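(* Let $X=\prod_{i=1}^p X_i$ be an arm space with trees $\mathcal T_i$ over $X_i$, $i=1,\dots,p$, as described in the context, and suppose the trees $\mathcal T_i$ have no leaf nodes. Fix $\beta\ge0$. For all large enough $\kappa,\lambda>0$ and all small enough $\gamma,\varepsilon\in(0,1)$, there is a rate $r_T$ with \[ r_T\gtrsim T^{-1/(\beta+2)} \] such that, for any strategy for the tree-armed bandit problem on $X$ and any $T\in\mathbb N$, there are events $E_T$ and $E_T'$, each of probability at least $\varepsilon$ under some $P\in\mathcal P(X,\mathcal T,\beta,\gamma,\kappa,\lambda)$ (the $P$ may depend on the strategy and on $T$, and may differ for the two events), for which \[ R_T\ge T r_T\ \text{ on } E_T,\qquad S_T\ge r_T\ \text{ on } E_T'. \]
   Context: **Tree structure.** $X=\prod_{i=1}^pX_i$. For each $i$, $\mathcal T_i$ is a tree with root $X_i$, whose nodes are non-empty subsets of $X_i$; each node $U$ is either a leaf or has children forming a partition of $U$; each non-leaf node has at least $2$ and at most $q$ children ($q\in\mathbb N$ constant). $\mathcal E_i$ is the $\sigma$-algebra on $X_i$ generated by the nodes of $\mathcal T_i$; $\mathcal E$ is the product $\sigma$-algebra on $X$. **Bandit problem.** For each $x\in X$ there is an unknown distribution $P(x)$ on $[0,1]$ with mean $\mu(x)$. There are rewards $Y_t\in[0,1]$ and randomisation variables $Z_t\in Z$ ($t\in\mathbb N$, $Z$ a measurable space). At time $t$: $Z_t$ is independent of past events; the arm $x_t\in X$ is an $\mathcal E$-measurable function of $Y_1,\dots,Y_{t-1},Z_1,\dots,Z_t$;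 $Y_t$ has distribution $P(x_t)$ conditionally on past events and $Z_t$. After $T$ steps an estimated maximum $\hat x_T\in X$ is returned, an $\mathcal E$-measurable function of $Y_1,\dots,Y_T,Z_1,\dots,Z_T$ and an independent randomisation variable $\hat Z_T\in Z$. A strategy consists of the functions $x_t,\hat x_T$ and the distributions of $Z_t,\hat Z_T$. With $\mu^*=\sup_X\mu$, $R_T=\sum_{t=1}^T(\mu^*-\mu(x_t))$ and $S_T=\mu^*-\mu(\hat x_T)$. **Boxes and $\pi$.** A box is a product $B=\prod_{i=1}^pU_i$ with $U_i$ a node of $\mathcal T_i$; $\mathcal B$ is the set of boxes. The depth $d(B)$ is the maximum over $i$ of the depth of $U_i$ in $\mathcal T_i$ (roots have depth $0$). $\pi=\prod_i\pi_i$, where $\pi_i$ is the distribution on $(X_i,\mathcal E_i)$ determined by: for each node $U$ of $\mathcal T_i$, $\pi_i(U)$ is the probability that $U$ is visited by a random descent of $\mathcal T_i$ which starts at the root and at each non-leaf node moves to a uniformly random child. (It is assumed that this defines a unique distribution.) For $\mu:X\to[0,1]$ and a box $B$: $W(B)=\sup_B\mu-\inf_B\mu$, $\mu(B)=\mathbb E_\pi[\mu(x)\mid x\in B]$, $\delta(B)=\mu^*-\inf_B\mu$. For $\delta>0$, $\mathcal X_\delta=\{x\in X:\mu^*-\mu(x)\le\delta\}$. **Collections.** For a collection $\mathcal C$ of disjoint boxes, a box $B$ is on $\mathcal C$ if it is a union of boxes in $\mathcal C$; $\mathcal C$ is a refinement of $\mathcal C'$ if every $B\in\mathcal C'$ is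 on $\mathcal C$. A grid is a set $\{\prod_{i=1}^pU_i:U_i\in\mathcal S_i\}$ where each $\mathcal S_i$ is a collection of disjoint nodes of $\mathcal T_i$. Grids $\mathcal G_1,\dots,\mathcal G_L$ are separated if any box on $\bigcup_l\mathcal G_l$ is on a single $\mathcal G_l$. **Well-behaved.** An $\mathcal E$-measurable $\mu:X\to[0,1]$ is well-behaved, with zooming dimension $\beta\ge0$, quality $\gamma\in(0,1)$ and constants $\kappa,\lambda>0$, if for each $m\in\mathbb N$ there are a partition $\mathcal B_m$ of $X$ into boxes and a subset $\mathcal C_m\subseteq\mathcal B_m$ such that, with $\delta_m=2^{1-m}$: (i) $\mathcal X_{\delta_m}$ is covered by $\mathcal C_m$; (ii) $|\mathcal C_m|\le\kappa\delta_m^{-\beta}$; (iii) every $B\in\mathcal C_m$ satisfies $W(B)\le\delta_m/(12p)$ and $d(B)\le\lambda m$; (iv) for each box $B$ on some $\mathcal C_m$ there are boxes $C_1,C_2\subseteq B$ which agree except along one axis (i.e. for some $i$, $C_k=U_1\times\cdots\times U_{i-1}\times U_{i,k}\times U_{i+1}\times\cdots\times U_p$, $k=1,2$, with $U_{i,k}\in\mathcal T_i$, $U_j\in\mathcal T_j$), with $\pi(C_k\mid B)\ge\gamma$ for $k=1,2$, and $\mu(C_1)-\mu(C_2)\ge\frac1p\left(W(B)-\frac14\delta(B)\right)$; (v) for each $m$ there are $L_m\in\mathbb N$ and separated grids $\mathcal G_{1,m},\dots,\mathcal G_{L_m,m}$ with $\mathcal C_m\subseteq\bigcup_{l=1}^{L_m}\mathcal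 G_{l,m}$; (vi) each $\mathcal B_{m+1}$ is a refinement of $\mathcal B_m$. **Class $\mathcal P$.** $\mathcal P(X,\mathcal T,\beta,\gamma,\kappa,\lambda)$ is the class of arm distributions $P=(P(x))_{x\in X}$ whose reward function $\mu$ is well-behaved with these constants. **Notation.** $f(T)\lesssim g(T)$ (equivalently $g(T)\gtrsim f(T)$) means $f(T)=O(g(T))$ as $T\to\infty$. *)

theory Defs
  imports "HOL-Probability.Probability" "HOL-Library.Landau_Symbols" "HOL-Library.Disjoint_Sets"
begin

section \<open>Trees\<close>

text \<open>
  A tree is given by its root and a map sending each node to the set of its children;
  leaves are the nodes without children. Children are disjoint and nonempty and there are at least
  two of them, so distinct nodes of a valid tree are distinct sets, and each node has one depth.
\<close>

record 'a arm_tree =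
  tree_root :: "'a set"
  tree_children :: "'a set \<Rightarrow> 'a set set"

inductive node_at :: "'a arm_tree \<Rightarrow> nat \<Rightarrow> 'a set \<Rightarrow> bool" for \<T> where
  root: "node_at \<T> 0 (tree_root \<T>)"
| child: "node_at \<T> n U \<Longrightarrow> V \<in> tree_children \<T> U \<Longrightarrow> node_at \<T> (Suc n) V"

definition tree_nodes :: "'a arm_tree \<Rightarrow> 'a set set" where
  "tree_nodes \<T> = {U. \<exists>n. node_at \<T> n U}"

definition node_depth :: "'a arm_tree \<Rightarrow> 'a set \<Rightarrow> nat" where
  "node_depth \<T> U = (LEAST n. node_at \<T> n U)"

definition is_leaf :: "'a arm_tree \<Rightarrow> 'a set \<Rightarrow> bool" where
  "is_leaf \<T> U \<longleftrightarrow> U \<in> tree_nodes \<T> \<and> tree_children \<T> U = {}"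

definition valid_tree :: "nat \<Rightarrow> 'a arm_tree \<Rightarrow> bool" where
  "valid_tree q \<T> \<longleftrightarrow> tree_root \<T> \<noteq> {} \<and>
     (\<forall>U\<in>tree_nodes \<T>. is_leaf \<T> U \<or>
        (partition_on U (tree_children \<T> U) \<and>
         2 \<le> card (tree_children \<T> U) \<and> card (tree_children \<T> U) \<le> q))"

definition tree_algebra :: "'a arm_tree \<Rightarrow> 'a measure" where
  "tree_algebra \<T> = sigma (tree_root \<T>) (tree_nodes \<T>)"

text \<open>The random descent stays at a leaf once it has reached one.\<close>

primrec descent :: "'a arm_tree \<Rightarrow> nat \<Rightarrow> 'a set pmf" where
  "descent \<T> 0 = return_pmf (tree_root \<T>)"
| "descent \<T> (Suc n) = bind_pmf (descent \<T> n)
     (\<lambda>U. if is_leaf \<T> U then return_pmf U else pmf_of_set (tree_children \<T> U))"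

text \<open>The descent can reach a node for the first time only at the step equal to its depth.\<close>

definition visit_prob :: "'a arm_tree \<Rightarrow> 'a set \<Rightarrow> real" where
  "visit_prob \<T> U = pmf (descent \<T> (node_depth \<T> U)) U"

definition is_descent_dist :: "'a arm_tree \<Rightarrow> 'a measure \<Rightarrow> bool" where
  "is_descent_dist \<T> M \<longleftrightarrow> prob_space M \<and> sets M = sets (tree_algebra \<T>) \<and>
     (\<forall>U\<in>tree_nodes \<T>. measure M U = visit_prob \<T> U)"

definition descent_dist :: "'a arm_tree \<Rightarrow> 'a measure" where
  "descent_dist \<T> = (THE M. is_descent_dist \<T> M)"


section \<open>Arm spaces and boxes\<close>

text \<open>
  The sets \<open>X\<^sub>1, \<dots>, X\<^sub>p\<close> are subsets of one type \<^typ>\<open>'a\<close>; as there are finitely many of them,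
  this is no restriction. Points of their product are functions on the index set \<open>{1..p}\<close>.
\<close>

definition arm_space :: "nat \<Rightarrow> (nat \<Rightarrow> 'a arm_tree) \<Rightarrow> (nat \<Rightarrow> 'a) set" where
  "arm_space p \<T> = (\<Pi>\<^sub>E i\<in>{1..p}. tree_root (\<T> i))"

definition arm_algebra :: "nat \<Rightarrow> (nat \<Rightarrow> 'a arm_tree) \<Rightarrow> (nat \<Rightarrow> 'a) measure" where
  "arm_algebra p \<T> = (\<Pi>\<^sub>M i\<in>{1..p}. tree_algebra (\<T> i))"

definition arm_dist :: "nat \<Rightarrow> (nat \<Rightarrow> 'a arm_tree) \<Rightarrow> (nat \<Rightarrow> 'a) measure" where
  "arm_dist p \<T> = (\<Pi>\<^sub>M i\<in>{1..p}. descent_dist (\<T> i))"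

definition boxes :: "nat \<Rightarrow> (nat \<Rightarrow> 'a arm_tree) \<Rightarrow> (nat \<Rightarrow> 'a) set set" where
  "boxes p \<T> = {Pi\<^sub>E {1..p} U | U. \<forall>i\<in>{1..p}. U i \<in> tree_nodes (\<T> i)}"

text \<open>A box is a nonempty product, so its side along axis \<open>i\<close> is its projection.\<close>

definition box_depth :: "nat \<Rightarrow> (nat \<Rightarrow> 'a arm_tree) \<Rightarrow> (nat \<Rightarrow> 'a) set \<Rightarrow> nat" where
  "box_depth p \<T> B = Max ((\<lambda>i. node_depth (\<T> i) ((\<lambda>x. x i) ` B)) ` {1..p})"

definition is_on ::
  "nat \<Rightarrow> (nat \<Rightarrow> 'a arm_tree) \<Rightarrow> (nat \<Rightarrow> 'a) set set \<Rightarrow> (nat \<Rightarrow> 'a) set \<Rightarrow> bool" where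
  "is_on p \<T> \<C> B \<longleftrightarrow> B \<in> boxes p \<T> \<and> (\<exists>\<D>\<subseteq>\<C>. B = \<Union>\<D>)"

definition is_refinement ::
  "nat \<Rightarrow> (nat \<Rightarrow> 'a arm_tree) \<Rightarrow> (nat \<Rightarrow> 'a) set set \<Rightarrow> (nat \<Rightarrow> 'a) set set \<Rightarrow> bool" where
  "is_refinement p \<T> \<C> \<C>' \<longleftrightarrow> (\<forall>B\<in>\<C>'. is_on p \<T> \<C> B)"

definition is_grid :: "nat \<Rightarrow> (nat \<Rightarrow> 'a arm_tree) \<Rightarrow> (nat \<Rightarrow> 'a) set set \<Rightarrow> bool" where
  "is_grid p \<T> \<G> \<longleftrightarrow> (\<exists>S. (\<forall>i\<in>{1..p}. S i \<subseteq> tree_nodes (\<T> i) \<and> disjoint (S i)) \<and>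
     \<G> = {Pi\<^sub>E {1..p} U | U. \<forall>i\<in>{1..p}. U i \<in> S i})"

text \<open>
  Being on a collection is a notion for collections of disjoint boxes, so the union
  of separated grids is required to be such a collection.
\<close>

definition separated ::
  "nat \<Rightarrow> (nat \<Rightarrow> 'a arm_tree) \<Rightarrow> nat \<Rightarrow> (nat \<Rightarrow> (nat \<Rightarrow> 'a) set set) \<Rightarrow> bool" where
  "separated p \<T> L \<G> \<longleftrightarrow> disjoint (\<Union>l\<in>{1..L}. \<G> l) \<and>
     (\<forall>B. is_on p \<T> (\<Union>l\<in>{1..L}. \<G> l) B \<longrightarrow> (\<exists>l\<in>{1..L}. is_on p \<T> (\<G> l) B))"


section \<open>Well-behaved reward functions\<close>

context
  fixes p :: nat and \<T> :: "nat \<Rightarrow> 'a arm_tree" and \<mu> :: "(nat \<Rightarrow> 'a) \<Rightarrow> real"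
begin

definition max_reward :: real where
  "max_reward = (SUP x\<in>arm_space p \<T>. \<mu> x)"

definition box_width :: "(nat \<Rightarrow> 'a) set \<Rightarrow> real" where
  "box_width B = (SUP x\<in>B. \<mu> x) - (INF x\<in>B. \<mu> x)"

definition box_mean :: "(nat \<Rightarrow> 'a) set \<Rightarrow> real" where
  "box_mean B = (LINT x:B|arm_dist p \<T>. \<mu> x) / measure (arm_dist p \<T>) B"

definition box_gap :: "(nat \<Rightarrow> 'a) set \<Rightarrow> real" where
  "box_gap B = max_reward - (INF x\<in>B. \<mu> x)"

definition near_optimal :: "real \<Rightarrow> (nat \<Rightarrow> 'a) set" where
  "near_optimal \<delta> = {x \<in> arm_space p \<T>. max_reward - \<mu> x \<le> \<delta>}"

definition well_behaved :: "real \<Rightarrow> real \<Rightarrow> real \<Rightarrow> real \<Rightarrow> bool" where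
  "well_behaved \<beta> \<gamma> \<kappa> \<Lambda> \<longleftrightarrow>
     \<mu> \<in> borel_measurable (arm_algebra p \<T>) \<and> (\<forall>x\<in>arm_space p \<T>. \<mu> x \<in> {0..1}) \<and>
     0 \<le> \<beta> \<and> 0 < \<gamma> \<and> \<gamma> < 1 \<and> 0 < \<kappa> \<and> 0 < \<Lambda> \<and>
     (\<exists>\<B> \<C>. \<forall>m\<ge>1. let \<delta> = 2 powr (1 - real m) in
        partition_on (arm_space p \<T>) (\<B> m) \<and> \<B> m \<subseteq> boxes p \<T> \<and> \<C> m \<subseteq> \<B> m \<and>
        near_optimal \<delta> \<subseteq> \<Union>(\<C> m) \<and>
        finite (\<C> m) \<and> real (card (\<C> m)) \<le> \<kappa> * \<delta> powr (-\<beta>) \<and>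
        (\<forall>B\<in>\<C> m. box_width B \<le> \<delta> / (12 * real p) \<and> real (box_depth p \<T> B) \<le> \<Lambda> * real m) \<and>
        (\<forall>B. is_on p \<T> (\<C> m) B \<longrightarrow>
          (\<exists>i\<in>{1..p}. \<exists>U V\<^sub>1 V\<^sub>2. let C\<^sub>1 = Pi\<^sub>E {1..p} (U(i := V\<^sub>1)); C\<^sub>2 = Pi\<^sub>E {1..p} (U(i := V\<^sub>2)) in
             C\<^sub>1 \<in> boxes p \<T> \<and> C\<^sub>1 \<subseteq> B \<and> C\<^sub>2 \<in> boxes p \<T> \<and> C\<^sub>2 \<subseteq> B \<and>
             \<P>(x in arm_dist p \<T>. x \<in> C\<^sub>1 \<bar> x \<in> B) \<ge> \<gamma> \<and>
             \<P>(x in arm_dist p \<T>. x \<in> C\<^sub>2 \<bar> x \<in> B) \<ge> \<gamma> \<and>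
             box_mean C\<^sub>1 - box_mean C\<^sub>2 \<ge> 1 / real p * (box_width B - 1 / 4 * box_gap B))) \<and>
        (\<exists>L \<G>. (\<forall>l\<in>{1..L}. is_grid p \<T> (\<G> l)) \<and> separated p \<T> L \<G> \<and>
           \<C> m \<subseteq> (\<Union>l\<in>{1..L}. \<G> l)) \<and>
        is_refinement p \<T> (\<B> (Suc m)) (\<B> m))"

end


section \<open>The bandit problem\<close>

abbreviation reward_space :: "real measure" where
  "reward_space \<equiv> restrict_space borel {0..1}"

definition mean_reward :: "('b \<Rightarrow> real measure) \<Rightarrow> 'b \<Rightarrow> real" where
  "mean_reward P x = (\<integral>y. y \<partial>P x)"

text \<open>
  The arm distributions have to form a Markov kernel for the conditional law of a reward
  given a randomly chosen arm to make sense.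
\<close>

definition arm_dists ::
  "nat \<Rightarrow> (nat \<Rightarrow> 'a arm_tree) \<Rightarrow> real \<Rightarrow> real \<Rightarrow> real \<Rightarrow> real \<Rightarrow> ((nat \<Rightarrow> 'a) \<Rightarrow> real measure) set" where
  "arm_dists p \<T> \<beta> \<gamma> \<kappa> \<Lambda> = {P. P \<in> arm_algebra p \<T> \<rightarrow>\<^sub>M prob_algebra reward_space \<and>
     well_behaved p \<T> (mean_reward P) \<beta> \<gamma> \<kappa> \<Lambda>}"

text \<open>
  \<open>arm S t\<close> takes the rewards \<open>Y\<^sub>1, \<dots>, Y\<^sub>t\<^sub>-\<^sub>1\<close> and the randomisation variables
  \<open>Z\<^sub>1, \<dots>, Z\<^sub>t\<close>; \<open>final_arm S T\<close> takes \<open>Y\<^sub>1, \<dots>, Y\<^sub>T\<close>, \<open>Z\<^sub>1, \<dots>, Z\<^sub>T\<close> and the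
  final randomisation variable for horizon \<open>T\<close>.
\<close>

record ('a, 'z) strategy =
  rand_space :: "'z measure"
  rand_dist :: "nat \<Rightarrow> 'z measure"
  final_rand_dist :: "nat \<Rightarrow> 'z measure"
  arm :: "nat \<Rightarrow> (nat \<Rightarrow> real) \<Rightarrow> (nat \<Rightarrow> 'z) \<Rightarrow> nat \<Rightarrow> 'a"
  final_arm :: "nat \<Rightarrow> (nat \<Rightarrow> real) \<Rightarrow> (nat \<Rightarrow> 'z) \<Rightarrow> 'z \<Rightarrow> nat \<Rightarrow> 'a"

definition is_strategy :: "nat \<Rightarrow> (nat \<Rightarrow> 'a arm_tree) \<Rightarrow> ('a, 'z) strategy \<Rightarrow> bool" where
  "is_strategy p \<T> S \<longleftrightarrow> (\<forall>t\<ge>1.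
     rand_dist S t \<in> space (prob_algebra (rand_space S)) \<and>
     final_rand_dist S t \<in> space (prob_algebra (rand_space S)) \<and>
     (\<lambda>(y, z). arm S t y z) \<in>
       (\<Pi>\<^sub>M s\<in>{1..<t}. reward_space) \<Otimes>\<^sub>M (\<Pi>\<^sub>M s\<in>{1..t}. rand_space S) \<rightarrow>\<^sub>M arm_algebra p \<T> \<and>
     (\<lambda>((y, z), w). final_arm S t y z w) \<in>
       ((\<Pi>\<^sub>M s\<in>{1..t}. reward_space) \<Otimes>\<^sub>M (\<Pi>\<^sub>M s\<in>{1..t}. rand_space S)) \<Otimes>\<^sub>M rand_space S
         \<rightarrow>\<^sub>M arm_algebra p \<T>)"

context
  fixes P :: "(nat \<Rightarrow> 'a) \<Rightarrow> real measure" and S :: "('a, 'z) strategy"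
begin

abbreviation history_space :: "nat \<Rightarrow> ((nat \<Rightarrow> real) \<times> (nat \<Rightarrow> 'z)) measure" where
  "history_space t \<equiv> (\<Pi>\<^sub>M s\<in>{1..t}. reward_space) \<Otimes>\<^sub>M (\<Pi>\<^sub>M s\<in>{1..t}. rand_space S)"

text \<open>The joint law of \<open>(Y\<^sub>1, \<dots>, Y\<^sub>t)\<close> and \<open>(Z\<^sub>1, \<dots>, Z\<^sub>t)\<close>.\<close>

primrec history_law :: "nat \<Rightarrow> ((nat \<Rightarrow> real) \<times> (nat \<Rightarrow> 'z)) measure" where
  "history_law 0 = return (history_space 0) (\<lambda>_. undefined, \<lambda>_. undefined)"
| "history_law (Suc t) =
     do {
       (y, z) \<leftarrow> history_law t;
       z\<^sub>t \<leftarrow> rand_dist S (Suc t);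
       y\<^sub>t \<leftarrow> P (arm S (Suc t) y (z(Suc t := z\<^sub>t)));
       return (history_space (Suc t)) (y(Suc t := y\<^sub>t), z(Suc t := z\<^sub>t))
     }"

text \<open>The joint law of the history up to time \<open>T\<close> and the final randomisation variable.\<close>

definition bandit_law :: "nat \<Rightarrow> (((nat \<Rightarrow> real) \<times> (nat \<Rightarrow> 'z)) \<times> 'z) measure" where
  "bandit_law T = history_law T \<Otimes>\<^sub>M final_rand_dist S T"

definition played_arm ::
  "nat \<Rightarrow> ((nat \<Rightarrow> real) \<times> (nat \<Rightarrow> 'z)) \<times> 'z \<Rightarrow> nat \<Rightarrow> 'a" where
  "played_arm t = (\<lambda>((y, z), w). arm S t (restrict y {1..<t}) (restrict z {1..t}))"

definition returned_arm ::
  "nat \<Rightarrow> ((nat \<Rightarrow> real) \<times> (nat \<Rightarrow> 'z)) \<times> 'z \<Rightarrow> nat \<Rightarrow> 'a" where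
  "returned_arm T = (\<lambda>((y, z), w). final_arm S T y z w)"

definition cumulative_regret ::
  "nat \<Rightarrow> (nat \<Rightarrow> 'a arm_tree) \<Rightarrow> nat \<Rightarrow> ((nat \<Rightarrow> real) \<times> (nat \<Rightarrow> 'z)) \<times> 'z \<Rightarrow> real" where
  "cumulative_regret p \<T> T \<omega> =
     (\<Sum>t=1..T. max_reward p \<T> (mean_reward P) - mean_reward P (played_arm t \<omega>))"

definition simple_regret ::
  "nat \<Rightarrow> (nat \<Rightarrow> 'a arm_tree) \<Rightarrow> nat \<Rightarrow> ((nat \<Rightarrow> real) \<times> (nat \<Rightarrow> 'z)) \<times> 'z \<Rightarrow> real" where
  "simple_regret p \<T> T \<omega> =
     max_reward p \<T> (mean_reward P) - mean_reward P (returned_arm T \<omega>)"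

end

text \<open>The kernels composed in \<^const>\<open>history_law\<close> are measurable, so its monadic composition is meaningful.\<close>

lemma history_law_prob:
  assumes S: "is_strategy p \<T> S" and P: "P \<in> arm_algebra p \<T> \<rightarrow>\<^sub>M prob_algebra reward_space"
  shows "history_law P S t \<in> space (prob_algebra (history_space S t))"
proof (induction t)
  case 0
  then show ?case
    by (auto simp: space_prob_algebra space_pair_measure space_PiM intro!: prob_space_return)
next
  case (Suc t)
  let ?Z = "rand_space S"
  let ?ZP = "history_space S t \<Otimes>\<^sub>M ?Z"
  have I: "{1..Suc t} = insert (Suc t) {1..t}" "{1..<Suc t} = {1..t}" by auto
  have zupd: "(\<lambda>((y,z),w). z(Suc t := w)) \<in> ?ZP \<rightarrow>\<^sub>M (\<Pi>\<^sub>M s\<in>{1..Suc t}. ?Z)"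
    unfolding I split_beta'
    by (rule measurable_compose[OF _ measurable_add_dim, where f="\<lambda>x. (snd (fst x), snd x)", simplified]) measurable
  have arm: "(\<lambda>(y, z). arm S (Suc t) y z) \<in>
       (\<Pi>\<^sub>M s\<in>{1..t}. reward_space) \<Otimes>\<^sub>M (\<Pi>\<^sub>M s\<in>{1..Suc t}. ?Z) \<rightarrow>\<^sub>M arm_algebra p \<T>"
    using S unfolding is_strategy_def by (metis I(2) le_add1 plus_1_eq_Suc)
  have rd: "rand_dist S (Suc t) \<in> space (prob_algebra ?Z)"
    using S unfolding is_strategy_def by (metis le_add1 plus_1_eq_Suc)
  have arm': "(\<lambda>((y,z),w). P (arm S (Suc t) y (z(Suc t := w)))) \<in> ?ZP \<rightarrow>\<^sub>M prob_algebra reward_space"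
  proof -
    have "(\<lambda>((y,z),w). (y, z(Suc t := w))) \<in> ?ZP \<rightarrow>\<^sub>M (\<Pi>\<^sub>M s\<in>{1..t}. reward_space) \<Otimes>\<^sub>M (\<Pi>\<^sub>M s\<in>{1..Suc t}. ?Z)"
      using zupd unfolding split_beta' by measurable
    from measurable_compose[OF measurable_compose[OF this arm] P] show ?thesis
      by (simp add: split_beta')
  qed
  have ret: "(\<lambda>(((y,z),w),v). return (history_space S (Suc t)) (y(Suc t := v), z(Suc t := w)))
     \<in> ?ZP \<Otimes>\<^sub>M reward_space \<rightarrow>\<^sub>M prob_algebra (history_space S (Suc t))"
  proof -
    have a: "(\<lambda>(((y,z),w),v). y(Suc t := v)) \<in> ?ZP \<Otimes>\<^sub>M reward_space \<rightarrow>\<^sub>M (\<Pi>\<^sub>M s\<in>{1..Suc t}. reward_space)"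
      unfolding I split_beta'
      by (rule measurable_compose[OF _ measurable_add_dim, where f="\<lambda>x. (fst (fst (fst x)), snd x)", simplified]) measurable
    have b: "(\<lambda>(((y,z),w),v). z(Suc t := w)) \<in> ?ZP \<Otimes>\<^sub>M reward_space \<rightarrow>\<^sub>M (\<Pi>\<^sub>M s\<in>{1..Suc t}. ?Z)"
      using measurable_compose[OF measurable_fst zupd] by (simp add: split_beta')
    have "(\<lambda>(((y,z),w),v). (y(Suc t := v), z(Suc t := w))) \<in> ?ZP \<Otimes>\<^sub>M reward_space \<rightarrow>\<^sub>M history_space S (Suc t)"
      using measurable_Pair[OF a b] by (simp add: split_beta')
    from measurable_compose[OF this measurable_return_prob_space] show ?thesis by (simp add: split_beta')
  qed
  have inner: "(\<lambda>((y,z),w). P (arm S (Suc t) y (z(Suc t := w))) \<bind> 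
        (\<lambda>v. return (history_space S (Suc t)) (y(Suc t := v), z(Suc t := w))))
     \<in> ?ZP \<rightarrow>\<^sub>M prob_algebra (history_space S (Suc t))"
    using measurable_bind_prob_space2[OF arm'] ret by (simp add: split_beta')
  have mid: "(\<lambda>(y,z). rand_dist S (Suc t) \<bind> (\<lambda>w. P (arm S (Suc t) y (z(Suc t := w))) \<bind> 
        (\<lambda>v. return (history_space S (Suc t)) (y(Suc t := v), z(Suc t := w)))))
     \<in> history_space S t \<rightarrow>\<^sub>M prob_algebra (history_space S (Suc t))"
    using measurable_bind_prob_space2[where M="history_space S t" and f="\<lambda>_. rand_dist S (Suc t)" and N="?Z"
       and g="\<lambda>h w. P (arm S (Suc t) (fst h) ((snd h)(Suc t := w))) \<bind> 
        (\<lambda>v. return (history_space S (Suc t)) ((fst h)(Suc t := v), (snd h)(Suc t := w)))"] inner rd 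
    by (simp add: split_beta')
  show ?case
    using measurable_bind_prob_space[where f="\<lambda>_. history_law P S t" and M="count_space (UNIV::unit set)", OF _ mid] Suc
    by (auto simp: measurable_count_space_eq1 split_beta' Pi_iff)
qed

end

theory Submission
  imports Defs
begin

text \<open>
  All rewards used depend on the first coordinate only, which reduces the problem to one tree. In that
  tree, nested sets \<open>A 0 \<supseteq> A 1 \<supseteq> \<dots> \<supseteq> A (Suc K)\<close> are chosen such that \<open>A k\<close> consists of
  \<open>a powr (- \<beta> * k)\<close> nodes for \<open>k \<le> K\<close> and the needle \<open>A (Suc K)\<close> is one node. Points which leave the
  sequence after \<open>A k\<close> lie below the maximum by an amount proportional to \<open>a ^ k\<close>. As \<open>a \<le> 1 / 4\<close> and
  every node of \<open>A (Suc k)\<close> has a sibling outside of it, such a reward is well-behaved.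

  There are at least \<open>4 * a powr (- \<beta> * K)\<close> disjoint candidates for the needle. If the needle is removed,
  some candidate is both rarely played and rarely returned. A likelihood ratio argument shows that
  inserting that needle changes the law of the history only little as long as
  \<open>T * a powr ((\<beta> + 2) * K)\<close> is below a constant, and choosing the smallest such \<open>K\<close> gives the rate.
\<close>

section \<open>Leafless trees\<close>

text \<open>Detecting a bump of height about \<open>a ^ K\<close> takes about
  \<open>a powr (- 2 * K)\<close> plays on it, and about \<open>a powr (- \<beta> * K)\<close>
  places compete for these plays; this is where \<beta> + 2 comes from. The obstacle is that a
  reward must be well-behaved at all scales. A single deep bump on a flat background would fail
  condition (iv) on the root box: every subbox of conditional probability at least \<gamma> would
  have nearly the same mean. With geometric decay of ratio at most 1/4, what remains inside the next
  level is absorbed by the term \<open>box_gap / 4\<close>, and the sibling outside supplies the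
  second subbox of non-negligible probability. The trees guarantee only two children per node, so
  node counts can be controlled only by powers of 2. A real \<beta> is matched by solving
  \<open>a powr (- \<beta>) = 2 ^ n\<close> for \<open>a\<close> instead of rounding counts. The
  reward without a needle is only a reference law; the distributions exhibited in the class all
  contain a needle. Both events are found under the same distribution.\<close>

locale leafless_tree =
  fixes q :: nat and \<T> :: "'a arm_tree"
  assumes valid: "valid_tree q \<T>" and leafless: "\<not> is_leaf \<T> U"
begin

lemma node_at_tree_nodes: "node_at \<T> n U \<Longrightarrow> U \<in> tree_nodes \<T>"
  by (auto simp: tree_nodes_def)

lemma children:
  assumes "node_at \<T> n U"
  shows "partition_on U (tree_children \<T> U)" "2 \<le> card (tree_children \<T> U)"
    "card (tree_children \<T> U) \<le> q" "finite (tree_children \<T> U)"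
proof -
  show *: "partition_on U (tree_children \<T> U)" "2 \<le> card (tree_children \<T> U)"
    "card (tree_children \<T> U) \<le> q"
    using valid leafless node_at_tree_nodes[OF assms] unfolding valid_tree_def by blast+
  show "finite (tree_children \<T> U)"
    using *(2) by (metis card.infinite not_numeral_le_zero)
qed

lemma q_ge_2: "2 \<le> q"
  using children(2,3)[OF node_at.root] by linarith

lemma child_subset:
  assumes "node_at \<T> n U" "V \<in> tree_children \<T> U"
  shows "V \<subseteq> U" "V \<noteq> {}"
  using children(1)[OF assms(1)] assms(2) by (auto simp: partition_on_def)

lemma node_at_Suc_cases:
  assumes "node_at \<T> (Suc n) V"
  obtains U where "node_at \<T> n U" "V \<in> tree_children \<T> U"
  using assms by (cases rule: node_at.cases) auto

lemma node_at_nonempty: "node_at \<T> n U \<Longrightarrow> U \<noteq> {}"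
proof (induction rule: node_at.induct)
  case root
  then show ?case using valid by (simp add: valid_tree_def)
qed (use child_subset in blast)

lemma ancestor_exists:
  assumes "node_at \<T> (n + i) V"
  shows "\<exists>U. node_at \<T> n U \<and> V \<subseteq> U"
  using assms
proof (induction i arbitrary: V)
  case (Suc i)
  then have "node_at \<T> (Suc (n + i)) V" by simp
  then obtain U where U: "node_at \<T> (n + i) U" "V \<in> tree_children \<T> U"
    by (rule node_at_Suc_cases)
  then show ?case using Suc.IH[OF U(1)] child_subset[OF U] by blast
qed auto

lemma node_at_subset_root: "node_at \<T> n U \<Longrightarrow> U \<subseteq> tree_root \<T>"
  by (induction rule: node_at.induct) (use child_subset(1) in blast)+

text \<open>Overlapping nodes of equal depth have overlapping parents, hence by induction the same
  parent, whose children form a partition.\<close>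

lemma node_at_eq_or_disjoint:
  assumes "node_at \<T> n U" "node_at \<T> n V" "U \<inter> V \<noteq> {}"
  shows "U = V"
  using assms
proof (induction n arbitrary: U V)
  case 0
  have "U = tree_root \<T>" "V = tree_root \<T>"
    using 0(1,2) by (auto elim: node_at.cases)
  then show ?case by simp
next
  case (Suc n)
  obtain U' where U': "node_at \<T> n U'" "U \<in> tree_children \<T> U'"
    using Suc.prems(1) by (rule node_at_Suc_cases)
  obtain V' where V': "node_at \<T> n V'" "V \<in> tree_children \<T> V'"
    using Suc.prems(2) by (rule node_at_Suc_cases)
  have "U' \<inter> V' \<noteq> {}"
    using child_subset(1)[OF U'] child_subset(1)[OF V'] Suc.prems(3) by blast
  then have "U' = V'" using Suc.IH U' V' by blast
  then show ?case
    using children(1)[OF U'(1)] U'(2) V'(2) Suc.prems(3)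
    by (auto simp: partition_on_def disjoint_def)
qed

lemma node_at_nested:
  assumes "node_at \<T> n U" "node_at \<T> m V" "n \<le> m" "U \<inter> V \<noteq> {}"
  shows "V \<subseteq> U"
proof -
  obtain U' where U': "node_at \<T> n U'" "V \<subseteq> U'"
    using ancestor_exists[of n "m - n" V] assms by auto
  then have "U' \<inter> U \<noteq> {}" using assms(4) by blast
  then show ?thesis using node_at_eq_or_disjoint U' assms(1) by blast
qed

lemma child_psubset:
  assumes "node_at \<T> n U" "V \<in> tree_children \<T> U"
  shows "V \<subset> U"
proof -
  have "\<not> tree_children \<T> U \<subseteq> {V}"
    using children(2)[OF assms(1)] card_mono[of "{V}" "tree_children \<T> U"] by auto
  then obtain V' where V': "V' \<in> tree_children \<T> U" "V' \<noteq> V" by blast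
  then have "V \<inter> V' = {}" "V' \<noteq> {}" "V' \<subseteq> U"
    using children(1)[OF assms(1)] assms(2) by (auto simp: partition_on_def disjoint_def)
  then show ?thesis using child_subset[OF assms] by blast
qed

text \<open>If U also occurred at a larger depth, its parent W there would lie in a node of the
  smaller depth that meets U, that is, in U itself. But a child is strictly smaller than its parent,
  because there is a second non-empty child.\<close>

lemma node_at_depth_unique:
  assumes "node_at \<T> n U" "node_at \<T> m U"
  shows "n = m"
proof -
  have "\<not> n < m" if nU: "node_at \<T> n U" and mU: "node_at \<T> m U" for n m
  proof
    assume "n < m"
    then obtain i where i: "m = Suc (n + i)" by (metis less_iff_Suc_add)
    then obtain W where W: "node_at \<T> (n + i) W" "U \<in> tree_children \<T> W"
      using mU by (auto elim: node_at_Suc_cases)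
    obtain U' where U': "node_at \<T> n U'" "W \<subseteq> U'" using ancestor_exists[OF W(1)] by blast
    have "U \<subset> W" using child_psubset[OF W] .
    moreover have "U' = U"
      using node_at_eq_or_disjoint[OF U'(1) nU] U'(2) \<open>U \<subset> W\<close> node_at_nonempty[OF nU]
      by blast
    ultimately show False using U'(2) by blast
  qed
  then show ?thesis using assms by (meson linorder_neqE_nat)
qed

lemma node_depth_eq:
  assumes "node_at \<T> n U"
  shows "node_depth \<T> U = n"
  unfolding node_depth_def using assms node_at_depth_unique by (metis LeastI)

section \<open>Visit probabilities and numbers of descendants\<close>

lemma visit_prob_eq: "node_at \<T> n U \<Longrightarrow> visit_prob \<T> U = pmf (descent \<T> n) U"
  by (simp add: visit_prob_def node_depth_eq)

lemma visit_prob_root: "visit_prob \<T> (tree_root \<T>) = 1"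
  by (simp add: visit_prob_eq[OF node_at.root])

text \<open>Keeping only the descents that pass through U gives a lower bound, and a uniform choice
  among at most \<open>q\<close> children picks V with probability at least
  \<open>1 / q\<close>.\<close>

lemma visit_prob_child:
  assumes "node_at \<T> n U" "V \<in> tree_children \<T> U"
  shows "visit_prob \<T> U / q \<le> visit_prob \<T> V"
proof -
  let ?ch = "\<lambda>U. if is_leaf \<T> U then return_pmf U else pmf_of_set (tree_children \<T> U)"
  note ch = children[OF assms(1)]
  have "pmf (descent \<T> n) U * (1 / q) \<le> pmf (descent \<T> n) U * pmf (?ch U) V"
  proof (rule mult_left_mono)
    have "tree_children \<T> U \<noteq> {}" using assms(2) by blast
    then show "1 / real q \<le> pmf (?ch U) V"
      using ch assms(2) by (simp add: leafless frac_le)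
  qed simp
  also have "\<dots> = (\<integral>W. indicator {U} W * pmf (?ch W) V \<partial>descent \<T> n)"
    by (subst integral_measure_pmf_real[where A="{U}"]) (auto simp: indicator_eq_0_iff)
  also have "\<dots> \<le> (\<integral>W. pmf (?ch W) V \<partial>descent \<T> n)"
    by (intro integral_mono measure_pmf.integrable_const_bound[where B=1])
      (auto simp: pmf_le_1 split: split_indicator)
  also have "\<dots> = pmf (descent \<T> (Suc n)) V"
    by (simp add: pmf_bind)
  finally show ?thesis
    by (simp add: visit_prob_eq[OF assms(1)] visit_prob_eq[OF node_at.child[OF assms]])
qed

lemma visit_prob_descendant:
  assumes "node_at \<T> n U" "node_at \<T> (n + i) V" "V \<subseteq> U"
  shows "visit_prob \<T> U / q ^ i \<le> visit_prob \<T> V"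
  using assms(2,3)
proof (induction i arbitrary: V)
  case 0
  then have "V = U"
    using node_at_eq_or_disjoint[OF assms(1), of V] node_at_nonempty[of n V] by auto
  then show ?case by simp
next
  case (Suc i)
  have "node_at \<T> (Suc (n + i)) V" using Suc.prems by simp
  then obtain W where W: "node_at \<T> (n + i) W" "V \<in> tree_children \<T> W"
    by (rule node_at_Suc_cases)
  have "W \<inter> U \<noteq> {}" using child_subset[OF W] Suc.prems(2) by blast
  then have "W \<subseteq> U" using node_at_nested[OF assms(1) W(1)] by auto
  then have "visit_prob \<T> U / q ^ i \<le> visit_prob \<T> W" using Suc.IH W(1) by blast
  then have "visit_prob \<T> U / q ^ i / q \<le> visit_prob \<T> W / q"
    by (intro divide_right_mono) auto
  also have "\<dots> \<le> visit_prob \<T> V" by (rule visit_prob_child[OF W])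
  finally show ?case by (simp add: field_simps)
qed

lemma visit_prob_pos:
  assumes "node_at \<T> n U"
  shows "0 < visit_prob \<T> U"
proof -
  have "1 / real q ^ n \<le> visit_prob \<T> U"
    using visit_prob_descendant[OF node_at.root, of n U] node_at_subset_root[OF assms] assms
    by (simp add: visit_prob_root)
  moreover have "0 < 1 / real q ^ n" using q_ge_2 by simp
  ultimately show ?thesis by linarith
qed

lemma descendants_card:
  assumes "node_at \<T> n U"
  shows "finite {V. node_at \<T> (n + i) V \<and> V \<subseteq> U} \<and> card {V. node_at \<T> (n + i) V \<and> V \<subseteq> U} \<le> q ^ i"
proof (induction i)
  case 0
  have "{V. node_at \<T> (n + 0) V \<and> V \<subseteq> U} \<subseteq> {U}"
  proof
    fix V assume "V \<in> {V. node_at \<T> (n + 0) V \<and> V \<subseteq> U}"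
    then have "node_at \<T> n V" "V \<subseteq> U" by auto
    then show "V \<in> {U}"
      using node_at_eq_or_disjoint[OF assms] node_at_nonempty by (metis inf.absorb2 singletonI)
  qed
  then show ?case
    using card_mono[of "{U}" "{V. node_at \<T> (n + 0) V \<and> V \<subseteq> U}"]
      finite_subset[of _ "{U}"] by simp
next
  case (Suc i)
  let ?D = "\<lambda>i. {V. node_at \<T> (n + i) V \<and> V \<subseteq> U}"
  have sub: "?D (Suc i) \<subseteq> (\<Union>W\<in>?D i. tree_children \<T> W)"
  proof
    fix V assume "V \<in> ?D (Suc i)"
    then have V: "node_at \<T> (Suc (n + i)) V" "V \<subseteq> U" by auto
    obtain W where W: "node_at \<T> (n + i) W" "V \<in> tree_children \<T> W"
      using V(1) by (rule node_at_Suc_cases)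
    have "W \<inter> U \<noteq> {}" using child_subset[OF W] V(2) by blast
    then have "W \<subseteq> U" using node_at_nested[OF assms W(1)] by auto
    then show "V \<in> (\<Union>W\<in>?D i. tree_children \<T> W)" using W by blast
  qed
  have fin: "finite (\<Union>W\<in>?D i. tree_children \<T> W)"
    using Suc children(4) by auto
  have "card (\<Union>W\<in>?D i. tree_children \<T> W) \<le> (\<Sum>W\<in>?D i. card (tree_children \<T> W))"
    using Suc by (intro card_UN_le) auto
  also have "\<dots> \<le> (\<Sum>W\<in>?D i. q)" by (intro sum_mono) (use children(3) in auto)
  also have "\<dots> \<le> q ^ Suc i" using Suc by simp
  finally show ?case using card_mono[OF fin sub] finite_subset[OF sub fin] by simp
qed

lemma level_cover:
  assumes "x \<in> tree_root \<T>"
  shows "\<exists>U. node_at \<T> n U \<and> x \<in> U"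
proof (induction n)
  case 0
  then show ?case using node_at.root assms by metis
next
  case (Suc n)
  then obtain U where U: "node_at \<T> n U" "x \<in> U" by blast
  then have "x \<in> \<Union>(tree_children \<T> U)"
    using children(1)[OF U(1)] by (simp add: partition_on_def)
  then show ?case using node_at.child[OF U(1)] by blast
qed

lemma finite_level: "finite {V. node_at \<T> n V}"
proof -
  have "{V. node_at \<T> n V} \<subseteq> {V. node_at \<T> (0 + n) V \<and> V \<subseteq> tree_root \<T>}"
    using node_at_subset_root by auto
  then show ?thesis
    by (rule finite_subset) (use descendants_card[OF node_at.root, of n] in simp)
qed

lemma tree_nodes_subset_Pow: "tree_nodes \<T> \<subseteq> Pow (tree_root \<T>)"
  using node_at_subset_root by (auto simp: tree_nodes_def)

lemma space_tree_algebra: "space (tree_algebra \<T>) = tree_root \<T>"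
  unfolding tree_algebra_def using tree_nodes_subset_Pow by (rule space_measure_of)

lemma tree_nodes_sets: "U \<in> tree_nodes \<T> \<Longrightarrow> U \<in> sets (tree_algebra \<T>)"
  unfolding tree_algebra_def using tree_nodes_subset_Pow by (simp add: sigma_sets.Basic)

lemma node_at_sets: "node_at \<T> n U \<Longrightarrow> U \<in> sets (tree_algebra \<T>)"
  by (intro tree_nodes_sets node_at_tree_nodes)

section \<open>Cascades of nodes\<close>

definition left_child :: "'a set \<Rightarrow> 'a set" where
  "left_child U = (SOME V. V \<in> tree_children \<T> U)"

definition right_child :: "'a set \<Rightarrow> 'a set" where
  "right_child U = (SOME V. V \<in> tree_children \<T> U \<and> V \<noteq> left_child U)"

lemma left_right_child:
  assumes "node_at \<T> n U"
  shows "left_child U \<in> tree_children \<T> U" "right_child U \<in> tree_children \<T> U"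
    "left_child U \<inter> right_child U = {}"
proof -
  note ch = children[OF assms]
  have ne: "tree_children \<T> U \<noteq> {}" using ch(2) by auto
  show l: "left_child U \<in> tree_children \<T> U"
    unfolding left_child_def using ne by (simp add: some_in_eq)
  have "\<not> tree_children \<T> U \<subseteq> {left_child U}"
    using ch(2) card_mono[of "{left_child U}" "tree_children \<T> U"] by auto
  then have "\<exists>V. V \<in> tree_children \<T> U \<and> V \<noteq> left_child U" by blast
  then have r: "right_child U \<in> tree_children \<T> U \<and> right_child U \<noteq> left_child U"
    unfolding right_child_def by (rule someI_ex)
  then show "right_child U \<in> tree_children \<T> U" by simp
  show "left_child U \<inter> right_child U = {}"
    using r l ch(1) by (auto simp: partition_on_def disjoint_def)
qed

text \<open>A subtree with prescribed branching. Where \<open>b e\<close> is false the right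
  children are dropped, so each of them is a node outside the cascade with a sibling inside
  it.\<close>

primrec cascade :: "(nat \<Rightarrow> bool) \<Rightarrow> nat \<Rightarrow> 'a set set" where
  "cascade b 0 = {tree_root \<T>}"
| "cascade b (Suc e) =
    (if b e then left_child ` cascade b e \<union> right_child ` cascade b e else left_child ` cascade b e)"

lemma cascade_node_at: "U \<in> cascade b e \<Longrightarrow> node_at \<T> e U"
proof (induction e arbitrary: U)
  case 0
  then show ?case by (simp add: node_at.root)
next
  case (Suc e)
  then obtain W where W: "W \<in> cascade b e" "U = left_child W \<or> U = right_child W"
    by (auto split: if_splits)
  then have "U \<in> tree_children \<T> W"
    using left_right_child(1,2)[OF Suc.IH[OF W(1)]] by blast
  then show ?case by (rule node_at.child[OF Suc.IH[OF W(1)]])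
qed

lemma cascade_SucE:
  assumes "U \<in> cascade b (Suc e)"
  obtains W where "W \<in> cascade b e" "U \<in> tree_children \<T> W" "U = left_child W \<or> b e \<and> U = right_child W"
proof -
  obtain W where W: "W \<in> cascade b e" "U = left_child W \<or> b e \<and> U = right_child W"
    using assms by (auto split: if_splits)
  then have "U \<in> tree_children \<T> W"
    using left_right_child(1,2)[OF cascade_node_at[OF W(1)]] by blast
  then show ?thesis using that W by blast
qed

lemma finite_cascade: "finite (cascade b e)"
  by (induction e) auto

lemma cascade_Union_Suc: "\<Union>(cascade b (Suc e)) \<subseteq> \<Union>(cascade b e)"
proof
  fix x assume "x \<in> \<Union>(cascade b (Suc e))"
  then obtain U where U: "U \<in> cascade b (Suc e)" "x \<in> U" by blast
  obtain W where "W \<in> cascade b e" "U \<in> tree_children \<T> W"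
    using U(1) by (rule cascade_SucE)
  then show "x \<in> \<Union>(cascade b e)"
    using child_subset(1)[OF cascade_node_at] U(2) by blast
qed

lemma cascade_Union_antimono: "e \<le> e' \<Longrightarrow> \<Union>(cascade b e') \<subseteq> \<Union>(cascade b e)"
  by (rule lift_Suc_antimono_le[of "\<lambda>e. \<Union>(cascade b e)"]) (rule cascade_Union_Suc)

lemma cascade_children_disjoint:
  assumes "U \<in> cascade b e" "V \<in> cascade b e" "U \<noteq> V"
    "U' \<in> tree_children \<T> U" "V' \<in> tree_children \<T> V"
  shows "U' \<inter> V' = {}"
proof -
  have "U \<inter> V = {}"
    using node_at_eq_or_disjoint cascade_node_at assms(1-3) by blast
  then show ?thesis
    using child_subset(1)[OF cascade_node_at] assms by blast
qed

text \<open>Children of different nodes are disjoint and non-empty, so no two of the chosen children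
  coincide.\<close>

lemma card_cascade_Suc:
  "card (cascade b (Suc e)) = (if b e then 2 * card (cascade b e) else card (cascade b e))"
proof -
  let ?F = "cascade b e"
  have lr: "node_at \<T> e U" "left_child U \<in> tree_children \<T> U" "right_child U \<in> tree_children \<T> U"
    "left_child U \<inter> right_child U = {}" "left_child U \<noteq> {}" "right_child U \<noteq> {}" if "U \<in> ?F" for U
    using left_right_child cascade_node_at[OF that] child_subset(2) by auto
  have disj: "U' \<noteq> V'" if "U \<in> ?F" "V \<in> ?F" "U \<noteq> V" "U' \<in> tree_children \<T> U" "V' \<in> tree_children \<T> V"
    for U V U' V'
    using cascade_children_disjoint[OF that] child_subset(2)[OF lr(1)[OF that(1)] that(4)] by blast
  have inj: "inj_on left_child ?F" "inj_on right_child ?F"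
    by (rule inj_onI, use disj lr(2) in metis, rule inj_onI, use disj lr(3) in metis)
  have "left_child U \<noteq> right_child V" if "U \<in> ?F" "V \<in> ?F" for U V
    using disj[OF that _ lr(2)[OF that(1)] lr(3)[OF that(2)]] lr(4,5)[OF that(1)] by (cases "U = V") (auto simp: Int_absorb)
  then have "left_child ` ?F \<inter> right_child ` ?F = {}" by blast
  then show ?thesis
    using card_Un_disjoint[of "left_child ` ?F" "right_child ` ?F"] card_image[OF inj(1)]
      card_image[OF inj(2)] finite_cascade[of b e] by (simp only: cascade.simps finite_imageI mult_2 split: if_splits) simp
qed

lemma card_cascade_keep:
  assumes "\<And>j. j < i \<Longrightarrow> b (e + j)"
  shows "card (cascade b (e + i)) = 2 ^ i * card (cascade b e)"
  using assms by (induction i) (simp_all add: card_cascade_Suc del: cascade.simps)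

lemma card_cascade_thin:
  assumes "\<And>j. j < i \<Longrightarrow> \<not> b (e + j)"
  shows "card (cascade b (e + i)) = card (cascade b e)"
  using assms by (induction i) (simp_all add: card_cascade_Suc del: cascade.simps)

end

section \<open>Gap functions with nested levels\<close>

text \<open>
  The sets \<open>A k\<close> decrease to the needle \<open>A (Suc K)\<close>; a point lying in \<open>A k\<close> but not in
  \<open>A (Suc k)\<close> gets the gap \<open>a ^ k\<close>, and points in the needle get the gap 0.
\<close>

locale nested_levels = leafless_tree q \<T> for q and \<T> :: "'a arm_tree" +
  fixes s K :: nat and a \<beta> :: real and A :: "nat \<Rightarrow> 'a set"
  assumes s_pos: "0 < s" and \<beta>_nonneg: "0 \<le> \<beta>"
    and a_pos: "0 < a" and a_le: "a \<le> 1 / 4"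
    and A_0: "A 0 = tree_root \<T>"
    and A_Suc: "A (Suc k) \<subseteq> A k"
    and A_late: "Suc K < k \<Longrightarrow> A k = {}"
    and A_needle: "A (Suc K) \<noteq> {}"
    and A_nodes: "node_at \<T> (s * k) V \<Longrightarrow> V \<subseteq> A k \<or> V \<inter> A k = {}"
    and A_split: "node_at \<T> e W \<Longrightarrow> Suc e = s * Suc k \<Longrightarrow> W \<inter> A (Suc k) \<noteq> {} \<Longrightarrow>
      \<exists>V\<^sub>1\<in>tree_children \<T> W. \<exists>V\<^sub>2\<in>tree_children \<T> W. V\<^sub>1 \<subseteq> A (Suc k) \<and> V\<^sub>2 \<inter> A (Suc k) = {}"
    and A_card: "k \<le> Suc K \<Longrightarrow> real (card {V. node_at \<T> (s * k) V \<and> V \<subseteq> A k}) \<le> a powr (- \<beta> * real k)"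
begin

lemma A_antimono: "i \<le> k \<Longrightarrow> A k \<subseteq> A i"
  by (rule lift_Suc_antimono_le[of A]) (rule A_Suc)

definition level_gap :: "nat \<Rightarrow> real" where
  "level_gap k = (if k \<le> K then a ^ k else 0)"

text \<open>As a telescoping sum over nested indicators the gap is measurable at once, and the
  needle enters only through the last summand \<open>k = K\<close>.\<close>

definition gap :: "'a \<Rightarrow> real" where
  "gap x = 1 - (\<Sum>k\<le>K. (level_gap k - level_gap (Suc k)) * indicator (A (Suc k)) x)"

lemma level_gap_nonneg: "0 \<le> level_gap k"
  using a_pos by (simp add: level_gap_def)

lemma level_gap_0: "level_gap 0 = 1"
  by (simp add: level_gap_def)

text \<open>This is the place of \<open>a \<le> 1 / 4\<close>: the factor 4 matches the coefficient
  1/4 of \<open>box_gap\<close> in condition (iv).\<close>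

lemma level_gap_Suc: "level_gap (Suc k) \<le> level_gap k / 4"
  using a_pos mult_right_mono[OF a_le, of "a ^ k"] by (auto simp: level_gap_def)

lemma level_gap_Suc_le: "level_gap (Suc k) \<le> level_gap k"
  using level_gap_Suc[of k] level_gap_nonneg[of k] by linarith

lemma level_gap_telescope: "(\<Sum>i<k. level_gap i - level_gap (Suc i)) = 1 - level_gap k"
  using sum_lessThan_telescope'[of level_gap k] by (simp add: level_gap_0)

text \<open>By nestedness the first \<open>k\<close> indicators are all 1 and telescope to
  \<open>1 - level_gap k\<close>; the other summands are nonnegative and only lower the gap.\<close>

lemma gap_le:
  assumes "x \<in> A k"
  shows "gap x \<le> level_gap k"
proof -
  have k: "k \<le> Suc K" using assms A_late[of k] by (cases "Suc K < k") auto
  have mem: "x \<in> A (Suc i)" if "i < k" for i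
    using assms A_antimono[of "Suc i" k] that by auto
  have "1 - level_gap k = (\<Sum>i<k. (level_gap i - level_gap (Suc i)) * indicator (A (Suc i)) x)"
    unfolding level_gap_telescope[symmetric]
    by (intro sum.cong) (simp_all add: mem)
  also have "\<dots> \<le> (\<Sum>i\<le>K. (level_gap i - level_gap (Suc i)) * indicator (A (Suc i)) x)"
    using k level_gap_Suc_le by (intro sum_mono2) (auto simp: indicator_def)
  finally show ?thesis by (simp add: gap_def)
qed

text \<open>By nestedness every indicator from index \<open>k\<close> on vanishes, so at most the
  first \<open>k\<close> summands survive.\<close>

lemma gap_ge:
  assumes "x \<notin> A (Suc k)"
  shows "level_gap k \<le> gap x"
proof -
  have out: "x \<notin> A (Suc i)" if "\<not> i < k" for i
    using assms A_antimono[of "Suc k" "Suc i"] that by auto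
  have "(\<Sum>i\<le>K. (level_gap i - level_gap (Suc i)) * indicator (A (Suc i)) x) \<le>
      (\<Sum>i\<in>{..K} \<inter> {..<k}. level_gap i - level_gap (Suc i))"
    unfolding sum.inter_restrict[OF finite_atMost]
    using level_gap_Suc_le by (intro sum_mono) (auto simp: indicator_def out)
  also have "\<dots> \<le> (\<Sum>i<k. level_gap i - level_gap (Suc i))"
    using level_gap_Suc_le by (intro sum_mono2) auto
  finally show ?thesis by (simp add: gap_def level_gap_telescope)
qed

lemma gap_eq: "x \<in> A k \<Longrightarrow> x \<notin> A (Suc k) \<Longrightarrow> gap x = level_gap k"
  using gap_le gap_ge by (simp add: antisym)

lemma gap_nonneg: "0 \<le> gap x"
proof -
  \<comment> \<open>There is no level beyond the needle, so the lower bound applies with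
    \<open>level_gap (Suc K) = 0\<close>.\<close>
  have "x \<notin> A (Suc (Suc K))" using A_late by auto
  then show ?thesis using gap_ge level_gap_nonneg order_trans by blast
qed

lemma gap_needle: "x \<in> A (Suc K) \<Longrightarrow> gap x = 0"
  using gap_le[of x "Suc K"] gap_nonneg[of x] by (simp add: level_gap_def)

lemma gap_le_1: "gap x \<le> 1"
  unfolding gap_def using level_gap_Suc_le by (auto intro!: sum_nonneg)

section \<open>The gap on the nodes of the tree\<close>

lemma node_A:
  assumes "node_at \<T> e U" "s * k \<le> e"
  shows "U \<subseteq> A k \<or> U \<inter> A k = {}"
proof -
  obtain V where "node_at \<T> (s * k) V" "U \<subseteq> V"
    using ancestor_exists[of "s * k" "e - s * k" U] assms by auto
  then show ?thesis using A_nodes by blast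
qed

lemma A_covered:
  assumes "x \<in> A k" "s * k \<le> e"
  shows "\<exists>U. node_at \<T> e U \<and> x \<in> U \<and> U \<subseteq> A k"
proof -
  have "x \<in> tree_root \<T>" using assms(1) A_antimono[of 0 k] A_0 by auto
  then obtain U where "node_at \<T> e U" "x \<in> U" using level_cover by blast
  then show ?thesis using node_A assms by blast
qed

lemma A_sets: "A k \<in> sets (tree_algebra \<T>)"
proof -
  have "A k = \<Union>{V. node_at \<T> (s * k) V \<and> V \<subseteq> A k}"
    using A_covered[of _ k "s * k"] by blast
  moreover have "\<dots> \<in> sets (tree_algebra \<T>)"
    using finite_level[of "s * k"] node_at_sets by (intro sets.finite_Union) auto
  ultimately show ?thesis by simp
qed

lemma gap_measurable: "gap \<in> borel_measurable (tree_algebra \<T>)"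
  unfolding gap_def using A_sets by measurable

text \<open>Take the first \<open>j\<close> for which U misses \<open>A (Suc j)\<close>. Then U
  meets \<open>A j\<close>, and since \<open>j \<le> e div s\<close> it is deep enough to lie in
  \<open>A j\<close> entirely, so its gap is that of level \<open>j\<close>.\<close>

lemma gap_constant_on_node:
  assumes U: "node_at \<T> e U" and "U \<inter> A (Suc (e div s)) = {}"
  shows "\<exists>k. \<forall>x\<in>U. gap x = level_gap k"
proof -
  define j where "j = (LEAST j. U \<inter> A (Suc j) = {})"
  have j: "U \<inter> A (Suc j) = {}"
    unfolding j_def by (rule LeastI) (rule assms(2))
  have "j \<le> e div s" unfolding j_def by (rule Least_le) (rule assms(2))
  then have le: "s * j \<le> e"
    by (metis div_times_less_eq_dividend le_trans mult.commute mult_le_mono1)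
  have "U \<inter> A j \<noteq> {}"
  proof (cases j)
    case 0
    then show ?thesis using A_0 node_at_subset_root[OF U] node_at_nonempty[OF U] by auto
  next
    case (Suc i)
    then show ?thesis using not_less_Least[of i "\<lambda>j. U \<inter> A (Suc j) = {}"] by (auto simp: j_def)
  qed
  then have "U \<subseteq> A j" using node_A[OF U le] by blast
  then show ?thesis using j gap_eq by blast
qed

text \<open>The split is made not at U but at the end of its block: a descendant W one depth above
  the next multiple of \<open>s\<close> has a child inside and a child outside of the next level.
  This costs at most \<open>s\<close> depths, however large U is.\<close>

lemma node_splits:
  assumes U: "node_at \<T> e U" and meets: "U \<inter> A (Suc (e div s)) \<noteq> {}"
  obtains V\<^sub>1 V\<^sub>2 where "node_at \<T> (s * Suc (e div s)) V\<^sub>1" "node_at \<T> (s * Suc (e div s)) V\<^sub>2"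
    "V\<^sub>1 \<subseteq> U" "V\<^sub>2 \<subseteq> U" "V\<^sub>1 \<subseteq> A (Suc (e div s))" "V\<^sub>2 \<inter> A (Suc (e div s)) = {}" "U \<subseteq> A (e div s)"
proof -
  let ?k = "e div s"
  \<comment> \<open>W is taken at depth \<open>e'\<close>, so that its children have exactly the
    depth \<open>s * Suc ?k\<close> of the next level.\<close>
  obtain e' where e': "Suc e' = s * Suc ?k" using s_pos by (metis Suc_pred nat_0_less_mult_iff zero_less_Suc)
  have "e < s * Suc ?k" using s_pos by (simp add: dividend_less_times_div)
  then have le: "e \<le> e'" using e' by simp
  obtain x where x: "x \<in> U" "x \<in> A (Suc ?k)" using meets by blast
  obtain W where W: "node_at \<T> e' W" "x \<in> W" using level_cover node_at_subset_root[OF U] x(1) by blast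
  have "W \<subseteq> U" using node_at_nested[OF U W(1) le] x W by blast
  moreover obtain V\<^sub>1 V\<^sub>2 where V: "V\<^sub>1 \<in> tree_children \<T> W" "V\<^sub>2 \<in> tree_children \<T> W"
    "V\<^sub>1 \<subseteq> A (Suc ?k)" "V\<^sub>2 \<inter> A (Suc ?k) = {}"
    using A_split[OF W(1) e'] x W(2) by blast
  moreover have "node_at \<T> (s * Suc ?k) V" if "V \<in> tree_children \<T> W" for V
    using node_at.child[OF W(1) that] e' by simp
  moreover have "U \<subseteq> A ?k"
    using node_A[OF U, of ?k] x A_Suc[of ?k] by (auto simp: mult.commute)
  ultimately show ?thesis using that child_subset(1)[OF W(1)] by (meson order_trans)
qed

text \<open>Origin of the threshold \<open>1 / q ^ s\<close> for \<gamma>: the two subboxes of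
  condition (iv) are found within one block below the given node.\<close>

lemma visit_prob_near_descendant:
  assumes "node_at \<T> e U" "node_at \<T> d V" "V \<subseteq> U" "d \<le> e + s" "e \<le> d"
  shows "visit_prob \<T> U / q ^ s \<le> visit_prob \<T> V"
proof -
  have "visit_prob \<T> U / q ^ s \<le> visit_prob \<T> U / q ^ (d - e)"
    using assms(4) q_ge_2 visit_prob_pos[OF assms(1)]
    by (intro divide_left_mono power_increasing) auto
  also have "\<dots> \<le> visit_prob \<T> V"
    using visit_prob_descendant[OF assms(1), of "d - e" V] assms by simp
  finally show ?thesis .
qed

text \<open>
  On a node meeting the next level, \<open>V\<^sub>1\<close> lies in that level and \<open>V\<^sub>2\<close> just outside of it; on every
  other node the gap is constant, and \<open>V\<^sub>1 = V\<^sub>2 = U\<close>.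
\<close>

lemma node_contrast:
  assumes U: "node_at \<T> e U"
  obtains V\<^sub>1 V\<^sub>2 l u v where "V\<^sub>1 \<in> tree_nodes \<T>" "V\<^sub>2 \<in> tree_nodes \<T>" "V\<^sub>1 \<subseteq> U" "V\<^sub>2 \<subseteq> U"
    "visit_prob \<T> U / q ^ s \<le> visit_prob \<T> V\<^sub>1" "visit_prob \<T> U / q ^ s \<le> visit_prob \<T> V\<^sub>2"
    "\<And>x. x \<in> U \<Longrightarrow> l \<le> gap x \<and> gap x \<le> v" "\<And>x. x \<in> V\<^sub>1 \<Longrightarrow> gap x \<le> u" "\<And>x. x \<in> V\<^sub>2 \<Longrightarrow> gap x = v"
    "u \<le> v" "(v - l) - v / 4 \<le> v - u"
proof (cases "U \<inter> A (Suc (e div s)) = {}")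
  case True
  obtain k where "\<forall>x\<in>U. gap x = level_gap k"
    using gap_constant_on_node[OF U True] by blast
  then show ?thesis
    using that[of U U "level_gap k" "level_gap k" "level_gap k"] node_at_tree_nodes[OF U]
      visit_prob_near_descendant[OF U U] level_gap_nonneg[of k] by simp
next
  case False
  let ?k = "e div s"
  obtain V\<^sub>1 V\<^sub>2 where V: "node_at \<T> (s * Suc ?k) V\<^sub>1" "node_at \<T> (s * Suc ?k) V\<^sub>2"
    "V\<^sub>1 \<subseteq> U" "V\<^sub>2 \<subseteq> U" "V\<^sub>1 \<subseteq> A (Suc ?k)" "V\<^sub>2 \<inter> A (Suc ?k) = {}" "U \<subseteq> A ?k"
    using node_splits[OF U False] by metis
  have "s * Suc ?k \<le> e + s" "e \<le> s * Suc ?k"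
    using s_pos by (auto simp: less_imp_le dividend_less_times_div)
  then have "visit_prob \<T> U / q ^ s \<le> visit_prob \<T> V\<^sub>1" "visit_prob \<T> U / q ^ s \<le> visit_prob \<T> V\<^sub>2"
    using visit_prob_near_descendant[OF U] V by auto
  moreover have "0 \<le> gap x \<and> gap x \<le> level_gap ?k" if "x \<in> U" for x
    using gap_nonneg gap_le that V(7) by blast
  moreover have "gap x \<le> level_gap (Suc ?k)" if "x \<in> V\<^sub>1" for x
    using gap_le that V(5) by blast
  moreover have "gap x = level_gap ?k" if "x \<in> V\<^sub>2" for x
    using gap_eq that V by blast
  ultimately show ?thesis
    using that[of V\<^sub>1 V\<^sub>2 0 "level_gap ?k" "level_gap (Suc ?k)"] V node_at_tree_nodes
      level_gap_Suc[of ?k] level_gap_nonneg[of ?k] by force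
qed

end

section \<open>Boxes over the first axis\<close>

text \<open>Keeps the index \<open>1\<close> of the distinguished axis from being rewritten to
  \<open>Suc 0\<close>.\<close>

declare One_nat_def [simp del]

locale leafless_arms =
  fixes p q :: nat and \<T> :: "nat \<Rightarrow> 'a arm_tree"
  assumes p_pos: "1 \<le> p"
    and valid_trees: "i \<in> {1..p} \<Longrightarrow> valid_tree q (\<T> i)"
    and unique_descent: "i \<in> {1..p} \<Longrightarrow> \<exists>!M. is_descent_dist (\<T> i) M"
    and leafless_trees: "i \<in> {1..p} \<Longrightarrow> \<not> is_leaf (\<T> i) U"
begin

lemma leafless_tree: "i \<in> {1..p} \<Longrightarrow> leafless_tree q (\<T> i)"
  by unfold_locales (use valid_trees leafless_trees in auto)

lemma descent_dist: "i \<in> {1..p} \<Longrightarrow> is_descent_dist (\<T> i) (descent_dist (\<T> i))"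
  unfolding descent_dist_def by (rule theI') (rule unique_descent)

lemma descent_dist_prob_space: "i \<in> {1..p} \<Longrightarrow> prob_space (descent_dist (\<T> i))"
  using descent_dist by (simp add: is_descent_dist_def)

lemma sets_arm_dist: "sets (arm_dist p \<T>) = sets (arm_algebra p \<T>)"
  unfolding arm_dist_def arm_algebra_def
  using descent_dist by (intro sets_PiM_cong) (auto simp: is_descent_dist_def)

lemma space_arm_algebra: "space (arm_algebra p \<T>) = arm_space p \<T>"
  unfolding arm_algebra_def arm_space_def space_PiM
  using leafless_tree.space_tree_algebra[OF leafless_tree] by (intro PiE_cong) auto

lemma space_arm_dist: "space (arm_dist p \<T>) = arm_space p \<T>"
  using sets_eq_imp_space_eq[OF sets_arm_dist] by (simp add: space_arm_algebra)

sublocale arm_prob: prob_space "arm_dist p \<T>"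
  unfolding arm_dist_def by (rule prob_space_PiM) (rule descent_dist_prob_space)

lemma node_sets:
  "i \<in> {1..p} \<Longrightarrow> U \<in> tree_nodes (\<T> i) \<Longrightarrow> U \<in> sets (descent_dist (\<T> i))"
  using descent_dist leafless_tree.tree_nodes_sets[OF leafless_tree]
  by (auto simp: is_descent_dist_def)

lemma box_sets:
  assumes "\<forall>i\<in>{1..p}. U i \<in> tree_nodes (\<T> i)"
  shows "Pi\<^sub>E {1..p} U \<in> sets (arm_dist p \<T>)"
  unfolding arm_dist_def using assms node_sets by (intro sets_PiM_I_finite) auto

lemma box_measure:
  assumes "\<forall>i\<in>{1..p}. U i \<in> tree_nodes (\<T> i)"
  shows "measure (arm_dist p \<T>) (Pi\<^sub>E {1..p} U) = (\<Prod>i\<in>{1..p}. visit_prob (\<T> i) (U i))"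
proof -
  have D: "emeasure (descent_dist (\<T> i)) (U i) = ennreal (visit_prob (\<T> i) (U i))" if "i \<in> {1..p}" for i
    using finite_measure.emeasure_eq_measure[OF prob_space.finite_measure[OF descent_dist_prob_space[OF that]]]
      descent_dist[OF that] assms that by (simp add: is_descent_dist_def)
  have "prod_emb {1..p} (\<lambda>i. descent_dist (\<T> i)) {1..p} (Pi\<^sub>E {1..p} U) = Pi\<^sub>E {1..p} U"
    using node_sets assms sets.sets_into_space by (intro prod_emb_PiE_same_index) blast
  then have "emeasure (arm_dist p \<T>) (Pi\<^sub>E {1..p} U) = (\<Prod>i\<in>{1..p}. emeasure (descent_dist (\<T> i)) (U i))"
    unfolding arm_dist_def
    using emeasure_PiM_emb[of "{1..p}" "\<lambda>i. descent_dist (\<T> i)" "{1..p}" U]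
      descent_dist_prob_space node_sets assms by simp
  also have "\<dots> = (\<Prod>i\<in>{1..p}. ennreal (visit_prob (\<T> i) (U i)))"
    by (intro prod.cong) (simp_all add: D)
  finally show ?thesis
    by (simp add: measure_def visit_prob_def prod_ennreal prod_nonneg)
qed

lemma box_measure_pos:
  assumes "\<forall>i\<in>{1..p}. U i \<in> tree_nodes (\<T> i)"
  shows "0 < measure (arm_dist p \<T>) (Pi\<^sub>E {1..p} U)"
  unfolding box_measure[OF assms]
proof (rule prod_pos)
  fix i assume i: "i \<in> {1..p}"
  then have "U i \<in> tree_nodes (\<T> i)" using assms by blast
  then show "0 < visit_prob (\<T> i) (U i)"
    using leafless_tree.visit_prob_pos[OF leafless_tree[OF i]] by (auto simp: tree_nodes_def)
qed

lemma box_subset_space: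
  assumes "\<forall>i\<in>{1..p}. U i \<in> tree_nodes (\<T> i)"
  shows "Pi\<^sub>E {1..p} U \<subseteq> arm_space p \<T>"
  using sets.sets_into_space[OF box_sets[OF assms]] by (simp add: space_arm_dist)

lemma one_in: "1 \<in> {1..p}"
  using p_pos by simp

text \<open>The boxes cut only along the first axis. They suffice for the partitions because the
  rewards depend on \<open>x 1\<close> alone.\<close>

definition slab :: "'a set \<Rightarrow> (nat \<Rightarrow> 'a) set" where
  "slab U = Pi\<^sub>E {1..p} ((\<lambda>i. tree_root (\<T> i))(1 := U))"

lemma root_nonempty: "i \<in> {1..p} \<Longrightarrow> tree_root (\<T> i) \<noteq> {}"
  using valid_trees by (auto simp: valid_tree_def)

lemma slab_eq:
  assumes "U \<subseteq> tree_root (\<T> 1)"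
  shows "slab U = {x \<in> arm_space p \<T>. x 1 \<in> U}"
proof
  have "slab U \<subseteq> arm_space p \<T>"
    unfolding slab_def arm_space_def using assms by (intro PiE_mono) auto
  moreover have "x 1 \<in> U" if "x \<in> slab U" for x
    using PiE_mem[OF that[unfolded slab_def] one_in] by simp
  ultimately show "slab U \<subseteq> {x \<in> arm_space p \<T>. x 1 \<in> U}" by blast
  show "{x \<in> arm_space p \<T>. x 1 \<in> U} \<subseteq> slab U"
    by (auto simp: slab_def arm_space_def PiE_iff extensional_def)
qed

lemma arm_exists:
  assumes "y \<in> tree_root (\<T> 1)"
  shows "\<exists>x\<in>arm_space p \<T>. x 1 = y"
proof -
  have "\<forall>i\<in>{1..p}. \<exists>z. z \<in> tree_root (\<T> i)" using root_nonempty by blast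
  then obtain f where "\<forall>i\<in>{1..p}. f i \<in> tree_root (\<T> i)" by metis
  then have "(\<lambda>i. if i \<in> {1..p} then if i = 1 then y else f i else undefined) \<in> arm_space p \<T>"
    using assms by (auto simp: arm_space_def)
  then show ?thesis using one_in by (intro bexI) auto
qed

lemma arm_space_first: "x \<in> arm_space p \<T> \<Longrightarrow> x 1 \<in> tree_root (\<T> 1)"
  using one_in by (auto simp: arm_space_def)

lemma root_node: "tree_root (\<T> i) \<in> tree_nodes (\<T> i)"
  using node_at.root[of "\<T> i"] by (auto simp: tree_nodes_def)

lemma slab_in_boxes: "U \<in> tree_nodes (\<T> 1) \<Longrightarrow> slab U \<in> boxes p \<T>"
  unfolding boxes_def slab_def using root_node
  by (auto intro!: exI[of _ "(\<lambda>i. tree_root (\<T> i))(1 := U)"])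

lemma slab_proj:
  assumes "U \<in> tree_nodes (\<T> 1)" "i \<in> {1..p}"
  shows "(\<lambda>x. x i) ` slab U = (if i = 1 then U else tree_root (\<T> i))"
proof -
  interpret leafless_tree q "\<T> 1" by (rule leafless_tree[OF one_in])
  have "U \<noteq> {}" using assms(1) node_at_nonempty by (auto simp: tree_nodes_def)
  then have "slab U \<noteq> {}"
    unfolding slab_def using root_nonempty by (subst PiE_eq_empty_iff) auto
  then show ?thesis
    unfolding slab_def using assms(2) by (subst image_projection_PiE) auto
qed

lemma slab_depth:
  assumes "node_at (\<T> 1) n U"
  shows "box_depth p \<T> (slab U) \<le> n"
proof -
  have "node_depth (\<T> i) ((\<lambda>x. x i) ` slab U) \<le> n" if "i \<in> {1..p}" for i
  proof -
    have "U \<in> tree_nodes (\<T> 1)" using assms by (auto simp: tree_nodes_def)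
    moreover have "node_depth (\<T> 1) U \<le> n"
      unfolding node_depth_def using assms by (rule Least_le)
    moreover have "node_depth (\<T> i) (tree_root (\<T> i)) \<le> 0"
      unfolding node_depth_def by (rule Least_le) (rule node_at.root)
    ultimately show ?thesis using slab_proj that by simp
  qed
  then show ?thesis
    unfolding box_depth_def using p_pos by (subst Max_le_iff) auto
qed

lemma box_mean_const:
  assumes U: "\<forall>i\<in>{1..p}. U i \<in> tree_nodes (\<T> i)"
    and c: "\<And>x. x \<in> Pi\<^sub>E {1..p} U \<Longrightarrow> f x = c"
  shows "box_mean p \<T> f (Pi\<^sub>E {1..p} U) = c"
proof -
  let ?B = "Pi\<^sub>E {1..p} U"
  have "(LINT x:?B|arm_dist p \<T>. f x) = (LINT x:?B|arm_dist p \<T>. c)"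
    using c by (intro set_lebesgue_integral_cong) (auto simp: box_sets[OF U])
  also have "\<dots> = measure (arm_dist p \<T>) ?B * c"
    using box_sets[OF U] by (simp add: set_lebesgue_integral_def)
  finally show ?thesis
    unfolding box_mean_def using box_measure_pos[OF U] by simp
qed

lemma box_mean_ge:
  assumes U: "\<forall>i\<in>{1..p}. U i \<in> tree_nodes (\<T> i)"
    and f: "f \<in> borel_measurable (arm_algebra p \<T>)" "\<And>x. x \<in> arm_space p \<T> \<Longrightarrow> f x \<in> {0..1}"
    and c: "\<And>x. x \<in> Pi\<^sub>E {1..p} U \<Longrightarrow> c \<le> f x"
  shows "c \<le> box_mean p \<T> f (Pi\<^sub>E {1..p} U)"
proof -
  let ?B = "Pi\<^sub>E {1..p} U"
  have fm: "f \<in> borel_measurable (arm_dist p \<T>)"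
    using f(1) measurable_cong_sets[OF sets_arm_dist refl] by blast
  have "measure (arm_dist p \<T>) ?B * c = (LINT x:?B|arm_dist p \<T>. c)"
    using box_sets[OF U] by (simp add: set_lebesgue_integral_def)
  also have "\<dots> \<le> (LINT x:?B|arm_dist p \<T>. f x)"
  proof (rule set_integral_mono)
    show "set_integrable (arm_dist p \<T>) ?B (\<lambda>x. c)"
      unfolding set_integrable_def using box_sets[OF U]
      by (intro integrable_scaleR_left integrable_real_indicator) (auto simp: arm_prob.emeasure_eq_measure)
    show "set_integrable (arm_dist p \<T>) ?B f"
      unfolding set_integrable_def
      using fm f(2) box_sets[OF U]
      by (intro arm_prob.integrable_const_bound[where B=1])
        (auto simp: space_arm_dist indicator_def intro!: AE_I2)
  qed (use c in auto)
  finally show ?thesis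
    unfolding box_mean_def using box_measure_pos[OF U] by (simp add: field_simps)
qed

text \<open>The other axes contribute the same factor to both measures, so the conditional
  probability is a ratio of visit probabilities in the first tree.\<close>

lemma box_cond_prob:
  assumes U: "\<forall>i\<in>{1..p}. U i \<in> tree_nodes (\<T> i)"
    and V: "V \<in> tree_nodes (\<T> 1)" "V \<subseteq> U 1" and c: "visit_prob (\<T> 1) (U 1) * c \<le> visit_prob (\<T> 1) V"
  shows "Pi\<^sub>E {1..p} (U(1 := V)) \<in> boxes p \<T>" "Pi\<^sub>E {1..p} (U(1 := V)) \<subseteq> Pi\<^sub>E {1..p} U"
    "c \<le> \<P>(x in arm_dist p \<T>. x \<in> Pi\<^sub>E {1..p} (U(1 := V)) \<bar> x \<in> Pi\<^sub>E {1..p} U)"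
proof -
  let ?C = "Pi\<^sub>E {1..p} (U(1 := V))" and ?B = "Pi\<^sub>E {1..p} U" and ?M = "arm_dist p \<T>"
  have V': "\<forall>i\<in>{1..p}. (U(1 := V)) i \<in> tree_nodes (\<T> i)"
    using U V by auto
  show "?C \<in> boxes p \<T>" unfolding boxes_def using V' by blast
  show sub: "?C \<subseteq> ?B" using V(2) by (intro PiE_mono) auto
  have C: "measure ?M ?C = visit_prob (\<T> 1) V * (\<Prod>i\<in>{1..p} - {1}. visit_prob (\<T> i) (U i))"
    unfolding box_measure[OF V'] by (subst prod.remove[OF _ one_in]) auto
  have B: "measure ?M ?B = visit_prob (\<T> 1) (U 1) * (\<Prod>i\<in>{1..p} - {1}. visit_prob (\<T> i) (U i))"
    unfolding box_measure[OF U] by (subst prod.remove[OF _ one_in]) auto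
  have "measure ?M ?B * c \<le> measure ?M ?C"
    unfolding B C using mult_right_mono[OF c, of "\<Prod>i\<in>{1..p} - {1}. visit_prob (\<T> i) (U i)"]
    by (simp add: visit_prob_def prod_nonneg mult_ac)
  moreover have "{x \<in> space ?M. x \<in> ?C \<and> x \<in> ?B} = ?C" "{x \<in> space ?M. x \<in> ?B} = ?B"
    using sub box_subset_space[OF U] by (auto simp: space_arm_dist)
  ultimately show "c \<le> \<P>(x in ?M. x \<in> ?C \<bar> x \<in> ?B)"
    unfolding cond_prob_def using box_measure_pos[OF U] by (simp add: field_simps)
qed

end

section \<open>Rewards depending on the first axis are well-behaved\<close>

locale first_axis = leafless_arms p q \<T> + nested_levels q "\<T> 1" s K a \<beta> A
  for p q :: nat and \<T> :: "nat \<Rightarrow> 'a arm_tree" and s K :: nat and a \<beta> :: real and A :: "nat \<Rightarrow> 'a set"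
begin

text \<open>Means between 1/4 and 3/4 keep Bernoulli arms away from the degenerate laws, so that
  divergences are quadratic in the difference of means. The factor 1/2 means that regret \<delta>
  corresponds to gap \<open>2 * \<delta>\<close>.\<close>

definition reward :: "(nat \<Rightarrow> 'a) \<Rightarrow> real" where
  "reward x = 3 / 4 - gap (x 1) / 2"

lemma reward_measurable: "reward \<in> borel_measurable (arm_algebra p \<T>)"
proof -
  have "(\<lambda>x. x 1) \<in> arm_algebra p \<T> \<rightarrow>\<^sub>M tree_algebra (\<T> 1)"
    unfolding arm_algebra_def by (rule measurable_component_singleton[OF one_in])
  then have "(\<lambda>x. gap (x 1)) \<in> borel_measurable (arm_algebra p \<T>)"
    using gap_measurable by (rule measurable_compose)
  then show ?thesis unfolding reward_def by measurable
qed

lemma reward_range: "reward x \<in> {1 / 4..3 / 4}"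
  using gap_nonneg[of "x 1"] gap_le_1[of "x 1"] by (auto simp: reward_def)

lemma max_reward: "max_reward p \<T> reward = 3 / 4"
  unfolding max_reward_def
proof (rule cSup_eq_maximum)
  obtain y where y: "y \<in> A (Suc K)" using A_needle by blast
  then have "y \<in> tree_root (\<T> 1)" using A_antimono[of 0 "Suc K"] A_0 by auto
  then obtain x where "x \<in> arm_space p \<T>" "x 1 = y" using arm_exists by blast
  then show "3 / 4 \<in> reward ` arm_space p \<T>"
    using gap_needle[OF y] by (intro image_eqI[of _ _ x]) (auto simp: reward_def)
qed (use reward_range in auto)

text \<open>Condition (iv) is shown for every box, which spares a description of the boxes on the
  active collection. As \<open>reward\<close> reverses the gap, the largest gap \<open>v\<close>
  gives the infimum over B, and \<open>V\<^sub>1\<close> has the larger mean.\<close>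

lemma box_contrast:
  assumes B: "B \<in> boxes p \<T>" and \<gamma>: "\<gamma> \<le> 1 / real q ^ s"
  shows "\<exists>i\<in>{1..p}. \<exists>U V\<^sub>1 V\<^sub>2. let C\<^sub>1 = Pi\<^sub>E {1..p} (U(i := V\<^sub>1)); C\<^sub>2 = Pi\<^sub>E {1..p} (U(i := V\<^sub>2)) in
    C\<^sub>1 \<in> boxes p \<T> \<and> C\<^sub>1 \<subseteq> B \<and> C\<^sub>2 \<in> boxes p \<T> \<and> C\<^sub>2 \<subseteq> B \<and>
    \<P>(x in arm_dist p \<T>. x \<in> C\<^sub>1 \<bar> x \<in> B) \<ge> \<gamma> \<and>
    \<P>(x in arm_dist p \<T>. x \<in> C\<^sub>2 \<bar> x \<in> B) \<ge> \<gamma> \<and>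
    box_mean p \<T> reward C\<^sub>1 - box_mean p \<T> reward C\<^sub>2 \<ge>
      1 / real p * (box_width reward B - 1 / 4 * box_gap p \<T> reward B)"
proof -
  obtain U where B_eq: "B = Pi\<^sub>E {1..p} U" and U: "\<forall>i\<in>{1..p}. U i \<in> tree_nodes (\<T> i)"
    using B unfolding boxes_def by blast
  obtain e where e: "node_at (\<T> 1) e (U 1)" using U one_in unfolding tree_nodes_def by blast
  obtain V\<^sub>1 V\<^sub>2 l u v where nodes: "V\<^sub>1 \<in> tree_nodes (\<T> 1)" "V\<^sub>2 \<in> tree_nodes (\<T> 1)" "V\<^sub>1 \<subseteq> U 1" "V\<^sub>2 \<subseteq> U 1"
    and vp: "visit_prob (\<T> 1) (U 1) / q ^ s \<le> visit_prob (\<T> 1) V\<^sub>1"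
      "visit_prob (\<T> 1) (U 1) / q ^ s \<le> visit_prob (\<T> 1) V\<^sub>2"
    and gaps: "\<And>x. x \<in> U 1 \<Longrightarrow> l \<le> gap x \<and> gap x \<le> v" "\<And>x. x \<in> V\<^sub>1 \<Longrightarrow> gap x \<le> u"
      "\<And>x. x \<in> V\<^sub>2 \<Longrightarrow> gap x = v"
    and uv: "u \<le> v" "(v - l) - v / 4 \<le> v - u"
    by (rule node_contrast[OF e]) (rule that)
  let ?C = "\<lambda>V. Pi\<^sub>E {1..p} (U(1 := V))"
  have cU: "visit_prob (\<T> 1) (U 1) * \<gamma> \<le> visit_prob (\<T> 1) (U 1) / q ^ s"
    using mult_left_mono[OF \<gamma>, of "visit_prob (\<T> 1) (U 1)"] by (simp add: visit_prob_def)
  note C1 = box_cond_prob[OF U nodes(1,3) order_trans[OF cU vp(1)]]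
  note C2 = box_cond_prob[OF U nodes(2,4) order_trans[OF cU vp(2)]]
  have UV: "\<forall>i\<in>{1..p}. (U(1 := V)) i \<in> tree_nodes (\<T> i)" if "V \<in> tree_nodes (\<T> 1)" for V
    using U that by auto
  have first: "x 1 \<in> V" if "x \<in> ?C V" for x V
    using PiE_mem[OF that one_in] by simp
  have m1: "3 / 4 - u / 2 \<le> box_mean p \<T> reward (?C V\<^sub>1)"
  proof (rule box_mean_ge[OF UV[OF nodes(1)] reward_measurable])
    show "reward x \<in> {0..1}" for x using reward_range[of x] by auto
    show "3 / 4 - u / 2 \<le> reward x" if "x \<in> ?C V\<^sub>1" for x
      using gaps(2)[OF first[OF that]] by (simp add: reward_def)
  qed
  have m2: "box_mean p \<T> reward (?C V\<^sub>2) = 3 / 4 - v / 2"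
    using gaps(3)[OF first] by (intro box_mean_const[OF UV[OF nodes(2)]]) (simp add: reward_def del: fun_upd_apply)
  have bounds: "3 / 4 - v / 2 \<le> reward x" "reward x \<le> 3 / 4 - l / 2" if "x \<in> B" for x
    using gaps(1)[of "x 1"] PiE_mem[OF that[unfolded B_eq] one_in] by (auto simp: reward_def)
  have "?C V\<^sub>2 \<noteq> {}"
    using box_measure_pos[OF UV[OF nodes(2)]] by (metis less_irrefl measure_empty)
  then obtain x where x: "x \<in> ?C V\<^sub>2" by blast
  have inf: "(INF x\<in>B. reward x) = 3 / 4 - v / 2"
  proof (rule cInf_eq_minimum)
    show "3 / 4 - v / 2 \<in> reward ` B"
      using x C2(2) gaps(3)[OF first[OF x]] B_eq by (intro image_eqI[of _ _ x]) (auto simp: reward_def)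
  qed (use bounds in auto)
  have "(SUP x\<in>B. reward x) \<le> 3 / 4 - l / 2"
    using x C2(2) B_eq bounds(2) by (intro cSUP_least) auto
  \<comment> \<open>Width at most \<open>(v - l) / 2\<close> and box gap \<open>v / 2\<close> turn
    this into half of the inequality \<open>(v - l) - v / 4 \<le> v - u\<close>.\<close>
  then have "box_width reward B - 1 / 4 * box_gap p \<T> reward B \<le> (v - u) / 2"
    using uv(2) by (simp add: box_width_def box_gap_def inf max_reward)
  then have "1 / real p * (box_width reward B - 1 / 4 * box_gap p \<T> reward B) \<le> 1 / real p * ((v - u) / 2)"
    by (intro mult_left_mono) auto
  also have "\<dots> \<le> 1 * ((v - u) / 2)"
    using p_pos uv(1) by (intro mult_right_mono) auto
  also have "\<dots> \<le> box_mean p \<T> reward (?C V\<^sub>1) - box_mean p \<T> reward (?C V\<^sub>2)"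
    using m1 m2 by simp
  finally show ?thesis
    using C1 C2 B_eq one_in by (intro bexI[of _ 1] exI[of _ U] exI[of _ V\<^sub>1] exI[of _ V\<^sub>2]) (auto simp: Let_def)
qed

end

section \<open>Partitions and active boxes at each scale\<close>

context first_axis
begin

text \<open>The first level whose gap is compatible with being near-optimal; the leading 2 undoes
  the factor 1/2 in \<open>reward\<close>.\<close>

definition near_level :: "nat \<Rightarrow> nat" where
  "near_level m = (LEAST k. a ^ k \<le> 2 * 2 powr (1 - real m))"

definition coarse_level :: "nat \<Rightarrow> nat" where
  "coarse_level m = min (near_level m) (Suc K)"

text \<open>Passing \<open>12 * p\<close> further levels multiplies the gap by at most
  \<open>4 ^ (- 12 * p)\<close>, which is below \<open>1 / (12 * p)\<close>, as the width bound
  requires. The cap is the needle, on which the gap is 0.\<close>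

definition fine_level :: "nat \<Rightarrow> nat" where
  "fine_level m = min (near_level m + 12 * p) (Suc K)"

definition parts :: "nat \<Rightarrow> (nat \<Rightarrow> 'a) set set" where
  "parts m = slab ` {U. node_at (\<T> 1) (s * fine_level m) U}"

definition active :: "nat \<Rightarrow> (nat \<Rightarrow> 'a) set set" where
  "active m = slab ` {U. node_at (\<T> 1) (s * fine_level m) U \<and> U \<subseteq> A (coarse_level m)}"

lemma powr_scale: "2 powr (1 - real m) = 2 / 2 ^ m"
  by (simp add: powr_diff powr_realpow)

text \<open>The ratio 1/4 decays faster than the scales do, so \<open>near_level m \<le> m\<close>;
  this makes the depth of the boxes linear in \<open>m\<close>.\<close>

lemma near_level_bound: "a ^ m \<le> 2 * 2 powr (1 - real m)"
proof -
  have "a ^ m \<le> (1 / 4) ^ m" using a_pos a_le by (intro power_mono) auto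
  also have "\<dots> \<le> (1 / 2) ^ m" by (intro power_mono) auto
  also have "\<dots> \<le> 2 * 2 powr (1 - real m)" by (simp add: powr_scale power_divide divide_right_mono)
  finally show ?thesis .
qed

lemma near_level: "a ^ near_level m \<le> 2 * 2 powr (1 - real m)"
  unfolding near_level_def by (rule LeastI) (rule near_level_bound)

lemma near_level_le: "near_level m \<le> m"
  unfolding near_level_def by (rule Least_le) (rule near_level_bound)

lemma below_near_level: "k < near_level m \<Longrightarrow> 2 * 2 powr (1 - real m) < a ^ k"
  unfolding near_level_def using not_less_Least[of k "\<lambda>k. a ^ k \<le> 2 * 2 powr (1 - real m)"] by auto

lemma near_level_Suc: "near_level m \<le> near_level (Suc m)"
  unfolding near_level_def[of m]
proof (rule Least_le)
  have "2 * 2 powr (1 - real (Suc m)) \<le> 2 * 2 powr (1 - real m)"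
    by (intro mult_left_mono powr_mono) auto
  then show "a ^ near_level (Suc m) \<le> 2 * 2 powr (1 - real m)"
    using near_level[of "Suc m"] by linarith
qed

lemma coarse_le_fine: "coarse_level m \<le> fine_level m"
  by (auto simp: coarse_level_def fine_level_def)

lemma fine_level_Suc: "fine_level m \<le> fine_level (Suc m)"
  using near_level_Suc[of m] by (auto simp: fine_level_def)

lemma mem_slab_node:
  "node_at (\<T> 1) e U \<Longrightarrow> x \<in> slab U \<longleftrightarrow> x \<in> arm_space p \<T> \<and> x 1 \<in> U"
  using slab_eq[OF node_at_subset_root] by auto

lemma slab_nonempty: "node_at (\<T> 1) e U \<Longrightarrow> slab U \<noteq> {}"
  using node_at_nonempty[of e U] arm_exists node_at_subset_root[of e U] mem_slab_node[of e U] by fastforce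

lemma slab_disjoint:
  assumes "node_at (\<T> 1) e U" "node_at (\<T> 1) e V" "slab U \<noteq> slab V"
  shows "slab U \<inter> slab V = {}"
  using assms node_at_eq_or_disjoint[OF assms(1,2)] mem_slab_node by blast

lemma parts_partition: "partition_on (arm_space p \<T>) (parts m)"
proof (rule partition_onI)
  show "\<Union>(parts m) = arm_space p \<T>"
  proof
    show "\<Union>(parts m) \<subseteq> arm_space p \<T>" by (auto simp: parts_def mem_slab_node)
    show "arm_space p \<T> \<subseteq> \<Union>(parts m)"
    proof
      fix x assume x: "x \<in> arm_space p \<T>"
      then obtain U where "node_at (\<T> 1) (s * fine_level m) U" "x 1 \<in> U"
        using level_cover[OF arm_space_first] by blast
      then show "x \<in> \<Union>(parts m)" using x by (auto simp: parts_def mem_slab_node)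
    qed
  qed
  show "\<And>B B'. B \<in> parts m \<Longrightarrow> B' \<in> parts m \<Longrightarrow> B \<noteq> B' \<Longrightarrow> disjnt B B'"
    unfolding parts_def disjnt_def using slab_disjoint by blast
  show "{} \<notin> parts m"
    unfolding parts_def using slab_nonempty by blast
qed

lemma parts_boxes: "parts m \<subseteq> boxes p \<T>"
  unfolding parts_def using slab_in_boxes node_at_tree_nodes by blast

lemma active_parts: "active m \<subseteq> parts m"
  by (auto simp: active_def parts_def)

lemma near_optimal_active: "near_optimal p \<T> reward (2 powr (1 - real m)) \<subseteq> \<Union>(active m)"
proof
  fix x assume "x \<in> near_optimal p \<T> reward (2 powr (1 - real m))"
  then have x: "x \<in> arm_space p \<T>" and gap: "gap (x 1) \<le> 2 * 2 powr (1 - real m)"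
    unfolding near_optimal_def max_reward by (auto simp: reward_def)
  have "x 1 \<in> A (coarse_level m)"
  proof (cases "coarse_level m")
    case 0
    then show ?thesis using A_0 arm_space_first[OF x] by simp
  next
    case (Suc j)
    then have "j \<le> K" "j < near_level m" by (auto simp: coarse_level_def)
    \<comment> \<open>Since \<open>j\<close> is below \<open>near_level m\<close>, leaving the
      sequence after \<open>A j\<close> would already cost more than a near-optimal point can
      afford.\<close>
    then have "gap (x 1) < level_gap j"
      using below_near_level[of j m] gap by (simp add: level_gap_def)
    then show ?thesis using gap_ge[of "x 1" j] Suc by (cases "x 1 \<in> A (Suc j)") auto
  qed
  then obtain U where "node_at (\<T> 1) (s * fine_level m) U" "x 1 \<in> U" "U \<subseteq> A (coarse_level m)"
    using A_covered[of "x 1" "coarse_level m" "s * fine_level m"] coarse_le_fine by auto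
  then show "x \<in> \<Union>(active m)" using x mem_slab_node unfolding active_def by blast
qed

text \<open>Coarse nodes are counted by \<open>A_card\<close>, and each has at most
  \<open>q ^ (s * (12 * p))\<close> descendants at the fine level, a factor that depends neither on
  \<open>m\<close> nor on \<open>K\<close>.\<close>

lemma active_card:
  "finite (active m) \<and>
    real (card (active m)) \<le> a powr (- \<beta>) * real q ^ (s * (12 * p)) * (2 powr (1 - real m)) powr (- \<beta>)"
proof -
  let ?\<delta> = "2 powr (1 - real m)" and ?c = "coarse_level m" and ?f = "fine_level m"
  let ?V = "{V. node_at (\<T> 1) (s * ?c) V \<and> V \<subseteq> A ?c}"
  let ?D = "\<lambda>V. {U. node_at (\<T> 1) (s * ?f) U \<and> U \<subseteq> V}"
  have D: "finite (?D V)" "card (?D V) \<le> q ^ (s * (12 * p))" if "V \<in> ?V" for V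
  proof -
    have eq: "s * ?c + s * (?f - ?c) = s * ?f"
      using coarse_le_fine[of m] by (simp add: add_mult_distrib2[symmetric])
    have "q ^ (s * (?f - ?c)) \<le> q ^ (s * (12 * p))"
      using q_ge_2 by (intro power_increasing) (auto simp: coarse_level_def fine_level_def)
    then show "finite (?D V)" "card (?D V) \<le> q ^ (s * (12 * p))"
      using descendants_card[of "s * ?c" V "s * (?f - ?c)"] that unfolding eq by auto
  qed
  have finV: "finite ?V" using finite_level[of "s * ?c"] by simp
  have fin: "finite (\<Union>V\<in>?V. ?D V)" using finV D(1) by blast
  have sub: "{U. node_at (\<T> 1) (s * ?f) U \<and> U \<subseteq> A ?c} \<subseteq> (\<Union>V\<in>?V. ?D V)"
  proof
    fix U assume "U \<in> {U. node_at (\<T> 1) (s * ?f) U \<and> U \<subseteq> A ?c}"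
    then have U: "node_at (\<T> 1) (s * ?f) U" "U \<subseteq> A ?c" by auto
    then obtain V where V: "node_at (\<T> 1) (s * ?c) V" "U \<subseteq> V"
      using ancestor_exists[of "s * ?c" "s * ?f - s * ?c" U] coarse_le_fine[of m] by auto
    then have "V \<subseteq> A ?c"
      using A_nodes[OF V(1)] U(2) node_at_nonempty[OF U(1)] by blast
    then show "U \<in> (\<Union>V\<in>?V. ?D V)" using U V by blast
  qed
  have "card (active m) \<le> card (\<Union>V\<in>?V. ?D V)"
    unfolding active_def using card_image_le[OF finite_subset[OF sub fin]] card_mono[OF fin sub]
    by (rule order_trans)
  also have "\<dots> \<le> (\<Sum>V\<in>?V. card (?D V))" by (rule card_UN_le[OF finV])
  also have "\<dots> \<le> (\<Sum>V\<in>?V. q ^ (s * (12 * p)))" by (intro sum_mono D(2))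
  also have "\<dots> = card ?V * q ^ (s * (12 * p))" by simp
  finally have "real (card (active m)) \<le> real (card ?V) * real q ^ (s * (12 * p))"
    by (metis of_nat_le_iff of_nat_mult of_nat_power)
  moreover have "real (card ?V) \<le> a powr (- \<beta>) * ?\<delta> powr (- \<beta>)"
  proof -
    have "real (card ?V) \<le> a powr (- \<beta> * real ?c)"
      by (rule A_card) (simp add: coarse_level_def)
    also have "\<dots> \<le> a powr (- \<beta>) * ?\<delta> powr (- \<beta>)"
    proof (cases ?c)
      case 0
      \<comment> \<open>At coarse level 0 there is only the root. The scale is at most 2, so
        \<open>a \<le> 1 / 4\<close> keeps its product with \<open>a\<close> below 1.\<close>
      have "1 powr (- \<beta>) \<le> (a * ?\<delta>) powr (- \<beta>)"
      proof (rule powr_mono2')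
        have "?\<delta> \<le> 2" by (simp add: powr_scale field_simps)
        then have "a * ?\<delta> \<le> 1 / 4 * 2" using a_pos a_le by (intro mult_mono) auto
        then show "a * ?\<delta> \<le> 1" by simp
      qed (use \<beta>_nonneg a_pos in auto)
      then show ?thesis using 0 a_pos by (simp add: powr_mult)
    next
      case (Suc j)
      \<comment> \<open>Minimality of \<open>near_level\<close> bounds the scale only by the power
        with exponent \<open>j\<close>, one less than the coarse level; the missing level is paid
        for by the constant factor \<open>a powr (- \<beta>)\<close>.\<close>
      then have "j < near_level m" by (simp add: coarse_level_def)
      then have "2 * ?\<delta> < a ^ j" by (rule below_near_level)
      then have "?\<delta> \<le> a ^ j" using powr_gt_zero[of 2 "1 - real m"] by linarith
      then have "(a ^ j) powr (- \<beta>) \<le> ?\<delta> powr (- \<beta>)"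
        using \<beta>_nonneg by (intro powr_mono2') auto
      moreover have "a powr (- \<beta> * real ?c) = a powr (- \<beta>) * (a ^ j) powr (- \<beta>)"
        using a_pos Suc by (simp add: powr_realpow[symmetric] powr_powr powr_add[symmetric] algebra_simps)
      ultimately show ?thesis by (simp add: mult_left_mono)
    qed
    finally show ?thesis .
  qed
  ultimately have "real (card (active m)) \<le> a powr (- \<beta>) * ?\<delta> powr (- \<beta>) * real q ^ (s * (12 * p))"
    by (meson mult_right_mono of_nat_0_le_iff order_trans zero_le_power)
  moreover have "finite (active m)"
    unfolding active_def using finite_subset[OF sub fin] by simp
  ultimately show ?thesis by (simp add: mult_ac)
qed

lemma box_width_le:
  assumes "B \<noteq> {}" "\<And>x. x \<in> B \<Longrightarrow> l \<le> f x" "\<And>x. x \<in> B \<Longrightarrow> f x \<le> h"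
  shows "box_width f B \<le> h - l"
  unfolding box_width_def
  using cSUP_least[of B f h] cINF_greatest[of B l f] assms by force

lemma fine_level_gap: "level_gap (fine_level m) \<le> 2 powr (1 - real m) / (6 * real p)"
proof (cases "near_level m + 12 * p \<le> K")
  case True
  have "real (12 * p) \<le> 4 ^ (12 * p)"
    using less_imp_le[OF of_nat_less_two_power[of "12 * p", where ?'a=real]]
      power_mono[of "2::real" 4 "12 * p"] by linarith
  then have "(1 / 4) ^ (12 * p) \<le> 1 / real (12 * p)"
    using p_pos by (simp add: power_divide frac_le)
  moreover have "a ^ (12 * p) \<le> (1 / 4) ^ (12 * p)"
    using a_pos a_le by (intro power_mono) auto
  ultimately have "a ^ (12 * p) \<le> 1 / real (12 * p)" by linarith
  then have "a ^ near_level m * a ^ (12 * p) \<le> (2 * 2 powr (1 - real m)) * (1 / real (12 * p))"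
    using near_level[of m] a_pos by (intro mult_mono) auto
  then show ?thesis
    using True by (simp add: fine_level_def level_gap_def power_add)
next
  \<comment> \<open>Here the fine level is the needle \<open>Suc K\<close>, whose gap is 0.\<close>
  case False
  then show ?thesis by (simp add: fine_level_def level_gap_def)
qed

text \<open>A fine node either misses its level, and then the gap is constant on it, or lies in it,
  and then the gap is between 0 and \<open>level_gap (fine_level m)\<close>. The factor 1/2 in
  \<open>reward\<close> turns \<open>6 * p\<close> into \<open>12 * p\<close>.\<close>

lemma active_width:
  assumes "B \<in> active m"
  shows "box_width reward B \<le> 2 powr (1 - real m) / (12 * real p)"
proof -
  obtain U where U: "node_at (\<T> 1) (s * fine_level m) U" "B = slab U"
    using assms by (auto simp: active_def)
  obtain l h where lh: "\<And>y. y \<in> U \<Longrightarrow> l \<le> gap y \<and> gap y \<le> h"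
    and hl: "h - l \<le> 2 powr (1 - real m) / (6 * real p)"
  proof (cases "U \<inter> A (fine_level m) = {}")
    case True
    then have "U \<inter> A (Suc (s * fine_level m div s)) = {}"
      using A_Suc[of "fine_level m"] s_pos by auto
    then obtain k where "\<forall>y\<in>U. gap y = level_gap k"
      using gap_constant_on_node[OF U(1)] by blast
    then show ?thesis using that[of "level_gap k" "level_gap k"] by simp
  next
    case False
    then have "U \<subseteq> A (fine_level m)" using A_nodes[OF U(1)] by blast
    then show ?thesis
      using that[of 0 "level_gap (fine_level m)"] gap_nonneg gap_le fine_level_gap[of m] by auto
  qed
  have "box_width reward B \<le> (3 / 4 - l / 2) - (3 / 4 - h / 2)"
    using U lh mem_slab_node[OF U(1)]
    by (intro box_width_le) (auto simp: slab_nonempty[OF U(1)] reward_def)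
  then show ?thesis using hl by (simp add: field_simps)
qed

lemma active_depth:
  assumes "B \<in> active m" "1 \<le> m"
  shows "real (box_depth p \<T> B) \<le> real (s * (1 + 12 * p)) * real m"
proof -
  obtain U where U: "node_at (\<T> 1) (s * fine_level m) U" "B = slab U"
    using assms by (auto simp: active_def)
  have "fine_level m \<le> m + 12 * p" using near_level_le[of m] by (auto simp: fine_level_def)
  \<comment> \<open>Only here does \<open>m \<ge> 1\<close> matter: it absorbs the additive
    \<open>12 * p\<close>.\<close>
  also have "\<dots> \<le> (1 + 12 * p) * m" using assms(2) by (cases m) auto
  finally have "s * fine_level m \<le> s * ((1 + 12 * p) * m)" by (rule mult_le_mono2)
  then have "box_depth p \<T> B \<le> s * (1 + 12 * p) * m"
    using slab_depth[OF U(1)] unfolding U(2) mult.assoc by (rule order_trans[rotated])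
  then show ?thesis by (metis of_nat_le_iff of_nat_mult)
qed

lemma parts_refinement: "is_refinement p \<T> (parts (Suc m)) (parts m)"
  unfolding is_refinement_def
proof
  fix B assume B: "B \<in> parts m"
  then obtain U where U: "node_at (\<T> 1) (s * fine_level m) U" "B = slab U"
    by (auto simp: parts_def)
  let ?e = "s * fine_level (Suc m)"
  let ?D = "slab ` {V. node_at (\<T> 1) ?e V \<and> V \<subseteq> U}"
  have "B = \<Union>?D"
  proof
    show "\<Union>?D \<subseteq> B" using U mem_slab_node by blast
    show "B \<subseteq> \<Union>?D"
    proof
      fix x assume x: "x \<in> B"
      then have x1: "x 1 \<in> U" "x \<in> arm_space p \<T>" using U mem_slab_node by blast+
      then obtain V where V: "node_at (\<T> 1) ?e V" "x 1 \<in> V"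
        using level_cover[OF arm_space_first] by blast
      have "V \<subseteq> U"
        using node_at_nested[OF U(1) V(1)] fine_level_Suc[of m] x1(1) V(2) by auto
      then show "x \<in> \<Union>?D" using V x1 mem_slab_node by blast
    qed
  qed
  moreover have "?D \<subseteq> parts (Suc m)" by (auto simp: parts_def)
  ultimately show "is_on p \<T> (parts (Suc m)) B"
    unfolding is_on_def using B parts_boxes by blast
qed

text \<open>All nodes of one depth on the first axis and the root on each other axis. The whole
  partition is a single grid, so separation holds with \<open>L = 1\<close>.\<close>

lemma parts_grid: "is_grid p \<T> (parts m)"
  unfolding is_grid_def
proof (intro exI conjI ballI)
  let ?S = "(\<lambda>i. {tree_root (\<T> i)})(1 := {U. node_at (\<T> 1) (s * fine_level m) U})"
  fix i
  show "?S i \<subseteq> tree_nodes (\<T> i)"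
    using node_at_tree_nodes root_node by auto
  show "disjoint (?S i)"
    using node_at_eq_or_disjoint by (auto simp: disjoint_def)
next
  let ?S = "(\<lambda>i. {tree_root (\<T> i)})(1 := {U. node_at (\<T> 1) (s * fine_level m) U})"
  show "parts m = {Pi\<^sub>E {1..p} U |U. \<forall>i\<in>{1..p}. U i \<in> ?S i}"
  proof (intro equalityI subsetI)
    fix B assume "B \<in> parts m"
    then obtain U where "node_at (\<T> 1) (s * fine_level m) U" "B = slab U"
      by (auto simp: parts_def)
    then show "B \<in> {Pi\<^sub>E {1..p} U |U. \<forall>i\<in>{1..p}. U i \<in> ?S i}"
      by (auto simp: slab_def intro!: exI[of _ "(\<lambda>i. tree_root (\<T> i))(1 := U)"])
  next
    fix B assume "B \<in> {Pi\<^sub>E {1..p} U |U. \<forall>i\<in>{1..p}. U i \<in> ?S i}"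
    then obtain U where U: "B = Pi\<^sub>E {1..p} U" "\<forall>i\<in>{1..p}. U i \<in> ?S i" by blast
    have Ui: "U i \<in> ?S i" if "i \<in> {1..p}" for i using U(2) that by blast
    have "U i = ((\<lambda>i. tree_root (\<T> i))(1 := U 1)) i" if "i \<in> {1..p}" for i
      using Ui[OF that] by (cases "i = 1") auto
    then have "B = slab (U 1)" unfolding slab_def U(1) by (rule PiE_cong)
    moreover have "node_at (\<T> 1) (s * fine_level m) (U 1)" using Ui[OF one_in] by simp
    ultimately show "B \<in> parts m" by (auto simp: parts_def)
  qed
qed

text \<open>The thresholds do not involve \<open>K\<close> or the needle, so one choice of constants
  serves all horizons.\<close>

lemma reward_well_behaved:
  assumes "a powr (- \<beta>) * real q ^ (s * (12 * p)) \<le> \<kappa>" "real (s * (1 + 12 * p)) \<le> \<Lambda>"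
    and "0 < \<gamma>" "\<gamma> \<le> 1 / real q ^ s"
  shows "well_behaved p \<T> reward \<beta> \<gamma> \<kappa> \<Lambda>"
proof -
  have "1 < real q ^ s" using q_ge_2 s_pos by (intro one_less_power) auto
  then have "1 / real q ^ s < 1" unfolding divide_less_eq_1 by linarith
  then have \<gamma>1: "\<gamma> < 1" using assms(4) by linarith
  have \<kappa>: "0 < \<kappa>"
    using assms(1) a_pos q_ge_2 by (intro less_le_trans[OF _ assms(1)] mult_pos_pos zero_less_power) auto
  have \<Lambda>: "0 < \<Lambda>"
    using s_pos by (intro less_le_trans[OF _ assms(2)]) auto
  have card: "real (card (active m)) \<le> \<kappa> * (2 powr (1 - real m)) powr (- \<beta>)" for m
    using order_trans[OF conjunct2[OF active_card[of m]] mult_right_mono[OF assms(1) powr_ge_zero]] .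
  have depth: "real (box_depth p \<T> B) \<le> \<Lambda> * real m" if "B \<in> active m" "1 \<le> m" for B m
    using active_depth[OF that] mult_right_mono[OF assms(2), of "real m"] by linarith
  have contrast: "\<And>B m. is_on p \<T> (active m) B \<Longrightarrow> B \<in> boxes p \<T>"
    by (simp add: is_on_def)
  have grids: "(\<forall>l\<in>{1..1}. is_grid p \<T> (parts m)) \<and> separated p \<T> 1 (\<lambda>_. parts m) \<and>
      active m \<subseteq> (\<Union>l\<in>{1..1::nat}. parts m)" for m
    using parts_grid[of m] active_parts[of m] partition_onD2[OF parts_partition[of m]]
    by (auto simp: separated_def)
  have range: "\<forall>x\<in>arm_space p \<T>. reward x \<in> {0..1}"
  proof
    show "reward x \<in> {0..1}" for x using reward_range[of x] by auto
  qed
  note box_contrast' = box_contrast[OF contrast assms(4)]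
  have main: "let \<delta> = 2 powr (1 - real m) in
        partition_on (arm_space p \<T>) (parts m) \<and> parts m \<subseteq> boxes p \<T> \<and> active m \<subseteq> parts m \<and>
        near_optimal p \<T> reward \<delta> \<subseteq> \<Union>(active m) \<and>
        finite (active m) \<and> real (card (active m)) \<le> \<kappa> * \<delta> powr (-\<beta>) \<and>
        (\<forall>B\<in>active m. box_width reward B \<le> \<delta> / (12 * real p) \<and> real (box_depth p \<T> B) \<le> \<Lambda> * real m) \<and>
        (\<forall>B. is_on p \<T> (active m) B \<longrightarrow>
          (\<exists>i\<in>{1..p}. \<exists>U V\<^sub>1 V\<^sub>2. let C\<^sub>1 = Pi\<^sub>E {1..p} (U(i := V\<^sub>1)); C\<^sub>2 = Pi\<^sub>E {1..p} (U(i := V\<^sub>2)) in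
             C\<^sub>1 \<in> boxes p \<T> \<and> C\<^sub>1 \<subseteq> B \<and> C\<^sub>2 \<in> boxes p \<T> \<and> C\<^sub>2 \<subseteq> B \<and>
             \<P>(x in arm_dist p \<T>. x \<in> C\<^sub>1 \<bar> x \<in> B) \<ge> \<gamma> \<and>
             \<P>(x in arm_dist p \<T>. x \<in> C\<^sub>2 \<bar> x \<in> B) \<ge> \<gamma> \<and>
             box_mean p \<T> reward C\<^sub>1 - box_mean p \<T> reward C\<^sub>2 \<ge>
               1 / real p * (box_width reward B - 1 / 4 * box_gap p \<T> reward B))) \<and>
        (\<exists>L \<G>. (\<forall>l\<in>{1..L}. is_grid p \<T> (\<G> l)) \<and> separated p \<T> L \<G> \<and>
           active m \<subseteq> (\<Union>l\<in>{1..L}. \<G> l)) \<and>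
        is_refinement p \<T> (parts (Suc m)) (parts m)"
      if m: "1 \<le> m" for m
      unfolding Let_def[of "2 powr (1 - real m)"]
      by (intro conjI ballI allI impI parts_partition parts_boxes active_parts near_optimal_active
          conjunct1[OF active_card] card active_width depth m box_contrast' parts_refinement
          exI[of _ 1] exI[of _ "\<lambda>_. parts m"] conjunct1[OF grids] conjunct2[OF grids, THEN conjunct1] conjunct2[OF grids, THEN conjunct2])
        assumption+
  show ?thesis
    unfolding well_behaved_def
    by (intro conjI reward_measurable range \<beta>_nonneg assms(3) \<gamma>1 \<kappa> \<Lambda>
      exI[of _ parts] exI[of _ active] allI impI main)
qed

end

section \<open>Bernoulli arms\<close>

definition bernoulli_arm :: "real \<Rightarrow> real measure" where
  "bernoulli_arm m = distr (measure_pmf (bernoulli_pmf m)) reward_space (\<lambda>b. if b then 1 else 0)"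

lemma sets_bernoulli_arm [simp, measurable_cong]: "sets (bernoulli_arm m) = sets reward_space"
  by (simp add: bernoulli_arm_def)

lemma bernoulli_arm_outcome:
  "(\<lambda>b. if b then 1 else 0) \<in> measure_pmf (bernoulli_pmf m) \<rightarrow>\<^sub>M reward_space"
  by (simp add: space_restrict_space)

lemma prob_space_bernoulli_arm: "prob_space (bernoulli_arm m)"
  unfolding bernoulli_arm_def
  by (rule prob_space.prob_space_distr[OF measure_pmf.prob_space_axioms bernoulli_arm_outcome])

lemma nn_integral_bernoulli_arm:
  assumes "m \<in> {0..1}" "g \<in> borel_measurable reward_space"
  shows "(\<integral>\<^sup>+v. g v \<partial>bernoulli_arm m) = ennreal m * g 1 + ennreal (1 - m) * g 0"
  unfolding bernoulli_arm_def using assms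
  by (subst nn_integral_distr[OF bernoulli_arm_outcome]) (auto simp: mult.commute)

lemma mean_bernoulli_arm:
  assumes "m \<in> {0..1}"
  shows "(\<integral>v. v \<partial>bernoulli_arm m) = m"
proof -
  have "(\<lambda>v. v) \<in> borel_measurable reward_space" by (rule measurable_restrict_space1) simp
  then show ?thesis
    unfolding bernoulli_arm_def using assms
    by (subst integral_distr[OF bernoulli_arm_outcome]) auto
qed

lemma bernoulli_arm_measurable:
  assumes f: "f \<in> borel_measurable M" and range: "\<And>x. f x \<in> {0..1}"
  shows "(\<lambda>x. bernoulli_arm (f x)) \<in> M \<rightarrow>\<^sub>M prob_algebra reward_space"
proof (intro measurable_prob_algebraI measurable_subprob_algebra prob_space_bernoulli_arm)
  show "subprob_space (bernoulli_arm (f x))" for x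
    by (rule prob_space_imp_subprob_space) (rule prob_space_bernoulli_arm)
  fix A assume A: "A \<in> sets reward_space"
  have "emeasure (bernoulli_arm (f x)) A = ennreal (f x) * indicator A 1 + ennreal (1 - f x) * indicator A 0" for x
    using A nn_integral_bernoulli_arm[OF range, of "indicator A" x] by simp
  then show "(\<lambda>x. emeasure (bernoulli_arm (f x)) A) \<in> borel_measurable M"
    using f by simp
qed simp

section \<open>One step of a strategy\<close>

locale bandit_strategy =
  fixes p :: nat and \<T> :: "nat \<Rightarrow> 'a arm_tree" and S :: "('a, 'z) strategy"
  assumes strategy: "is_strategy p \<T> S"
begin

text \<open>The restrictions make the arm of time \<open>t\<close> readable from any longer history,
  in agreement with \<open>played_arm\<close>; \<open>next_arm\<close> is the same arm seen just
  before its reward is drawn.\<close>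

definition arm_at :: "nat \<Rightarrow> (nat \<Rightarrow> real) \<times> (nat \<Rightarrow> 'z) \<Rightarrow> nat \<Rightarrow> 'a" where
  "arm_at t \<omega> = arm S t (restrict (fst \<omega>) {1..<t}) (restrict (snd \<omega>) {1..t})"

definition next_arm :: "nat \<Rightarrow> (nat \<Rightarrow> real) \<times> (nat \<Rightarrow> 'z) \<Rightarrow> 'z \<Rightarrow> nat \<Rightarrow> 'a" where
  "next_arm t \<omega> w = arm S (Suc t) (fst \<omega>) ((snd \<omega>)(Suc t := w))"

definition extend :: "nat \<Rightarrow> (nat \<Rightarrow> real) \<times> (nat \<Rightarrow> 'z) \<Rightarrow> 'z \<Rightarrow> real \<Rightarrow> (nat \<Rightarrow> real) \<times> (nat \<Rightarrow> 'z)" where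
  "extend t \<omega> w v = ((fst \<omega>)(Suc t := v), (snd \<omega>)(Suc t := w))"

definition step :: "((nat \<Rightarrow> 'a) \<Rightarrow> real measure) \<Rightarrow> nat \<Rightarrow> (nat \<Rightarrow> real) \<times> (nat \<Rightarrow> 'z) \<Rightarrow>
    ((nat \<Rightarrow> real) \<times> (nat \<Rightarrow> 'z)) measure" where
  "step P t \<omega> = rand_dist S (Suc t) \<bind> (\<lambda>w. P (next_arm t \<omega> w) \<bind>
     (\<lambda>v. return (history_space S (Suc t)) (extend t \<omega> w v)))"

lemma history_law_Suc: "history_law P S (Suc t) = history_law P S t \<bind> step P t"
  by (simp add: step_def[abs_def] next_arm_def extend_def split_beta')

lemma rand_dist_prob: "rand_dist S (Suc t) \<in> space (prob_algebra (rand_space S))"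
  using strategy by (simp add: is_strategy_def)

lemma arm_measurable:
  "(\<lambda>(y, z). arm S (Suc t) y z) \<in>
    (\<Pi>\<^sub>M s\<in>{1..<Suc t}. reward_space) \<Otimes>\<^sub>M (\<Pi>\<^sub>M s\<in>{1..Suc t}. rand_space S) \<rightarrow>\<^sub>M arm_algebra p \<T>"
  using strategy unfolding is_strategy_def by (metis le_add1 plus_1_eq_Suc)

lemma Suc_interval: "{1..Suc t} = insert (Suc t) {1..t}" "{1..<Suc t} = {1..t}"
  by auto

lemma upd_measurable:
  assumes "f \<in> M \<rightarrow>\<^sub>M (\<Pi>\<^sub>M s\<in>{1..t}. N)" "g \<in> M \<rightarrow>\<^sub>M N"
  shows "(\<lambda>x. (f x)(Suc t := g x)) \<in> M \<rightarrow>\<^sub>M (\<Pi>\<^sub>M s\<in>{1..Suc t}. N)"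
  using measurable_compose[OF measurable_Pair[OF assms] measurable_add_dim[of "Suc t" "{1..t}" "\<lambda>_. N"]]
  unfolding Suc_interval by simp

lemma next_arm_measurable:
  "(\<lambda>(\<omega>, w). next_arm t \<omega> w) \<in> history_space S t \<Otimes>\<^sub>M rand_space S \<rightarrow>\<^sub>M arm_algebra p \<T>"
proof -
  have "(\<lambda>x. (fst (fst x), (snd (fst x))(Suc t := snd x))) \<in> history_space S t \<Otimes>\<^sub>M rand_space S \<rightarrow>\<^sub>M
      (\<Pi>\<^sub>M s\<in>{1..<Suc t}. reward_space) \<Otimes>\<^sub>M (\<Pi>\<^sub>M s\<in>{1..Suc t}. rand_space S)"
    unfolding Suc_interval(2) by (intro measurable_Pair upd_measurable) simp_all
  from measurable_compose[OF this arm_measurable] show ?thesis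
    by (simp add: next_arm_def split_beta')
qed

lemma extend_measurable:
  "(\<lambda>((\<omega>, w), v). extend t \<omega> w v) \<in>
    (history_space S t \<Otimes>\<^sub>M rand_space S) \<Otimes>\<^sub>M reward_space \<rightarrow>\<^sub>M history_space S (Suc t)"
  unfolding extend_def split_beta' by (intro measurable_Pair upd_measurable) simp_all

lemma step_measurable:
  assumes P: "P \<in> arm_algebra p \<T> \<rightarrow>\<^sub>M prob_algebra reward_space"
  shows "step P t \<in> history_space S t \<rightarrow>\<^sub>M prob_algebra (history_space S (Suc t))"
proof -
  have "(\<lambda>x. P (next_arm t (fst x) (snd x))) \<in> history_space S t \<Otimes>\<^sub>M rand_space S \<rightarrow>\<^sub>M prob_algebra reward_space"
    using measurable_compose[OF next_arm_measurable P] by (simp add: split_beta')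
  moreover have "(\<lambda>(x, v). return (history_space S (Suc t)) (extend t (fst x) (snd x) v)) \<in>
      (history_space S t \<Otimes>\<^sub>M rand_space S) \<Otimes>\<^sub>M reward_space \<rightarrow>\<^sub>M prob_algebra (history_space S (Suc t))"
    using measurable_compose[OF extend_measurable measurable_return_prob_space] by (simp add: split_beta')
  ultimately have "(\<lambda>x. P (next_arm t (fst x) (snd x)) \<bind> (\<lambda>v. return (history_space S (Suc t)) (extend t (fst x) (snd x) v)))
      \<in> history_space S t \<Otimes>\<^sub>M rand_space S \<rightarrow>\<^sub>M prob_algebra (history_space S (Suc t))"
    by (rule measurable_bind_prob_space2)
  then have "(\<lambda>(\<omega>, w). P (next_arm t \<omega> w) \<bind> (\<lambda>v. return (history_space S (Suc t)) (extend t \<omega> w v)))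
      \<in> history_space S t \<Otimes>\<^sub>M rand_space S \<rightarrow>\<^sub>M prob_algebra (history_space S (Suc t))"
    by (simp add: split_beta')
  from measurable_bind_prob_space2[OF measurable_const[OF rand_dist_prob] this] show ?thesis
    unfolding step_def .
qed

lemma history_law_space:
  assumes P: "P \<in> arm_algebra p \<T> \<rightarrow>\<^sub>M prob_algebra reward_space"
  shows "prob_space (history_law P S t)" "sets (history_law P S t) = sets (history_space S t)"
    "space (history_law P S t) = space (history_space S t)"
  using history_law_prob[OF strategy P, of t] sets_eq_imp_space_eq
  by (auto simp: space_prob_algebra)

lemma history_law_measurable_iff:
  assumes P: "P \<in> arm_algebra p \<T> \<rightarrow>\<^sub>M prob_algebra reward_space"
  shows "f \<in> history_law P S t \<rightarrow>\<^sub>M N \<longleftrightarrow> f \<in> history_space S t \<rightarrow>\<^sub>M N"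
  using measurable_cong_sets[OF history_law_space(2)[OF P] refl] by blast

lemma nn_integral_history_law_Suc:
  assumes P: "P \<in> arm_algebra p \<T> \<rightarrow>\<^sub>M prob_algebra reward_space"
    and \<phi>: "\<phi> \<in> borel_measurable (history_space S (Suc t))"
  shows "(\<integral>\<^sup>+\<omega>. \<phi> \<omega> \<partial>history_law P S (Suc t)) = (\<integral>\<^sup>+\<omega>. (\<integral>\<^sup>+\<omega>'. \<phi> \<omega>' \<partial>step P t \<omega>) \<partial>history_law P S t)"
  unfolding history_law_Suc using measurable_prob_algebraD[OF step_measurable[OF P]]
  by (intro nn_integral_bind[OF \<phi>]) (simp add: history_law_measurable_iff[OF P])

lemma nn_integral_step_measurable:
  assumes P: "P \<in> arm_algebra p \<T> \<rightarrow>\<^sub>M prob_algebra reward_space"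
    and \<phi>: "\<phi> \<in> borel_measurable (history_space S (Suc t))"
  shows "(\<lambda>\<omega>. \<integral>\<^sup>+\<omega>'. \<phi> \<omega>' \<partial>step P t \<omega>) \<in> borel_measurable (history_space S t)"
  using measurable_compose[OF measurable_prob_algebraD[OF step_measurable[OF P]]
      nn_integral_measurable_subprob_algebra[OF \<phi>]] .

lemma next_arm_measurable1:
  "\<omega> \<in> space (history_space S t) \<Longrightarrow> next_arm t \<omega> \<in> rand_space S \<rightarrow>\<^sub>M arm_algebra p \<T>"
  using measurable_Pair_compose_split[OF next_arm_measurable measurable_const measurable_ident] by simp

lemma extend_measurable1:
  "\<omega> \<in> space (history_space S t) \<Longrightarrow>
    (\<lambda>(w, v). extend t \<omega> w v) \<in> rand_space S \<Otimes>\<^sub>M reward_space \<rightarrow>\<^sub>M history_space S (Suc t)"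
  unfolding extend_def split_beta'
  by (intro measurable_Pair upd_measurable measurable_const) (auto simp: space_pair_measure)

text \<open>A two-valued reward turns the inner integral into a sum. What remains is the integral
  over the randomisation variable, under which all one-step estimates are then made.\<close>

lemma nn_integral_step_bernoulli:
  assumes f: "f \<in> borel_measurable (arm_algebra p \<T>)" "\<And>x. f x \<in> {0..1}"
    and \<omega>: "\<omega> \<in> space (history_space S t)"
    and \<phi>: "\<phi> \<in> borel_measurable (history_space S (Suc t))"
  shows "(\<integral>\<^sup>+\<omega>'. \<phi> \<omega>' \<partial>step (\<lambda>x. bernoulli_arm (f x)) t \<omega>) =
    (\<integral>\<^sup>+w. ennreal (f (next_arm t \<omega> w)) * \<phi> (extend t \<omega> w 1) +
      ennreal (1 - f (next_arm t \<omega> w)) * \<phi> (extend t \<omega> w 0) \<partial>rand_dist S (Suc t))"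
proof -
  let ?P = "\<lambda>x. bernoulli_arm (f x)"
  note P = bernoulli_arm_measurable[OF f]
  have rd: "sets (rand_dist S (Suc t)) = sets (rand_space S)"
    using rand_dist_prob by (simp add: space_prob_algebra)
  have "(\<lambda>w. ?P (next_arm t \<omega> w)) \<in> rand_space S \<rightarrow>\<^sub>M prob_algebra reward_space"
    using measurable_compose[OF next_arm_measurable1[OF \<omega>] P] .
  moreover have ret: "(\<lambda>(w, v). return (history_space S (Suc t)) (extend t \<omega> w v)) \<in>
      rand_space S \<Otimes>\<^sub>M reward_space \<rightarrow>\<^sub>M prob_algebra (history_space S (Suc t))"
    using measurable_compose[OF extend_measurable1[OF \<omega>] measurable_return_prob_space] by (simp add: split_beta')
  ultimately have "(\<lambda>w. ?P (next_arm t \<omega> w) \<bind> (\<lambda>v. return (history_space S (Suc t)) (extend t \<omega> w v)))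
      \<in> rand_space S \<rightarrow>\<^sub>M prob_algebra (history_space S (Suc t))"
    by (rule measurable_bind_prob_space2)
  then have "(\<integral>\<^sup>+\<omega>'. \<phi> \<omega>' \<partial>step ?P t \<omega>) =
      (\<integral>\<^sup>+w. (\<integral>\<^sup>+\<omega>'. \<phi> \<omega>' \<partial>(?P (next_arm t \<omega> w) \<bind>
        (\<lambda>v. return (history_space S (Suc t)) (extend t \<omega> w v)))) \<partial>rand_dist S (Suc t))"
    unfolding step_def
    by (intro nn_integral_bind[OF \<phi>] measurable_prob_algebraD) (simp add: measurable_cong_sets[OF rd refl])
  also have "\<dots> = (\<integral>\<^sup>+w. ennreal (f (next_arm t \<omega> w)) * \<phi> (extend t \<omega> w 1) +
      ennreal (1 - f (next_arm t \<omega> w)) * \<phi> (extend t \<omega> w 0) \<partial>rand_dist S (Suc t))"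
  proof (rule nn_integral_cong)
    fix w assume "w \<in> space (rand_dist S (Suc t))"
    then have w: "w \<in> space (rand_space S)" using sets_eq_imp_space_eq[OF rd] by simp
    have ext: "extend t \<omega> w \<in> reward_space \<rightarrow>\<^sub>M history_space S (Suc t)"
      using measurable_Pair_compose_split[OF extend_measurable1[OF \<omega>] measurable_const[OF w] measurable_ident] by simp
    have "(\<integral>\<^sup>+\<omega>'. \<phi> \<omega>' \<partial>(?P (next_arm t \<omega> w) \<bind> (\<lambda>v. return (history_space S (Suc t)) (extend t \<omega> w v)))) =
        (\<integral>\<^sup>+v. (\<integral>\<^sup>+\<omega>'. \<phi> \<omega>' \<partial>return (history_space S (Suc t)) (extend t \<omega> w v)) \<partial>?P (next_arm t \<omega> w))"
      using measurable_prob_algebraD[OF measurable_compose[OF ext measurable_return_prob_space]]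
      by (intro nn_integral_bind[OF \<phi>]) (simp add: measurable_cong_sets[OF sets_bernoulli_arm refl])
    also have "\<dots> = (\<integral>\<^sup>+v. \<phi> (extend t \<omega> w v) \<partial>?P (next_arm t \<omega> w))"
      using measurable_space[OF ext] sets_eq_imp_space_eq[OF sets_bernoulli_arm]
      by (intro nn_integral_cong nn_integral_return[OF _ \<phi>]) auto
    also have "\<dots> = ennreal (f (next_arm t \<omega> w)) * \<phi> (extend t \<omega> w 1) +
        ennreal (1 - f (next_arm t \<omega> w)) * \<phi> (extend t \<omega> w 0)"
      using measurable_compose[OF ext \<phi>] by (intro nn_integral_bernoulli_arm f(2))
    finally show "(\<integral>\<^sup>+\<omega>'. \<phi> \<omega>' \<partial>(?P (next_arm t \<omega> w) \<bind> (\<lambda>v. return (history_space S (Suc t)) (extend t \<omega> w v)))) = \<dots>" .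
  qed
  finally show ?thesis .
qed

lemma arm_at_measurable:
  assumes "t \<in> {1..n}"
  shows "arm_at t \<in> history_space S n \<rightarrow>\<^sub>M arm_algebra p \<T>"
proof -
  obtain t' where t': "t = Suc t'" using assms by (cases t) auto
  have "(\<lambda>\<omega>. (restrict (fst \<omega>) {1..<t}, restrict (snd \<omega>) {1..t})) \<in> history_space S n \<rightarrow>\<^sub>M
      (\<Pi>\<^sub>M s\<in>{1..<t}. reward_space) \<Otimes>\<^sub>M (\<Pi>\<^sub>M s\<in>{1..t}. rand_space S)"
    using assms
    by (intro measurable_Pair measurable_compose[OF measurable_fst measurable_restrict_subset]
        measurable_compose[OF measurable_snd measurable_restrict_subset]) auto
  from measurable_compose[OF this[unfolded t'] arm_measurable] show ?thesis
    unfolding arm_at_def[abs_def] t' by simp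
qed

lemma reward_at_measurable:
  assumes "t \<in> {1..n}"
  shows "(\<lambda>\<omega>. fst \<omega> t) \<in> borel_measurable (history_space S n)"
proof -
  have "(\<lambda>\<omega>. fst \<omega> t) \<in> history_space S n \<rightarrow>\<^sub>M reward_space"
    by (rule measurable_compose[OF measurable_fst measurable_component_singleton[OF assms]])
  then show ?thesis by (simp add: measurable_restrict_space2_iff)
qed

lemma arm_at_extend: "s \<le> t \<Longrightarrow> arm_at s (extend t \<omega> w v) = arm_at s \<omega>"
  unfolding arm_at_def extend_def
  by (auto intro!: arg_cong2[where f="arm S s"] simp: restrict_def)

lemma arm_at_extend_Suc:
  assumes "\<omega> \<in> space (history_space S t)"
  shows "arm_at (Suc t) (extend t \<omega> w v) = next_arm t \<omega> w"
proof -
  \<comment> \<open>Histories are undefined beyond \<open>t\<close>, so restricting the extended one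
    to the past gives back exactly the old one.\<close>
  have "fst \<omega> \<in> extensional {1..t}" "snd \<omega> \<in> extensional {1..t}"
    using assms by (auto simp: space_pair_measure space_PiM PiE_def)
  then have "restrict ((fst \<omega>)(Suc t := v)) {1..<Suc t} = fst \<omega>"
    "restrict ((snd \<omega>)(Suc t := w)) {1..Suc t} = (snd \<omega>)(Suc t := w)"
    by (auto simp: restrict_def extensional_def fun_eq_iff)
  then show ?thesis by (simp add: arm_at_def extend_def next_arm_def)
qed

end

section \<open>Change of measure\<close>

text \<open>The left side is the Kullback-Leibler divergence of the Bernoulli law with mean
  \<open>m\<close> from the one with mean \<open>h\<close>. By \<open>ln y \<le> y - 1\<close> it is
  at most the chi-square divergence \<open>(h - m)\<^sup>2 / (h * (1 - h))\<close>, whose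
  denominator is at least 3/16.\<close>

lemma bernoulli_divergence_le:
  fixes m h :: real
  assumes "m \<in> {1 / 4..3 / 4}" "h \<in> {1 / 4..3 / 4}"
  shows "- (m * ln (h / m) + (1 - m) * ln ((1 - h) / (1 - m))) \<le> 16 / 3 * (h - m)\<^sup>2"
proof -
  have le: "- ln (x / y) \<le> y / x - 1" if "0 < x" "0 < y" for x y :: real
    using ln_le_minus_one[of "y / x"] that by (simp add: ln_div)
  have hpos: "0 < h" "0 < 1 - h" and mpos: "0 < m" "0 < 1 - m" using assms by auto
  have "- (m * ln (h / m) + (1 - m) * ln ((1 - h) / (1 - m))) =
      m * (- ln (h / m)) + (1 - m) * (- ln ((1 - h) / (1 - m)))" by simp
  also have "\<dots> \<le> m * (m / h - 1) + (1 - m) * ((1 - m) / (1 - h) - 1)"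
    using le[OF hpos(1) mpos(1)] le[OF hpos(2) mpos(2)] mpos by (intro add_mono mult_left_mono) auto
  also have "\<dots> = (h - m)\<^sup>2 / (h * (1 - h))"
    using hpos by (simp add: field_simps power2_eq_square)
  also have "\<dots> \<le> (h - m)\<^sup>2 / (3 / 16)"
  proof (rule divide_left_mono)
    have "0 \<le> (h - 1 / 4) * (3 / 4 - h)" using assms(2) by (intro mult_nonneg_nonneg) auto
    also have "\<dots> = h * (1 - h) - 3 / 16" by (simp add: field_simps)
    finally show "3 / 16 \<le> h * (1 - h)" by simp
  qed (use hpos in auto)
  finally show ?thesis by (simp add: mult_ac)
qed

text \<open>A pointwise substitute for Pinsker's inequality. With \<open>x\<close> a likelihood
  ratio, multiplying by the indicator of an event and integrating bounds its probability under one
  law by that under the other, up to \<theta> and the divergence over \<theta>.\<close>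

lemma one_le_likelihood:
  fixes x \<theta> :: real
  assumes "0 < x" "0 < \<theta>"
  shows "1 \<le> x + \<theta> + (x - 1 - ln x) / \<theta>"
proof (cases "1 \<le> x")
  case True
  have "0 \<le> (x - 1 - ln x) / \<theta>" using assms ln_le_minus_one[of x] by simp
  then show ?thesis using True assms by linarith
next
  case False
  \<comment> \<open>The square root gives \<open>ln x = 2 * ln s\<close>, and
    \<open>ln s \<le> s - 1\<close> then leaves the square \<open>(1 - s)\<^sup>2\<close>, as in
    Hellinger distance; the rest is the inequality of the means.\<close>
  define s where "s = sqrt x"
  have s: "0 < s" "s\<^sup>2 = x" using assms by (auto simp: s_def)
  then have s1: "s \<le> 1" using False by (metis less_le_not_le linorder_le_cases one_le_power)
  have "ln x = 2 * ln s" using s ln_realpow[of s 2] by simp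
  then have "(1 - s)\<^sup>2 \<le> x - 1 - ln x"
    using ln_le_minus_one[OF s(1)] s(2) by (simp add: power2_eq_square algebra_simps)
  then have "(1 - s)\<^sup>2 / \<theta> \<le> (x - 1 - ln x) / \<theta>" using assms by (simp add: divide_right_mono)
  moreover have "1 - x \<le> \<theta> + (1 - s)\<^sup>2 / \<theta>"
  proof -
    have "1 - x = (1 - s) * (1 + s)" using s(2) by (simp add: power2_eq_square algebra_simps)
    also have "\<dots> \<le> (1 - s) * 2" using s1 by (intro mult_left_mono) auto
    also have "\<dots> \<le> \<theta> + (1 - s)\<^sup>2 / \<theta>"
    proof -
      have "0 \<le> (\<theta> - (1 - s))\<^sup>2 / \<theta>" using assms by simp
      also have "\<dots> = \<theta> - (1 - s) * 2 + (1 - s)\<^sup>2 / \<theta>"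
        using assms by (simp add: power2_eq_square field_simps)
      finally show ?thesis by simp
    qed
    finally show ?thesis .
  qed
  ultimately show ?thesis by simp
qed

context bandit_strategy
begin

definition visits :: "(nat \<Rightarrow> 'a) set \<Rightarrow> nat \<Rightarrow> (nat \<Rightarrow> real) \<times> (nat \<Rightarrow> 'z) \<Rightarrow> real" where
  "visits N t \<omega> = (\<Sum>s\<in>{1..t}. indicator N (arm_at s \<omega>))"

lemma visits_nonneg: "0 \<le> visits N t \<omega>"
  unfolding visits_def by (intro sum_nonneg) auto

lemma visits_le: "visits N t \<omega> \<le> real t"
proof -
  have "(\<Sum>s\<in>{1..t}. indicator N (arm_at s \<omega>)) \<le> (\<Sum>s\<in>{1..t}. 1 :: real)"
    by (intro sum_mono) (auto simp: indicator_def)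
  then show ?thesis by (simp add: visits_def)
qed

lemma visits_measurable:
  assumes "N \<in> sets (arm_algebra p \<T>)"
  shows "visits N t \<in> borel_measurable (history_space S t)"
  unfolding visits_def[abs_def]
  using measurable_compose[OF arm_at_measurable borel_measurable_indicator[OF assms]]
  by (intro borel_measurable_sum) auto

end

section \<open>Likelihood ratio of two reward functions that agree off a set\<close>

locale bandit_pair = bandit_strategy p \<T> S
  for p :: nat and \<T> :: "nat \<Rightarrow> 'a arm_tree" and S :: "('a, 'z) strategy" +
  fixes f h :: "(nat \<Rightarrow> 'a) \<Rightarrow> real" and N :: "(nat \<Rightarrow> 'a) set" and \<Delta> :: real
  assumes f_measurable: "f \<in> borel_measurable (arm_algebra p \<T>)"
    and h_measurable: "h \<in> borel_measurable (arm_algebra p \<T>)"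
    and f_range: "f x \<in> {1 / 4..3 / 4}" and h_range: "h x \<in> {1 / 4..3 / 4}"
    and N_sets: "N \<in> sets (arm_algebra p \<T>)"
    and off_N: "x \<in> space (arm_algebra p \<T>) \<Longrightarrow> x \<notin> N \<Longrightarrow> h x = f x" and diff_le: "\<bar>h x - f x\<bar> \<le> \<Delta>"
begin

abbreviation "P\<^sub>f \<equiv> \<lambda>x. bernoulli_arm (f x)"
abbreviation "P\<^sub>h \<equiv> \<lambda>x. bernoulli_arm (h x)"

lemma unit_range: "f x \<in> {0..1}" "h x \<in> {0..1}"
  using f_range[of x] h_range[of x] by auto

lemmas P\<^sub>f = bernoulli_arm_measurable[OF f_measurable unit_range(1)]
lemmas P\<^sub>h = bernoulli_arm_measurable[OF h_measurable unit_range(2)]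

text \<open>Every \<open>v\<close> other than 1 is treated as the outcome 0, the only other value a
  Bernoulli arm produces.\<close>

definition ratio :: "(nat \<Rightarrow> 'a) \<Rightarrow> real \<Rightarrow> real" where
  "ratio x v = (if v = 1 then h x / f x else (1 - h x) / (1 - f x))"

definition likelihood :: "nat \<Rightarrow> (nat \<Rightarrow> real) \<times> (nat \<Rightarrow> 'z) \<Rightarrow> real" where
  "likelihood t \<omega> = (\<Prod>s\<in>{1..t}. ratio (arm_at s \<omega>) (fst \<omega> s))"

lemma ratio_pos: "0 < ratio x v"
  using f_range[of x] h_range[of x] by (auto simp: ratio_def intro!: divide_pos_pos)

lemma likelihood_pos: "0 < likelihood t \<omega>"
  unfolding likelihood_def by (intro prod_pos ratio_pos)

lemma likelihood_measurable [measurable]: "likelihood t \<in> borel_measurable (history_space S t)"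
  unfolding likelihood_def[abs_def]
proof (rule borel_measurable_prod)
  fix s assume s: "s \<in> {1..t}"
  have [measurable]: "(\<lambda>\<omega>. f (arm_at s \<omega>)) \<in> borel_measurable (history_space S t)"
    "(\<lambda>\<omega>. h (arm_at s \<omega>)) \<in> borel_measurable (history_space S t)"
    "(\<lambda>\<omega>. fst \<omega> s) \<in> borel_measurable (history_space S t)"
    using measurable_compose[OF arm_at_measurable[OF s]] f_measurable h_measurable
      reward_at_measurable[OF s] by auto
  show "(\<lambda>\<omega>. ratio (arm_at s \<omega>) (fst \<omega> s)) \<in> borel_measurable (history_space S t)"
    unfolding ratio_def by measurable
qed

lemmas visits_N_measurable [measurable] = visits_measurable[OF N_sets]

lemma likelihood_extend:
  assumes "\<omega> \<in> space (history_space S t)"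
  shows "likelihood (Suc t) (extend t \<omega> w v) = likelihood t \<omega> * ratio (next_arm t \<omega> w) v"
proof -
  have "fst (extend t \<omega> w v) s = fst \<omega> s" if "s \<in> {1..t}" for s
    using that by (simp add: extend_def)
  moreover have "fst (extend t \<omega> w v) (Suc t) = v" by (simp add: extend_def)
  ultimately show ?thesis
    by (simp add: likelihood_def arm_at_extend arm_at_extend_Suc[OF assms])
qed

lemma visits_extend:
  assumes "\<omega> \<in> space (history_space S t)"
  shows "visits N (Suc t) (extend t \<omega> w v) = visits N t \<omega> + indicator N (next_arm t \<omega> w)"
  by (simp add: visits_def arm_at_extend arm_at_extend_Suc[OF assms])

lemma rand_dist_props:
  "prob_space (rand_dist S (Suc t))" "sets (rand_dist S (Suc t)) = sets (rand_space S)"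
  "space (rand_dist S (Suc t)) = space (rand_space S)"
  using rand_dist_prob[of t] sets_eq_imp_space_eq by (auto simp: space_prob_algebra)

lemma next_arm_rand_measurable:
  assumes "\<omega> \<in> space (history_space S t)" "g \<in> borel_measurable (arm_algebra p \<T>)"
  shows "(\<lambda>w. g (next_arm t \<omega> w)) \<in> borel_measurable (rand_dist S (Suc t))"
  using measurable_compose[OF next_arm_measurable1[OF assms(1)] assms(2)]
  by (simp add: measurable_cong_sets[OF rand_dist_props(2) refl])

lemma extend_rand_measurable:
  assumes "\<omega> \<in> space (history_space S t)" "\<phi> \<in> borel_measurable (history_space S (Suc t))" "v \<in> {0..1}"
  shows "(\<lambda>w. \<phi> (extend t \<omega> w v)) \<in> borel_measurable (rand_dist S (Suc t))"
proof -
  have "(\<lambda>w. (w, v)) \<in> rand_space S \<rightarrow>\<^sub>M rand_space S \<Otimes>\<^sub>M reward_space"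
    using assms(3) by (intro measurable_Pair) (auto simp: space_restrict_space)
  from measurable_compose[OF measurable_compose[OF this extend_measurable1[OF assms(1)]] assms(2)]
  show ?thesis by (simp add: measurable_cong_sets[OF rand_dist_props(2) refl])
qed

text \<open>Multiplying by \<open>ratio\<close> replaces the Bernoulli weights of \<open>f\<close>
  by those of \<open>h\<close>; the randomisation variable has the same law in both problems and
  contributes no factor.\<close>

lemma nn_integral_step_likelihood:
  assumes \<omega>: "\<omega> \<in> space (history_space S t)"
    and \<phi>: "\<phi> \<in> borel_measurable (history_space S (Suc t))"
  shows "(\<integral>\<^sup>+\<omega>'. \<phi> \<omega>' * ennreal (likelihood (Suc t) \<omega>') \<partial>step P\<^sub>f t \<omega>) =
    (\<integral>\<^sup>+\<omega>'. \<phi> \<omega>' \<partial>step P\<^sub>h t \<omega>) * ennreal (likelihood t \<omega>)"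
proof -
  let ?x = "next_arm t \<omega>" and ?R = "rand_dist S (Suc t)"
  have mix: "ennreal (f x) * (a * ennreal (likelihood t \<omega> * ratio x 1)) +
      ennreal (1 - f x) * (b * ennreal (likelihood t \<omega> * ratio x 0)) =
    (ennreal (h x) * a + ennreal (1 - h x) * b) * ennreal (likelihood t \<omega>)" for x a b
  proof -
    have L: "0 \<le> likelihood t \<omega>" using likelihood_pos[of t \<omega>] by simp
    have r: "f x * ratio x 1 = h x" "(1 - f x) * ratio x 0 = 1 - h x"
      using f_range[of x] by (auto simp: ratio_def)
    have 1: "ennreal (f x) * (a * ennreal (likelihood t \<omega> * ratio x 1)) = ennreal (h x) * a * ennreal (likelihood t \<omega>)"
      using unit_range[of x] ratio_pos[of x 1] L unfolding r(1)[symmetric]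
      by (simp add: ennreal_mult less_imp_le mult_ac)
    have 2: "ennreal (1 - f x) * (b * ennreal (likelihood t \<omega> * ratio x 0)) = ennreal (1 - h x) * b * ennreal (likelihood t \<omega>)"
      using unit_range[of x] ratio_pos[of x 0] L unfolding r(2)[symmetric]
      by (simp add: ennreal_mult less_imp_le mult_ac)
    show ?thesis unfolding 1 2 by (simp add: distrib_right)
  qed
  have "(\<integral>\<^sup>+\<omega>'. \<phi> \<omega>' * ennreal (likelihood (Suc t) \<omega>') \<partial>step P\<^sub>f t \<omega>) =
      (\<integral>\<^sup>+w. (ennreal (h (?x w)) * \<phi> (extend t \<omega> w 1) + ennreal (1 - h (?x w)) * \<phi> (extend t \<omega> w 0)) *
        ennreal (likelihood t \<omega>) \<partial>?R)"
    using \<phi> by (subst nn_integral_step_bernoulli[OF f_measurable unit_range(1) \<omega>])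
      (auto simp: likelihood_extend[OF \<omega>] mix)
  also have "\<dots> = (\<integral>\<^sup>+w. ennreal (h (?x w)) * \<phi> (extend t \<omega> w 1) + ennreal (1 - h (?x w)) * \<phi> (extend t \<omega> w 0) \<partial>?R) *
        ennreal (likelihood t \<omega>)"
  proof (rule nn_integral_multc)
    note [measurable] = next_arm_rand_measurable[OF \<omega> h_measurable]
      extend_rand_measurable[OF \<omega> \<phi>, of 0, simplified] extend_rand_measurable[OF \<omega> \<phi>, of 1, simplified]
    show "(\<lambda>w. ennreal (h (?x w)) * \<phi> (extend t \<omega> w 1) + ennreal (1 - h (?x w)) * \<phi> (extend t \<omega> w 0)) \<in> borel_measurable ?R"
      by measurable
  qed
  also have "\<dots> = (\<integral>\<^sup>+\<omega>'. \<phi> \<omega>' \<partial>step P\<^sub>h t \<omega>) * ennreal (likelihood t \<omega>)"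
    by (subst nn_integral_step_bernoulli[OF h_measurable unit_range(2) \<omega> \<phi>]) simp
  finally show ?thesis .
qed

lemma change_of_measure:
  assumes "\<phi> \<in> borel_measurable (history_space S t)"
  shows "(\<integral>\<^sup>+\<omega>. \<phi> \<omega> \<partial>history_law P\<^sub>h S t) = (\<integral>\<^sup>+\<omega>. \<phi> \<omega> * ennreal (likelihood t \<omega>) \<partial>history_law P\<^sub>f S t)"
  using assms
proof (induction t arbitrary: \<phi>)
  case 0
  then show ?case by (simp add: likelihood_def)
next
  case (Suc t)
  note \<phi> = Suc.prems
  have "(\<integral>\<^sup>+\<omega>. \<phi> \<omega> \<partial>history_law P\<^sub>h S (Suc t)) = (\<integral>\<^sup>+\<omega>. (\<integral>\<^sup>+\<omega>'. \<phi> \<omega>' \<partial>step P\<^sub>h t \<omega>) \<partial>history_law P\<^sub>h S t)"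
    by (rule nn_integral_history_law_Suc[OF P\<^sub>h \<phi>])
  also have "\<dots> = (\<integral>\<^sup>+\<omega>. (\<integral>\<^sup>+\<omega>'. \<phi> \<omega>' \<partial>step P\<^sub>h t \<omega>) * ennreal (likelihood t \<omega>) \<partial>history_law P\<^sub>f S t)"
    by (rule Suc.IH[OF nn_integral_step_measurable[OF P\<^sub>h \<phi>]])
  also have "\<dots> = (\<integral>\<^sup>+\<omega>. (\<integral>\<^sup>+\<omega>'. \<phi> \<omega>' * ennreal (likelihood (Suc t) \<omega>') \<partial>step P\<^sub>f t \<omega>) \<partial>history_law P\<^sub>f S t)"
    using history_law_space(3)[OF P\<^sub>f] nn_integral_step_likelihood[OF _ \<phi>]
    by (intro nn_integral_cong) (simp del: history_law.simps)
  also have "\<dots> = (\<integral>\<^sup>+\<omega>. \<phi> \<omega> * ennreal (likelihood (Suc t) \<omega>) \<partial>history_law P\<^sub>f S (Suc t))"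
    by (intro nn_integral_history_law_Suc[OF P\<^sub>f, symmetric] borel_measurable_times_ennreal \<phi>
        measurable_compose[OF likelihood_measurable measurable_ennreal])
  finally show ?case .
qed

text \<open>Under the law of \<open>f\<close> the likelihood has mean 1, so the mean of this
  quantity is the Kullback-Leibler divergence. Adding \<open>likelihood - 1\<close> to minus the
  logarithm makes it nonnegative, so nonnegative integrals apply without a question of
  integrability.\<close>

definition divergence :: "nat \<Rightarrow> (nat \<Rightarrow> real) \<times> (nat \<Rightarrow> 'z) \<Rightarrow> real" where
  "divergence t \<omega> = likelihood t \<omega> - 1 - ln (likelihood t \<omega>)"

lemma divergence_nonneg: "0 \<le> divergence t \<omega>"
  unfolding divergence_def using ln_le_minus_one[OF likelihood_pos, of t \<omega>] by simp

lemma divergence_measurable [measurable]: "divergence t \<in> borel_measurable (history_space S t)"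
  unfolding divergence_def[abs_def] by measurable

text \<open>Averaged over the new reward the likelihood is unchanged, so only the logarithm
  contributes: its mean change is the divergence between the two laws of the arm played, which is
  zero off N.\<close>

lemma divergence_extend:
  assumes \<omega>: "\<omega> \<in> space (history_space S t)" and w: "w \<in> space (rand_space S)"
  shows "f (next_arm t \<omega> w) * divergence (Suc t) (extend t \<omega> w 1) +
      (1 - f (next_arm t \<omega> w)) * divergence (Suc t) (extend t \<omega> w 0)
    \<le> divergence t \<omega> + 16 / 3 * \<Delta>\<^sup>2 * indicator N (next_arm t \<omega> w)"
proof -
  define x l where "x = next_arm t \<omega> w" and "l = likelihood t \<omega>"
  have l: "0 < l" unfolding l_def by (rule likelihood_pos)
  have r: "f x * ratio x 1 = h x" "(1 - f x) * ratio x 0 = 1 - h x"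
    using f_range[of x] by (auto simp: ratio_def)
  have ln_eq: "ln (l * ratio x v) = ln l + ln (ratio x v)" for v
    using l ratio_pos[of x v] by (simp add: ln_mult)
  have "f x * (l * ratio x 1 - 1 - ln (l * ratio x 1)) + (1 - f x) * (l * ratio x 0 - 1 - ln (l * ratio x 0))
      = l * (f x * ratio x 1) + l * ((1 - f x) * ratio x 0) - 1 - ln l
        - (f x * ln (ratio x 1) + (1 - f x) * ln (ratio x 0))"
    unfolding ln_eq by (simp add: algebra_simps)
  also have "\<dots> = (l - 1 - ln l) - (f x * ln (h x / f x) + (1 - f x) * ln ((1 - h x) / (1 - f x)))"
    unfolding r by (simp add: ratio_def algebra_simps)
  also have "\<dots> \<le> (l - 1 - ln l) + 16 / 3 * (h x - f x)\<^sup>2"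
    using bernoulli_divergence_le[OF f_range[of x] h_range[of x]] by simp
  also have "(h x - f x)\<^sup>2 \<le> \<Delta>\<^sup>2 * indicator N x"
    using off_N[of x] measurable_space[OF next_arm_measurable1[OF \<omega>] w] power_mono[OF diff_le[of x], of 2]
    by (cases "x \<in> N") (auto simp: x_def)
  finally show ?thesis
    unfolding divergence_def likelihood_extend[OF \<omega>] x_def l_def by simp
qed

text \<open>The growth of the divergence is compared with the growth of the visits. The old visits
  stand on the left so that nothing is subtracted in \<open>ennreal\<close>.\<close>

lemma nn_integral_step_divergence:
  assumes \<omega>: "\<omega> \<in> space (history_space S t)"
  shows "(\<integral>\<^sup>+\<omega>'. ennreal (divergence (Suc t) \<omega>') \<partial>step P\<^sub>f t \<omega>) + ennreal (16 / 3 * \<Delta>\<^sup>2) * ennreal (visits N t \<omega>)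
    \<le> ennreal (divergence t \<omega>) + ennreal (16 / 3 * \<Delta>\<^sup>2) * (\<integral>\<^sup>+\<omega>'. ennreal (visits N (Suc t) \<omega>') \<partial>step P\<^sub>f t \<omega>)"
proof -
  let ?x = "next_arm t \<omega>" and ?R = "rand_dist S (Suc t)" and ?c = "16 / 3 * \<Delta>\<^sup>2"
  interpret R: prob_space ?R by (rule rand_dist_props(1))
  have [measurable]: "(\<lambda>w. indicator N (?x w) :: ennreal) \<in> borel_measurable ?R"
    using measurable_compose[OF next_arm_measurable1[OF \<omega>] borel_measurable_indicator[OF N_sets]]
    by (simp add: measurable_cong_sets[OF rand_dist_props(2) refl])
  have ind: "ennreal (indicator N x) = indicator N x" for x :: "nat \<Rightarrow> 'a"
    by (auto simp: indicator_def)
  have "(\<integral>\<^sup>+\<omega>'. ennreal (divergence (Suc t) \<omega>') \<partial>step P\<^sub>f t \<omega>) \<le>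
      (\<integral>\<^sup>+w. ennreal (divergence t \<omega>) + ennreal ?c * indicator N (?x w) \<partial>?R)"
  proof (subst nn_integral_step_bernoulli[OF f_measurable unit_range(1) \<omega>], measurable, rule nn_integral_mono)
    fix w assume "w \<in> space ?R"
    then have w: "w \<in> space (rand_space S)" by (simp add: rand_dist_props(3))
    have "ennreal (f (?x w)) * ennreal (divergence (Suc t) (extend t \<omega> w 1)) +
        ennreal (1 - f (?x w)) * ennreal (divergence (Suc t) (extend t \<omega> w 0)) =
      ennreal (f (?x w) * divergence (Suc t) (extend t \<omega> w 1) +
        (1 - f (?x w)) * divergence (Suc t) (extend t \<omega> w 0))"
      using unit_range(1)[of "?x w"] divergence_nonneg by (simp add: ennreal_mult ennreal_plus)
    also have "\<dots> \<le> ennreal (divergence t \<omega> + ?c * indicator N (?x w))"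
      by (intro ennreal_leI divergence_extend[OF \<omega> w])
    also have "\<dots> = ennreal (divergence t \<omega>) + ennreal ?c * indicator N (?x w)"
      using divergence_nonneg by (cases "?x w \<in> N") (simp_all add: ennreal_plus)
    finally show "ennreal (f (?x w)) * ennreal (divergence (Suc t) (extend t \<omega> w 1)) +
        ennreal (1 - f (?x w)) * ennreal (divergence (Suc t) (extend t \<omega> w 0)) \<le> \<dots>" .
  qed
  also have "\<dots> = ennreal (divergence t \<omega>) + ennreal ?c * (\<integral>\<^sup>+w. indicator N (?x w) \<partial>?R)"
    by (simp add: nn_integral_add nn_integral_cmult R.emeasure_space_1)
  finally have div: "(\<integral>\<^sup>+\<omega>'. ennreal (divergence (Suc t) \<omega>') \<partial>step P\<^sub>f t \<omega>) \<le>
      ennreal (divergence t \<omega>) + ennreal ?c * (\<integral>\<^sup>+w. indicator N (?x w) \<partial>?R)" .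
  have "(\<integral>\<^sup>+\<omega>'. ennreal (visits N (Suc t) \<omega>') \<partial>step P\<^sub>f t \<omega>) =
      (\<integral>\<^sup>+w. ennreal (visits N t \<omega>) + indicator N (?x w) \<partial>?R)"
  proof (subst nn_integral_step_bernoulli[OF f_measurable unit_range(1) \<omega>], measurable, rule nn_integral_cong)
    fix w
    have "ennreal (f x) * a + ennreal (1 - f x) * a = a" for x and a :: ennreal
      using unit_range(1)[of x] by (simp add: distrib_right[symmetric] ennreal_plus[symmetric] del: ennreal_plus)
    then show "ennreal (f (?x w)) * ennreal (visits N (Suc t) (extend t \<omega> w 1)) +
        ennreal (1 - f (?x w)) * ennreal (visits N (Suc t) (extend t \<omega> w 0)) =
      ennreal (visits N t \<omega>) + indicator N (?x w)"
      using visits_nonneg by (simp add: visits_extend[OF \<omega>] ennreal_plus ind)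
  qed
  also have "\<dots> = ennreal (visits N t \<omega>) + (\<integral>\<^sup>+w. indicator N (?x w) \<partial>?R)"
    by (simp add: nn_integral_add R.emeasure_space_1)
  finally show ?thesis
    using add_right_mono[OF div] by (simp add: distrib_left add_ac)
qed

lemma expected_divergence:
  "(\<integral>\<^sup>+\<omega>. ennreal (divergence t \<omega>) \<partial>history_law P\<^sub>f S t) \<le>
    ennreal (16 / 3 * \<Delta>\<^sup>2) * (\<integral>\<^sup>+\<omega>. ennreal (visits N t \<omega>) \<partial>history_law P\<^sub>f S t)"
proof (induction t)
  case 0
  have "divergence 0 \<omega> = 0" for \<omega> by (simp add: divergence_def likelihood_def)
  then show ?case by (simp del: history_law.simps)
next
  case (Suc t)
  let ?c = "ennreal (16 / 3 * \<Delta>\<^sup>2)" and ?M = "history_law P\<^sub>f S t"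
  have dm: "(\<lambda>\<omega>. ennreal (divergence t \<omega>)) \<in> borel_measurable ?M"
    "(\<lambda>\<omega>. ennreal (visits N t \<omega>)) \<in> borel_measurable ?M"
    "(\<lambda>\<omega>. \<integral>\<^sup>+\<omega>'. ennreal (divergence (Suc t) \<omega>') \<partial>step P\<^sub>f t \<omega>) \<in> borel_measurable ?M"
    "(\<lambda>\<omega>. \<integral>\<^sup>+\<omega>'. ennreal (visits N (Suc t) \<omega>') \<partial>step P\<^sub>f t \<omega>) \<in> borel_measurable ?M"
    unfolding history_law_measurable_iff[OF P\<^sub>f]
    by (intro nn_integral_step_measurable[OF P\<^sub>f] measurable_compose[OF _ measurable_ennreal]
        divergence_measurable visits_N_measurable)+
  note [measurable] = dm
  have "(\<integral>\<^sup>+\<omega>. (\<integral>\<^sup>+\<omega>'. ennreal (divergence (Suc t) \<omega>') \<partial>step P\<^sub>f t \<omega>) + ?c * ennreal (visits N t \<omega>) \<partial>?M) \<le>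
      (\<integral>\<^sup>+\<omega>. ennreal (divergence t \<omega>) + ?c * (\<integral>\<^sup>+\<omega>'. ennreal (visits N (Suc t) \<omega>') \<partial>step P\<^sub>f t \<omega>) \<partial>?M)"
    using history_law_space(3)[OF P\<^sub>f] nn_integral_step_divergence
    by (intro nn_integral_mono) (simp del: history_law.simps)
  then have "(\<integral>\<^sup>+\<omega>. ennreal (divergence (Suc t) \<omega>) \<partial>history_law P\<^sub>f S (Suc t)) + ?c * (\<integral>\<^sup>+\<omega>. ennreal (visits N t \<omega>) \<partial>?M)
      \<le> (\<integral>\<^sup>+\<omega>. ennreal (divergence t \<omega>) \<partial>?M) + ?c * (\<integral>\<^sup>+\<omega>. ennreal (visits N (Suc t) \<omega>) \<partial>history_law P\<^sub>f S (Suc t))"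
    by (simp add: nn_integral_add nn_integral_cmult nn_integral_history_law_Suc[OF P\<^sub>f] del: history_law.simps)
  also have "\<dots> \<le> ?c * (\<integral>\<^sup>+\<omega>. ennreal (visits N t \<omega>) \<partial>?M) + ?c * (\<integral>\<^sup>+\<omega>. ennreal (visits N (Suc t) \<omega>) \<partial>history_law P\<^sub>f S (Suc t))"
    using Suc.IH by (intro add_right_mono)
  finally have le: "?c * (\<integral>\<^sup>+\<omega>. ennreal (visits N t \<omega>) \<partial>?M) + (\<integral>\<^sup>+\<omega>. ennreal (divergence (Suc t) \<omega>) \<partial>history_law P\<^sub>f S (Suc t))
      \<le> ?c * (\<integral>\<^sup>+\<omega>. ennreal (visits N t \<omega>) \<partial>?M) + ?c * (\<integral>\<^sup>+\<omega>. ennreal (visits N (Suc t) \<omega>) \<partial>history_law P\<^sub>f S (Suc t))"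
    by (simp only: add_ac)
  \<comment> \<open>Cancelling the common summand in \<open>ennreal\<close> requires it to be
    finite, which the trivial bound by \<open>t\<close> provides.\<close>
  have "(\<integral>\<^sup>+\<omega>. ennreal (visits N t \<omega>) \<partial>?M) \<le> (\<integral>\<^sup>+\<omega>. ennreal t \<partial>?M)"
    by (intro nn_integral_mono ennreal_leI visits_le)
  also have "\<dots> = ennreal t"
    using prob_space.emeasure_space_1[OF history_law_space(1)[OF P\<^sub>f]] by simp
  finally have "(\<integral>\<^sup>+\<omega>. ennreal (visits N t \<omega>) \<partial>?M) < \<infinity>" by (rule le_less_trans) simp
  then have "?c * (\<integral>\<^sup>+\<omega>. ennreal (visits N t \<omega>) \<partial>?M) \<noteq> \<infinity>"
    by (simp add: ennreal_mult_eq_top_iff)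
  then show ?case using le by (simp add: ennreal_add_left_cancel_le del: history_law.simps)
qed

end

section \<open>Finding a neglected needle\<close>

context bandit_strategy
begin

lemma final_rand_props:
  assumes "1 \<le> T"
  shows "prob_space (final_rand_dist S T)" "sets (final_rand_dist S T) = sets (rand_space S)"
    "space (final_rand_dist S T) = space (rand_space S)"
proof -
  show "prob_space (final_rand_dist S T)" and *: "sets (final_rand_dist S T) = sets (rand_space S)"
    using strategy assms by (auto simp: is_strategy_def space_prob_algebra)
  show "space (final_rand_dist S T) = space (rand_space S)" using * by (rule sets_eq_imp_space_eq)
qed

lemma bandit_law_props:
  assumes P: "P \<in> arm_algebra p \<T> \<rightarrow>\<^sub>M prob_algebra reward_space" and T: "1 \<le> T"
  shows "prob_space (bandit_law P S T)"
    "sets (bandit_law P S T) = sets (history_space S T \<Otimes>\<^sub>M rand_space S)"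
    "space (bandit_law P S T) = space (history_space S T \<Otimes>\<^sub>M rand_space S)"
proof -
  interpret H: prob_space "history_law P S T" by (rule history_law_space(1)[OF P])
  interpret F: prob_space "final_rand_dist S T" by (rule final_rand_props(1)[OF T])
  interpret pair_prob_space "history_law P S T" "final_rand_dist S T" ..
  show "prob_space (bandit_law P S T)" unfolding bandit_law_def by (rule P.prob_space_axioms)
  show *: "sets (bandit_law P S T) = sets (history_space S T \<Otimes>\<^sub>M rand_space S)"
    unfolding bandit_law_def using history_law_space(2)[OF P] final_rand_props(2)[OF T]
    by (rule sets_pair_measure_cong)
  show "space (bandit_law P S T) = space (history_space S T \<Otimes>\<^sub>M rand_space S)"
    using * by (rule sets_eq_imp_space_eq)
qed

lemma returned_arm_measurable:
  assumes "1 \<le> T"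
  shows "returned_arm S T \<in> history_space S T \<Otimes>\<^sub>M rand_space S \<rightarrow>\<^sub>M arm_algebra p \<T>"
  using strategy assms unfolding is_strategy_def returned_arm_def by blast

lemma emeasure_bandit_law:
  assumes T: "1 \<le> T" and E: "E \<in> sets (history_space S T \<Otimes>\<^sub>M rand_space S)"
    and P: "P \<in> arm_algebra p \<T> \<rightarrow>\<^sub>M prob_algebra reward_space"
  shows "emeasure (bandit_law P S T) E =
    (\<integral>\<^sup>+\<omega>. emeasure (final_rand_dist S T) (Pair \<omega> -` E) \<partial>history_law P S T)"
proof -
  interpret F: prob_space "final_rand_dist S T" by (rule final_rand_props(1)[OF T])
  show ?thesis
    using E bandit_law_props(2)[OF P T] unfolding bandit_law_def
    by (intro F.emeasure_pair_measure_alt) simp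
qed

end

context bandit_pair
begin

text \<open>The final randomisation has the same law in both problems, so the event is replaced by
  its conditional probability \<psi> given the history. Then \<open>one_le_likelihood\<close> is
  multiplied by \<psi> and integrated; \<psi> is bounded by 1 in the error terms only.\<close>

lemma bandit_law_transfer:
  assumes T: "1 \<le> T" and E: "E \<in> sets (history_space S T \<Otimes>\<^sub>M rand_space S)" and \<theta>: "0 < \<theta>"
    and V: "(\<integral>\<^sup>+\<omega>. ennreal (visits N T \<omega>) \<partial>history_law P\<^sub>f S T) \<le> ennreal V" "0 \<le> V"
  shows "measure (bandit_law P\<^sub>f S T) E \<le>
    measure (bandit_law P\<^sub>h S T) E + \<theta> + 16 / 3 * \<Delta>\<^sup>2 * V / \<theta>"
proof -
  let ?F = "final_rand_dist S T" and ?M = "history_law P\<^sub>f S T" and ?c = "16 / 3 * \<Delta>\<^sup>2"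
  define \<psi> where "\<psi> \<omega> = emeasure ?F (Pair \<omega> -` E)" for \<omega>
  interpret F: prob_space ?F by (rule final_rand_props(1)[OF T])
  interpret M: prob_space ?M by (rule history_law_space(1)[OF P\<^sub>f])
  interpret Bf: prob_space "bandit_law P\<^sub>f S T" by (rule bandit_law_props(1)[OF P\<^sub>f T])
  interpret Bh: prob_space "bandit_law P\<^sub>h S T" by (rule bandit_law_props(1)[OF P\<^sub>h T])
  have "E \<in> sets (history_space S T \<Otimes>\<^sub>M ?F)"
    using E sets_pair_measure_cong[OF refl final_rand_props(2)[OF T]] by blast
  then have \<psi>m: "\<psi> \<in> borel_measurable (history_space S T)"
    unfolding \<psi>_def[abs_def] by (rule F.measurable_emeasure_Pair)
  then have [measurable]: "\<psi> \<in> borel_measurable ?M" by (simp add: history_law_measurable_iff[OF P\<^sub>f])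
  have [measurable]: "likelihood T \<in> borel_measurable ?M" "divergence T \<in> borel_measurable ?M"
    unfolding history_law_measurable_iff[OF P\<^sub>f] by (rule likelihood_measurable, rule divergence_measurable)
  have \<psi>1: "\<psi> \<omega> \<le> 1" for \<omega> unfolding \<psi>_def by (rule F.emeasure_le_1)
  have pointwise: "\<psi> \<omega> \<le> \<psi> \<omega> * ennreal (likelihood T \<omega>) + (ennreal \<theta> + ennreal (1 / \<theta>) * ennreal (divergence T \<omega>))" for \<omega>
  proof -
    have "1 \<le> likelihood T \<omega> + (\<theta> + 1 / \<theta> * divergence T \<omega>)"
      using one_le_likelihood[OF likelihood_pos \<theta>, of T \<omega>] by (simp add: divergence_def)
    then have "\<psi> \<omega> * 1 \<le> \<psi> \<omega> * ennreal (likelihood T \<omega> + (\<theta> + 1 / \<theta> * divergence T \<omega>))"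
      by (intro mult_left_mono) (simp_all add: ennreal_ge_1)
    also have "\<dots> = \<psi> \<omega> * (ennreal (likelihood T \<omega>) + (ennreal \<theta> + ennreal (1 / \<theta> * divergence T \<omega>)))"
      using likelihood_pos[of T \<omega>] divergence_nonneg[of T \<omega>] \<theta> by (simp add: ennreal_plus)
    also have "\<dots> = \<psi> \<omega> * ennreal (likelihood T \<omega>) + \<psi> \<omega> * (ennreal \<theta> + ennreal (1 / \<theta>) * ennreal (divergence T \<omega>))"
      unfolding distrib_left using divergence_nonneg[of T \<omega>] \<theta>
      by (subst ennreal_mult) (auto simp: distrib_left)
    also have "\<dots> \<le> \<psi> \<omega> * ennreal (likelihood T \<omega>) + 1 * (ennreal \<theta> + ennreal (1 / \<theta>) * ennreal (divergence T \<omega>))"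
      by (intro add_left_mono mult_right_mono \<psi>1) simp
    finally show ?thesis by simp
  qed
  have "emeasure (bandit_law P\<^sub>f S T) E = (\<integral>\<^sup>+\<omega>. \<psi> \<omega> \<partial>?M)"
    unfolding \<psi>_def by (rule emeasure_bandit_law[OF T E P\<^sub>f])
  also have "\<dots> \<le> (\<integral>\<^sup>+\<omega>. \<psi> \<omega> * ennreal (likelihood T \<omega>) + (ennreal \<theta> + ennreal (1 / \<theta>) * ennreal (divergence T \<omega>)) \<partial>?M)"
    by (intro nn_integral_mono pointwise)
  also have "\<dots> = (\<integral>\<^sup>+\<omega>. \<psi> \<omega> * ennreal (likelihood T \<omega>) \<partial>?M) +
      (ennreal \<theta> + ennreal (1 / \<theta>) * (\<integral>\<^sup>+\<omega>. ennreal (divergence T \<omega>) \<partial>?M))"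
    by (simp add: nn_integral_add nn_integral_cmult M.emeasure_space_1)
  also have "(\<integral>\<^sup>+\<omega>. \<psi> \<omega> * ennreal (likelihood T \<omega>) \<partial>?M) = emeasure (bandit_law P\<^sub>h S T) E"
    using emeasure_bandit_law[OF T E P\<^sub>h] change_of_measure[OF \<psi>m]
    unfolding \<psi>_def[symmetric] by (rule trans[symmetric])
  also have "emeasure (bandit_law P\<^sub>h S T) E + (ennreal \<theta> + ennreal (1 / \<theta>) * (\<integral>\<^sup>+\<omega>. ennreal (divergence T \<omega>) \<partial>?M)) \<le>
      emeasure (bandit_law P\<^sub>h S T) E + (ennreal \<theta> + ennreal (1 / \<theta>) * (ennreal ?c * ennreal V))"
    using order_trans[OF expected_divergence mult_left_mono[OF V(1)]]
    by (intro add_left_mono mult_left_mono) auto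
  also have "\<dots> = ennreal (measure (bandit_law P\<^sub>h S T) E + \<theta> + ?c * V / \<theta>)"
    using \<theta> V(2) by (simp add: Bh.emeasure_eq_measure ennreal_mult'[symmetric] ennreal_plus[symmetric] add_ac del: ennreal_plus)
  finally show ?thesis
    unfolding Bf.emeasure_eq_measure using \<theta> V(2) by (subst (asm) ennreal_le_iff) auto
qed

end

section \<open>Averaging over the candidate needles\<close>

context bandit_strategy
begin

text \<open>By disjointness the expected visits sum to at most T and the return probabilities to at
  most 1. Averaging visits plus T times return probability controls both with the same
  \<open>j\<close>; having at least 4 candidates turns the average \<open>2 * T / card J\<close>
  into at most \<open>T / 2\<close>.\<close>

lemma neglected_needle:
  assumes T: "1 \<le> T" and P: "P \<in> arm_algebra p \<T> \<rightarrow>\<^sub>M prob_algebra reward_space"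
    and J: "finite J" "4 \<le> card J" and N: "\<And>j. j \<in> J \<Longrightarrow> N j \<in> sets (arm_algebra p \<T>)"
    and disj: "disjoint_family_on N J"
  obtains j where "j \<in> J" "(\<integral>\<omega>. visits (N j) T \<omega> \<partial>history_law P S T) \<le> 2 * real T / real (card J)"
    "(\<integral>\<omega>. visits (N j) T \<omega> \<partial>history_law P S T) \<le> real T / 2"
    "measure (bandit_law P S T) {\<omega> \<in> space (bandit_law P S T). returned_arm S T \<omega> \<in> N j} \<le> 1 / 2"
proof -
  let ?M = "history_law P S T" and ?B = "bandit_law P S T" and ?n = "real (card J)"
  let ?R = "\<lambda>j. {\<omega> \<in> space ?B. returned_arm S T \<omega> \<in> N j}"
  interpret M: prob_space ?M by (rule history_law_space(1)[OF P])
  interpret B: prob_space ?B by (rule bandit_law_props(1)[OF P T])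
  define a where "a j = (\<integral>\<omega>. visits (N j) T \<omega> \<partial>?M)" for j
  have int: "integrable ?M (visits (N j) T)" if "j \<in> J" for j
    using visits_measurable[OF N[OF that]] visits_le visits_nonneg
    by (intro M.integrable_const_bound[where B="real T"])
      (auto simp: history_law_measurable_iff[OF P])
  have a0: "0 \<le> a j" for j unfolding a_def by (rule Bochner_Integration.integral_nonneg) (rule visits_nonneg)
  have "(\<Sum>j\<in>J. a j) = (\<integral>\<omega>. (\<Sum>j\<in>J. visits (N j) T \<omega>) \<partial>?M)"
    unfolding a_def by (rule Bochner_Integration.integral_sum[symmetric]) (rule int)
  also have "\<dots> \<le> (\<integral>\<omega>. real T \<partial>?M)"
  proof (rule integral_mono)
    show "integrable ?M (\<lambda>\<omega>. \<Sum>j\<in>J. visits (N j) T \<omega>)" using int by simp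
    fix \<omega>
    have one: "(\<Sum>j\<in>J. indicator (N j) x) \<le> (1 :: real)" for x
    proof -
      have "(\<Sum>j\<in>J. indicator (N j) x) = (indicator (\<Union>j\<in>J. N j) x :: real)"
        using indicator_UN_disjoint[OF J(1) disj] by metis
      then show ?thesis by (simp add: indicator_def)
    qed
    have "(\<Sum>j\<in>J. visits (N j) T \<omega>) = (\<Sum>s\<in>{1..T}. \<Sum>j\<in>J. indicator (N j) (arm_at s \<omega>))"
      unfolding visits_def by (rule sum.swap)
    also have "\<dots> \<le> (\<Sum>s\<in>{1..T}. 1)" by (intro sum_mono one)
    finally show "(\<Sum>j\<in>J. visits (N j) T \<omega>) \<le> real T" by simp
  qed simp
  finally have suma: "(\<Sum>j\<in>J. a j) \<le> real T" by (simp add: M.prob_space)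
  have R: "?R j \<in> sets ?B" if "j \<in> J" for j
    using measurable_sets[OF returned_arm_measurable[OF T] N[OF that]]
    by (simp add: bandit_law_props(2,3)[OF P T] vimage_def Int_def conj_commute)
  have "(\<Sum>j\<in>J. measure ?B (?R j)) = measure ?B (\<Union>j\<in>J. ?R j)"
    using R disj J(1)
    by (intro B.finite_measure_finite_Union[symmetric]) (auto simp: disjoint_family_on_def)
  then have sumb: "(\<Sum>j\<in>J. measure ?B (?R j)) \<le> 1" by simp
  have "\<exists>j\<in>J. a j + T * measure ?B (?R j) \<le> 2 * real T / ?n"
  proof (rule ccontr)
    assume "\<not> ?thesis"
    then have "(\<Sum>j\<in>J. 2 * real T / ?n) < (\<Sum>j\<in>J. a j + T * measure ?B (?R j))"
      using J by (intro sum_strict_mono) (auto simp: not_le)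
    also have "\<dots> = (\<Sum>j\<in>J. a j) + T * (\<Sum>j\<in>J. measure ?B (?R j))"
      by (simp add: sum.distrib sum_distrib_left)
    also have "\<dots> \<le> real T + real T * 1"
      by (intro add_mono mult_left_mono suma sumb) simp
    finally show False using J(2) by simp
  qed
  then obtain j where j: "j \<in> J" "a j + T * measure ?B (?R j) \<le> 2 * real T / ?n" by blast
  have "2 * real T / ?n \<le> 2 * real T / 4"
    using J(2) by (intro divide_left_mono) auto
  then have half: "a j + T * measure ?B (?R j) \<le> real T / 2" using j(2) by linarith
  have Tb: "0 \<le> T * measure ?B (?R j)" by simp
  have "T * measure ?B (?R j) \<le> T * (1 / 2)" using half a0[of j] by simp
  then have "measure ?B (?R j) \<le> 1 / 2" using T by simp
  then show ?thesis
    using that[OF j(1)] j(2) half Tb unfolding a_def[symmetric] by linarith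
qed

text \<open>Markov's inequality: a mean of at most \<open>T / 2\<close> exceeds
  \<open>3 / 4 * T\<close> with probability at most 2/3.\<close>

lemma few_visits_event:
  assumes T: "1 \<le> T" and P: "P \<in> arm_algebra p \<T> \<rightarrow>\<^sub>M prob_algebra reward_space"
    and N: "N \<in> sets (arm_algebra p \<T>)"
    and le: "(\<integral>\<omega>. visits N T \<omega> \<partial>history_law P S T) \<le> real T / 2"
  defines "E \<equiv> {\<omega> \<in> space (history_space S T \<Otimes>\<^sub>M rand_space S). visits N T (fst \<omega>) < 3 / 4 * real T}"
  shows "E \<in> sets (history_space S T \<Otimes>\<^sub>M rand_space S)" "1 / 3 \<le> measure (bandit_law P S T) E"
proof -
  let ?M = "history_law P S T" and ?B = "bandit_law P S T" and ?F = "final_rand_dist S T"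
  interpret M: prob_space ?M by (rule history_law_space(1)[OF P])
  interpret F: prob_space ?F by (rule final_rand_props(1)[OF T])
  have [measurable]: "(\<lambda>\<omega>. visits N T (fst \<omega>)) \<in> borel_measurable (history_space S T \<Otimes>\<^sub>M rand_space S)"
    by (rule measurable_compose[OF measurable_fst visits_measurable[OF N]])
  show "E \<in> sets (history_space S T \<Otimes>\<^sub>M rand_space S)" unfolding E_def by measurable
  have vm: "visits N T \<in> borel_measurable ?M"
    using visits_measurable[OF N] by (simp add: history_law_measurable_iff[OF P])
  have int: "integrable ?M (visits N T)"
    using vm visits_le visits_nonneg by (intro M.integrable_const_bound[where B="real T"]) auto
  let ?A = "{\<omega> \<in> space ?M. visits N T \<omega> < 3 / 4 * real T}"
  have A: "?A \<in> sets ?M" using vm by measurable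
  have "measure ?M {\<omega> \<in> space ?M. 3 / 4 * real T \<le> visits N T \<omega>} \<le>
      (\<integral>\<omega>. visits N T \<omega> \<partial>?M) / (3 / 4 * real T)"
    using T by (intro integral_Markov_inequality_measure[OF int, where A="{}"]) (auto simp: visits_nonneg)
  also have "\<dots> \<le> (real T / 2) / (3 / 4 * real T)" by (intro divide_right_mono le) simp
  also have "\<dots> = 2 / 3" using T by simp
  also have "{\<omega> \<in> space ?M. 3 / 4 * real T \<le> visits N T \<omega>} = space ?M - ?A" by auto
  finally have "1 / 3 \<le> measure ?M ?A" using M.prob_compl[OF A] by simp
  also have "measure ?M ?A = measure ?B (?A \<times> space ?F)"
    unfolding bandit_law_def using A F.emeasure_pair_measure_Times[OF A sets.top]
    by (simp add: measure_def F.emeasure_space_1)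
  also have "?A \<times> space ?F = E"
    unfolding E_def using history_law_space(3)[OF P] final_rand_props(3)[OF T]
    by (auto simp: space_pair_measure)
  finally show "1 / 3 \<le> measure ?B E" .
qed

text \<open>With \<theta> = 1/12 and \<open>1536 = 16 / 3 * 2 * 12 * 12\<close>, both error terms of
  the transfer are at most 1/12. The probabilities 1/3 and 1/2 under the reference law thus lose at
  most 1/6, and at least 1/6 remains of each.\<close>

lemma needle_lower_bound:
  assumes T: "1 \<le> T" and J: "finite J" "4 \<le> card J"
    and pairs: "\<And>j. j \<in> J \<Longrightarrow> bandit_pair p \<T> S f (h j) (N j) \<Delta>"
    and disj: "disjoint_family_on N J"
    and small: "1536 * \<Delta>\<^sup>2 * real T \<le> real (card J)"
  shows "\<exists>j\<in>J.
    (\<exists>E\<in>sets (bandit_law (\<lambda>x. bernoulli_arm (h j x)) S T).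
      1 / 6 \<le> measure (bandit_law (\<lambda>x. bernoulli_arm (h j x)) S T) E \<and>
      (\<forall>\<omega>\<in>E. visits (N j) T (fst \<omega>) \<le> 3 / 4 * real T)) \<and>
    (\<exists>E\<in>sets (bandit_law (\<lambda>x. bernoulli_arm (h j x)) S T).
      1 / 6 \<le> measure (bandit_law (\<lambda>x. bernoulli_arm (h j x)) S T) E \<and>
      (\<forall>\<omega>\<in>E. returned_arm S T \<omega> \<in> space (arm_algebra p \<T>) - N j))"
proof -
  have "J \<noteq> {}" using J(2) by auto
  then obtain j\<^sub>0 where "j\<^sub>0 \<in> J" by blast
  then interpret pair\<^sub>0: bandit_pair p \<T> S f "h j\<^sub>0" "N j\<^sub>0" \<Delta> by (rule pairs)
  let ?Pf = "\<lambda>x. bernoulli_arm (f x)"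
  have Pf: "?Pf \<in> arm_algebra p \<T> \<rightarrow>\<^sub>M prob_algebra reward_space" by (rule pair\<^sub>0.P\<^sub>f)
  have N: "N j \<in> sets (arm_algebra p \<T>)" if "j \<in> J" for j
    using pairs[OF that] by (rule bandit_pair.N_sets)
  obtain j where j: "j \<in> J"
    and few: "(\<integral>\<omega>. visits (N j) T \<omega> \<partial>history_law ?Pf S T) \<le> 2 * real T / real (card J)"
    and half: "(\<integral>\<omega>. visits (N j) T \<omega> \<partial>history_law ?Pf S T) \<le> real T / 2"
    and ret: "measure (bandit_law ?Pf S T) {\<omega> \<in> space (bandit_law ?Pf S T). returned_arm S T \<omega> \<in> N j} \<le> 1 / 2"
    by (rule neglected_needle[OF T Pf J N disj]) (assumption, rule that)
  interpret bandit_pair p \<T> S f "h j" "N j" \<Delta> by (rule pairs[OF j])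
  interpret M: prob_space "history_law P\<^sub>f S T" by (rule history_law_space(1)[OF P\<^sub>f])
  interpret B: prob_space "bandit_law P\<^sub>f S T" by (rule bandit_law_props(1)[OF P\<^sub>f T])
  let ?V = "2 * real T / real (card J)"
  have "integrable (history_law P\<^sub>f S T) (visits (N j) T)"
    using visits_measurable[OF N_sets] visits_le visits_nonneg
    by (intro M.integrable_const_bound[where B="real T"]) (auto simp: history_law_measurable_iff[OF P\<^sub>f])
  then have V: "(\<integral>\<^sup>+\<omega>. ennreal (visits (N j) T \<omega>) \<partial>history_law P\<^sub>f S T) \<le> ennreal ?V"
    using few by (subst nn_integral_eq_integral) (auto simp: visits_nonneg ennreal_leI)
  have "16 / 3 * \<Delta>\<^sup>2 * ?V / (1 / 12) = 1536 * \<Delta>\<^sup>2 * real T / (12 * real (card J))"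
    by (simp add: field_simps)
  also have "\<dots> \<le> real (card J) / (12 * real (card J))"
    by (intro divide_right_mono small) simp
  also have "\<dots> = 1 / 12" using J by auto
  finally have small': "16 / 3 * \<Delta>\<^sup>2 * ?V / (1 / 12) \<le> 1 / 12" .
  have transfer: "measure (bandit_law P\<^sub>f S T) E - 1 / 6 \<le> measure (bandit_law P\<^sub>h S T) E"
    if "E \<in> sets (history_space S T \<Otimes>\<^sub>M rand_space S)" for E
    using bandit_law_transfer[OF T that _ V, of "1 / 12"] small' by simp
  note sets_h = bandit_law_props(2)[OF P\<^sub>h T]
  let ?E = "{\<omega> \<in> space (history_space S T \<Otimes>\<^sub>M rand_space S). visits (N j) T (fst \<omega>) < 3 / 4 * real T}"
  let ?E' = "{\<omega> \<in> space (history_space S T \<Otimes>\<^sub>M rand_space S). returned_arm S T \<omega> \<in> space (arm_algebra p \<T>) - N j}"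
  note E = few_visits_event[OF T P\<^sub>f N_sets half]
  have R: "{\<omega> \<in> space (bandit_law P\<^sub>f S T). returned_arm S T \<omega> \<in> N j} \<in> sets (bandit_law P\<^sub>f S T)"
    using measurable_sets[OF returned_arm_measurable[OF T] N_sets]
    by (simp add: bandit_law_props(2,3)[OF P\<^sub>f T] vimage_def Int_def conj_commute)
  have E'_eq: "?E' = space (bandit_law P\<^sub>f S T) - {\<omega> \<in> space (bandit_law P\<^sub>f S T). returned_arm S T \<omega> \<in> N j}"
    using measurable_space[OF returned_arm_measurable[OF T]] bandit_law_props(3)[OF P\<^sub>f T] by auto
  then have E': "?E' \<in> sets (history_space S T \<Otimes>\<^sub>M rand_space S)"
    using sets.compl_sets[OF R] unfolding bandit_law_props(2)[OF P\<^sub>f T] by (simp only:)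
  have "1 / 2 \<le> measure (bandit_law P\<^sub>f S T) ?E'"
    unfolding E'_eq using B.prob_compl[OF R] ret by simp
  then have "1 / 6 \<le> measure (bandit_law P\<^sub>h S T) ?E'" using transfer[OF E'] by simp
  moreover have "1 / 6 \<le> measure (bandit_law P\<^sub>h S T) ?E" using transfer[OF E(1)] E(2) by simp
  moreover have "?E \<in> sets (bandit_law P\<^sub>h S T)" "?E' \<in> sets (bandit_law P\<^sub>h S T)"
    unfolding sets_h by (rule E(1), rule E')
  ultimately show ?thesis
    by (intro bexI[OF _ j] conjI bexI[of _ ?E] bexI[of _ ?E']) auto
qed

end

section \<open>Needles in a cascade\<close>

context leafless_tree
begin

text \<open>
  Blocks of \<open>n + 2\<close> depths: both children are kept at the first \<open>n\<close> of them, so that a block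
  multiplies the number of nodes by \<open>2 ^ n\<close>. The block below level \<open>K\<close> keeps all children, which
  leaves room for at least four needles in each node of level \<open>K\<close>.
\<close>

definition block_pattern :: "nat \<Rightarrow> nat \<Rightarrow> nat \<Rightarrow> bool" where
  "block_pattern n K e \<longleftrightarrow> e mod (n + 2) < n \<or> (n + 2) * K \<le> e"

abbreviation blocks :: "nat \<Rightarrow> nat \<Rightarrow> nat \<Rightarrow> 'a set set" where
  "blocks n K \<equiv> cascade (block_pattern n K)"

definition needles :: "nat \<Rightarrow> nat \<Rightarrow> 'a set set" where
  "needles n K = blocks n K ((n + 2) * Suc K)"

text \<open>Levels up to \<open>K\<close> ignore \<nu>, so all candidates share them, and the empty
  set in place of \<nu> describes the situation without a needle.\<close>

definition level_sets :: "nat \<Rightarrow> nat \<Rightarrow> 'a set \<Rightarrow> nat \<Rightarrow> 'a set" where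
  "level_sets n K \<nu> k = (if k \<le> K then \<Union>(blocks n K ((n + 2) * k)) else if k = Suc K then \<nu> else {})"

lemma card_blocks: "k \<le> K \<Longrightarrow> card (blocks n K ((n + 2) * k)) = 2 ^ (n * k)"
proof (induction k)
  case (Suc k)
  let ?s = "n + 2"
  have keep: "block_pattern n K (?s * k + j)" if "j < n" for j
    using that by (simp add: block_pattern_def mod_mult_self4 del: mult_Suc)
  have thin: "\<not> block_pattern n K (?s * k + n + j)" if "j < 2" for j
  proof -
    have "(?s * k + (n + j)) mod ?s = n + j" unfolding mod_mult_self4 using that by simp
    moreover have "?s * k + n + j < ?s * Suc k" using that by simp
    moreover have "?s * Suc k \<le> ?s * K" using Suc.prems by (rule mult_le_mono2)
    ultimately show ?thesis unfolding block_pattern_def add.assoc by linarith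
  qed
  have "?s * Suc k = ?s * k + n + 2" by simp
  then have "card (blocks n K (?s * Suc k)) = card (blocks n K (?s * k + n))"
    using card_cascade_thin[of 2 "block_pattern n K" "?s * k + n"] thin by presburger
  also have "\<dots> = 2 ^ n * card (blocks n K (?s * k))"
    using keep by (rule card_cascade_keep)
  finally show ?case using Suc by (simp add: power_add)
qed simp

text \<open>The last block doubles the count at all its \<open>n + 2\<close> depths. The summand 2
  in the block length guarantees four needles even if \<open>n\<close> and \<open>K\<close> are
  0.\<close>

lemma card_needles: "card (needles n K) = 2 ^ (n + 2) * 2 ^ (n * K)"
proof -
  have "(n + 2) * Suc K = (n + 2) * K + (n + 2)" by simp
  then have "card (needles n K) = 2 ^ (n + 2) * card (blocks n K ((n + 2) * K))"
    unfolding needles_def using card_cascade_keep[of "n + 2" "block_pattern n K" "(n + 2) * K"]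
    by (simp only:) (simp add: block_pattern_def)
  then show ?thesis unfolding card_blocks[OF order_refl] .
qed

lemma needle_node_at: "\<nu> \<in> needles n K \<Longrightarrow> node_at \<T> ((n + 2) * Suc K) \<nu>"
  unfolding needles_def by (rule cascade_node_at)

lemma needles_disjoint: "\<nu> \<in> needles n K \<Longrightarrow> \<nu>' \<in> needles n K \<Longrightarrow> \<nu> \<noteq> \<nu>' \<Longrightarrow> \<nu> \<inter> \<nu>' = {}"
  using node_at_eq_or_disjoint needle_node_at by blast

text \<open>Up to level \<open>K\<close> the last depth of a block keeps left children only, so the
  right child of W lies outside. For the needle itself, one of the two chosen children of W is the
  needle and the other lies outside.\<close>

lemma level_sets_split:
  assumes \<nu>: "\<nu> \<in> needles n K" and W: "node_at \<T> e W" and e: "Suc e = (n + 2) * Suc k"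
    and meets: "W \<inter> level_sets n K \<nu> (Suc k) \<noteq> {}"
  shows "\<exists>V\<^sub>1\<in>tree_children \<T> W. \<exists>V\<^sub>2\<in>tree_children \<T> W.
    V\<^sub>1 \<subseteq> level_sets n K \<nu> (Suc k) \<and> V\<^sub>2 \<inter> level_sets n K \<nu> (Suc k) = {}"
proof -
  have same: "W = W'" if "W' \<in> blocks n K e" "U \<in> tree_children \<T> W'" "U \<inter> W \<noteq> {}" for U W'
    using node_at_eq_or_disjoint[OF W cascade_node_at[OF that(1)]]
      child_subset(1)[OF cascade_node_at[OF that(1)] that(2)] that(3) by blast
  note lr = left_right_child[OF W]
  consider "Suc k \<le> K" | "k = K" using meets by (force simp: level_sets_def split: if_splits)
  then show ?thesis
  proof cases
    case 1
    then have A: "level_sets n K \<nu> (Suc k) = \<Union>(blocks n K (Suc e))"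
      by (simp add: level_sets_def e del: cascade.simps mult_Suc_right)
    \<comment> \<open>W has residue \<open>n + 1\<close>, the last depth of its block, and is above
      the final block, in which nothing is dropped.\<close>
    have "e = (n + 2) * k + (n + 1)" using e by simp
    moreover have "((n + 2) * k + (n + 1)) mod (n + 2) = n + 1"
      by (subst mod_mult_self4) simp
    moreover have "e < (n + 2) * K"
      using e mult_le_mono2[OF 1, of "n + 2"] by linarith
    ultimately have thin: "\<not> block_pattern n K e" by (auto simp: block_pattern_def)
    obtain U where U: "U \<in> blocks n K (Suc e)" "U \<inter> W \<noteq> {}" using meets A by blast
    obtain W' where W': "W' \<in> blocks n K e" "U \<in> tree_children \<T> W'" "U = left_child W'"
      using U(1) thin by (auto elim!: cascade_SucE simp del: cascade.simps)
    have WW: "W = W'" by (rule same[OF W'(1,2) U(2)])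
    have "right_child W \<inter> U' = {}" if U': "U' \<in> blocks n K (Suc e)" for U'
    proof -
      obtain W2 where W2: "W2 \<in> blocks n K e" "U' \<in> tree_children \<T> W2" "U' = left_child W2"
        by (rule cascade_SucE[OF U']) (use thin in blast)
      show ?thesis
      proof (cases "W2 = W")
        case True
        then show ?thesis using lr(3) W2(3) by blast
      next
        case False
        then show ?thesis
          using cascade_children_disjoint[OF _ W2(1) _ lr(2) W2(2)] W'(1) WW by blast
      qed
    qed
    then have "right_child W \<inter> level_sets n K \<nu> (Suc k) = {}" unfolding A by blast
    moreover have "left_child W \<subseteq> level_sets n K \<nu> (Suc k)" unfolding A using U(1) W'(3) WW by blast
    ultimately show ?thesis using lr(1,2) by blast
  next
    case 2
    then have A: "level_sets n K \<nu> (Suc k) = \<nu>" by (simp add: level_sets_def)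
    have "\<nu> \<in> blocks n K (Suc e)" using \<nu> unfolding needles_def e 2 .
    then obtain W' where W': "W' \<in> blocks n K e" "\<nu> \<in> tree_children \<T> W'" "\<nu> = left_child W' \<or> \<nu> = right_child W'"
      by (auto elim!: cascade_SucE simp del: cascade.simps)
    have "W = W'" using same[OF W'(1,2)] meets A by blast
    then show ?thesis using W' lr unfolding A by blast
  qed
qed

lemma level_sets_nested:
  assumes \<nu>: "\<nu> \<in> needles n K" and \<beta>: "0 \<le> \<beta>" and a: "0 < a" "a \<le> 1 / 4" "a powr (- \<beta>) = 2 ^ n"
  shows "nested_levels q \<T> (n + 2) K a \<beta> (level_sets n K \<nu>)"
proof unfold_locales
  let ?s = "n + 2" and ?A = "level_sets n K \<nu>"
  show "0 < n + 2" "0 \<le> \<beta>" "0 < a" "a \<le> 1 / 4" using \<beta> a by simp_all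
  show "?A 0 = tree_root \<T>" by (simp add: level_sets_def)
  show "?A (Suc k) \<subseteq> ?A k" for k
  proof -
    have "\<Union>(blocks n K (?s * Suc k)) \<subseteq> \<Union>(blocks n K (?s * k))"
      by (rule cascade_Union_antimono) simp
    moreover have "\<nu> \<subseteq> \<Union>(blocks n K (?s * Suc K))" using \<nu> unfolding needles_def by blast
    ultimately show ?thesis by (cases "k = K") (auto simp: level_sets_def simp del: cascade.simps mult_Suc_right)
  qed
  show "Suc K < k \<Longrightarrow> ?A k = {}" for k by (simp add: level_sets_def)
  show "?A (Suc K) \<noteq> {}" using node_at_nonempty[OF needle_node_at[OF \<nu>]] by (simp add: level_sets_def)
  show "V \<subseteq> ?A k \<or> V \<inter> ?A k = {}" if V: "node_at \<T> (?s * k) V" for k V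
  proof -
    have "V \<subseteq> \<Union>(blocks n K (?s * k)) \<or> V \<inter> \<Union>(blocks n K (?s * k)) = {}"
      using node_at_eq_or_disjoint[OF V] cascade_node_at by blast
    moreover have "V = \<nu> \<or> V \<inter> \<nu> = {}" if "k = Suc K"
      using node_at_eq_or_disjoint[OF V[unfolded that] needle_node_at[OF \<nu>]] by blast
    ultimately show ?thesis by (auto simp: level_sets_def)
  qed
  show "node_at \<T> e W \<Longrightarrow> Suc e = ?s * Suc k \<Longrightarrow> W \<inter> ?A (Suc k) \<noteq> {} \<Longrightarrow>
      \<exists>V\<^sub>1\<in>tree_children \<T> W. \<exists>V\<^sub>2\<in>tree_children \<T> W. V\<^sub>1 \<subseteq> ?A (Suc k) \<and> V\<^sub>2 \<inter> ?A (Suc k) = {}" for e W k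
    by (rule level_sets_split[OF \<nu>])
  show "real (card {V. node_at \<T> (?s * k) V \<and> V \<subseteq> ?A k}) \<le> a powr (- \<beta> * real k)" if "k \<le> Suc K" for k
  proof -
    have "a powr (- \<beta> * real k) = (a powr (- \<beta>)) powr real k" by (simp add: powr_powr)
    also have "\<dots> = (a powr (- \<beta>)) ^ k" using a(1) by (intro powr_realpow) simp
    finally have pw: "a powr (- \<beta> * real k) = 2 ^ (n * k)" unfolding a(3) power_mult .
    show ?thesis
    proof (cases "k \<le> K")
      case True
      have Ak: "?A k = \<Union>(blocks n K (?s * k))" using True by (simp add: level_sets_def)
      have "{V. node_at \<T> (?s * k) V \<and> V \<subseteq> \<Union>(blocks n K (?s * k))} \<subseteq> blocks n K (?s * k)"
      proof
        fix V assume "V \<in> {V. node_at \<T> (?s * k) V \<and> V \<subseteq> \<Union>(blocks n K (?s * k))}"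
        then have V: "node_at \<T> (?s * k) V" "V \<subseteq> \<Union>(blocks n K (?s * k))" by auto
        then obtain U where "U \<in> blocks n K (?s * k)" "V \<inter> U \<noteq> {}"
          using node_at_nonempty[OF V(1)] by blast
        then show "V \<in> blocks n K (?s * k)"
          using node_at_eq_or_disjoint[OF V(1) cascade_node_at] by blast
      qed
      from card_mono[OF finite_cascade this]
      have "card {V. node_at \<T> (?s * k) V \<and> V \<subseteq> ?A k} \<le> 2 ^ (n * k)"
        unfolding Ak card_blocks[OF True] .
      then show ?thesis unfolding pw by (metis of_nat_le_iff of_nat_numeral of_nat_power)
    next
      case False
      then have k: "k = Suc K" using that by simp
      have "{V. node_at \<T> (?s * k) V \<and> V \<subseteq> ?A k} \<subseteq> {\<nu>}"
      proof
        fix V assume "V \<in> {V. node_at \<T> (?s * k) V \<and> V \<subseteq> ?A k}"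
        then have V: "node_at \<T> (?s * Suc K) V" "V \<subseteq> \<nu>" by (auto simp: k level_sets_def)
        then have "V \<inter> \<nu> \<noteq> {}" using node_at_nonempty[OF V(1)] by blast
        then show "V \<in> {\<nu>}" using node_at_eq_or_disjoint[OF V(1) needle_node_at[OF \<nu>]] by simp
      qed
      from card_mono[OF _ this] have "card {V. node_at \<T> (?s * k) V \<and> V \<subseteq> ?A k} \<le> 1" by simp
      then have "real (card {V. node_at \<T> (?s * k) V \<and> V \<subseteq> ?A k}) \<le> 1" by linarith
      also have "1 \<le> (2 :: real) ^ (n * k)" by simp
      finally show ?thesis unfolding pw .
    qed
  qed
qed

end

section \<open>The lower bound\<close>

text \<open>The integer \<open>n\<close> is prescribed first and \<open>a\<close> solved for.
  Rounding \<open>2 * \<beta>\<close> up makes \<open>n / \<beta> \<ge> 2\<close>, hence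
  \<open>a \<le> 1 / 4\<close>; for \<beta> = 0 there is no growth and \<open>n = 0\<close>.\<close>

lemma scale_exists:
  fixes \<beta> :: real
  assumes "0 \<le> \<beta>"
  obtains n :: nat and a :: real where "0 < a" "a \<le> 1 / 4" "a powr (- \<beta>) = 2 ^ n"
proof (cases "\<beta> = 0")
  case True
  then show ?thesis using that[of "1 / 4" 0] by simp
next
  case False
  define n where "n = nat \<lceil>2 * \<beta>\<rceil>"
  have n: "2 * \<beta> \<le> real n" unfolding n_def by linarith
  define a where "a = 2 powr (- real n / \<beta>)"
  have "a powr (- \<beta>) = 2 ^ n"
    using False by (simp add: a_def powr_powr powr_realpow)
  moreover have "a \<le> 2 powr (- 2)"
    unfolding a_def using n assms False by (intro powr_mono) (auto simp: field_simps)
  then have "a \<le> 1 / 4" by (simp add: powr_minus)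
  moreover have "0 < a" by (simp add: a_def)
  ultimately show ?thesis using that by blast
qed

context leafless_arms
begin

sublocale axis: leafless_tree q "\<T> 1"
  by (rule leafless_tree[OF one_in])

text \<open>The reference reward, with largest value \<open>3 / 4 - a ^ K / 2\<close> on level
  \<open>K\<close>; a needle fills exactly the remaining \<open>a ^ K / 2\<close>.\<close>

definition base_reward :: "nat \<Rightarrow> nat \<Rightarrow> real \<Rightarrow> (nat \<Rightarrow> 'a) \<Rightarrow> real" where
  "base_reward n K a x = 1 / 4 + (\<Sum>k<K. (a ^ k - a ^ Suc k) *
    indicator (axis.level_sets n K {} (Suc k)) (x 1)) / 2"

definition needle_reward :: "nat \<Rightarrow> nat \<Rightarrow> real \<Rightarrow> 'a set \<Rightarrow> (nat \<Rightarrow> 'a) \<Rightarrow> real" where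
  "needle_reward n K a \<nu> x = base_reward n K a x + a ^ K / 2 * indicator \<nu> (x 1)"

lemma needle_reward_props:
  assumes \<nu>: "\<nu> \<in> axis.needles n K" and \<beta>: "0 \<le> \<beta>" and a: "0 < a" "a \<le> 1 / 4" "a powr (- \<beta>) = 2 ^ n"
  shows "needle_reward n K a \<nu> \<in> borel_measurable (arm_algebra p \<T>)"
    "needle_reward n K a \<nu> x \<in> {1 / 4..3 / 4}"
    "max_reward p \<T> (needle_reward n K a \<nu>) = 3 / 4"
    "x 1 \<notin> \<nu> \<Longrightarrow> needle_reward n K a \<nu> x \<le> 3 / 4 - a ^ K / 2"
    "\<lbrakk>2 ^ n * real q ^ ((n + 2) * (12 * p)) \<le> \<kappa>; real ((n + 2) * (1 + 12 * p)) \<le> \<Lambda>;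
      0 < \<gamma>; \<gamma> \<le> 1 / real q ^ (n + 2)\<rbrakk> \<Longrightarrow> well_behaved p \<T> (needle_reward n K a \<nu>) \<beta> \<gamma> \<kappa> \<Lambda>"
proof -
  interpret nested_levels q "\<T> 1" "n + 2" K a \<beta> "axis.level_sets n K \<nu>"
    by (rule axis.level_sets_nested[OF \<nu> \<beta> a])
  interpret first_axis p q \<T> "n + 2" K a \<beta> "axis.level_sets n K \<nu>" ..
  have eq: "needle_reward n K a \<nu> = reward"
  proof
    fix x :: "nat \<Rightarrow> 'a"
    \<comment> \<open>The summand \<open>k = K\<close> has weight \<open>a ^ K - 0\<close> and is
      the needle; all earlier levels are the same with the empty set in place of \<nu>.\<close>
    have "(\<Sum>k\<le>K. (level_gap k - level_gap (Suc k)) * indicator (axis.level_sets n K \<nu> (Suc k)) (x 1)) =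
        (\<Sum>k<K. (a ^ k - a ^ Suc k) * indicator (axis.level_sets n K {} (Suc k)) (x 1)) +
        a ^ K * indicator \<nu> (x 1)"
      unfolding lessThan_Suc_atMost[symmetric] sum.lessThan_Suc
      by (intro arg_cong2[where f="(+)"] sum.cong) (auto simp: level_gap_def axis.level_sets_def)
    then show "needle_reward n K a \<nu> x = reward x"
      by (simp add: needle_reward_def base_reward_def reward_def gap_def field_simps)
  qed
  show "needle_reward n K a \<nu> \<in> borel_measurable (arm_algebra p \<T>)"
    "needle_reward n K a \<nu> x \<in> {1 / 4..3 / 4}"
    "max_reward p \<T> (needle_reward n K a \<nu>) = 3 / 4"
    unfolding eq by (rule reward_measurable, rule reward_range, rule max_reward)
  show "needle_reward n K a \<nu> x \<le> 3 / 4 - a ^ K / 2" if "x 1 \<notin> \<nu>"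
    using gap_ge[of "x 1" K] that unfolding eq reward_def by (simp add: axis.level_sets_def level_gap_def)
  show "well_behaved p \<T> (needle_reward n K a \<nu>) \<beta> \<gamma> \<kappa> \<Lambda>"
    if "2 ^ n * real q ^ ((n + 2) * (12 * p)) \<le> \<kappa>" "real ((n + 2) * (1 + 12 * p)) \<le> \<Lambda>"
      "0 < \<gamma>" "\<gamma> \<le> 1 / real q ^ (n + 2)"
    unfolding eq using that a(3) by (intro reward_well_behaved) simp_all
qed

lemma needle_bandit_pair:
  fixes S :: "('a, 'z) strategy"
  assumes S: "is_strategy p \<T> S" and \<nu>: "\<nu> \<in> axis.needles n K"
    and \<beta>: "0 \<le> \<beta>" and a: "0 < a" "a \<le> 1 / 4" "a powr (- \<beta>) = 2 ^ n"
  shows "bandit_pair p \<T> S (base_reward n K a) (needle_reward n K a \<nu>) (slab \<nu>) (a ^ K / 2)"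
proof unfold_locales
  note props = needle_reward_props[OF \<nu> \<beta> a]
  have node: "node_at (\<T> 1) ((n + 2) * Suc K) \<nu>" by (rule axis.needle_node_at[OF \<nu>])
  have proj: "(\<lambda>x. x 1) \<in> arm_algebra p \<T> \<rightarrow>\<^sub>M tree_algebra (\<T> 1)"
    unfolding arm_algebra_def by (rule measurable_component_singleton[OF one_in])
  have ind: "(\<lambda>x. indicator \<nu> (x 1) :: real) \<in> borel_measurable (arm_algebra p \<T>)"
    by (rule measurable_compose[OF proj borel_measurable_indicator[OF axis.node_at_sets[OF node]]])
  have base_eq: "base_reward n K a = (\<lambda>x. needle_reward n K a \<nu> x - a ^ K / 2 * indicator \<nu> (x 1))"
    by (simp add: needle_reward_def fun_eq_iff)
  show "is_strategy p \<T> S" by (rule S)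
  show "base_reward n K a \<in> borel_measurable (arm_algebra p \<T>)"
    unfolding base_eq using props(1) ind by measurable
  show "needle_reward n K a \<nu> \<in> borel_measurable (arm_algebra p \<T>)" by (rule props(1))
  show "needle_reward n K a \<nu> x \<in> {1 / 4..3 / 4}" for x by (rule props(2))
  show "base_reward n K a x \<in> {1 / 4..3 / 4}" for x
  proof -
    have "a ^ Suc k \<le> a ^ k" for k using a by (intro power_decreasing) auto
    then have "1 / 4 \<le> base_reward n K a x"
      unfolding base_reward_def by (auto intro!: sum_nonneg)
    moreover have "base_reward n K a x \<le> needle_reward n K a \<nu> x"
      using a by (simp add: needle_reward_def)
    ultimately show ?thesis using props(2)[of x] by simp
  qed
  show "slab \<nu> \<in> sets (arm_algebra p \<T>)"
    unfolding slab_def sets_arm_dist[symmetric]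
    using axis.node_at_tree_nodes[OF node] root_node by (intro box_sets) auto
  show "needle_reward n K a \<nu> x = base_reward n K a x" if "x \<in> space (arm_algebra p \<T>)" "x \<notin> slab \<nu>" for x
    using that slab_eq[OF axis.node_at_subset_root[OF node]]
    by (auto simp: needle_reward_def space_arm_algebra)
  show "\<bar>needle_reward n K a \<nu> x - base_reward n K a x\<bar> \<le> a ^ K / 2" for x
    using a by (simp add: needle_reward_def indicator_def)
qed

text \<open>The hypothesis on \<open>K\<close> is exactly what the likelihood argument needs for a
  bump of height \<open>a ^ K / 2\<close> among \<open>2 ^ (n + 2) * 2 ^ (n * K)\<close> candidates,
  up to a spare factor \<open>2 ^ n\<close>.\<close>

lemma strategy_lower_bound:
  fixes S :: "('a, 'z) strategy"
  assumes S: "is_strategy p \<T> S" and T: "1 \<le> T"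
    and \<beta>: "0 \<le> \<beta>" and a: "0 < a" "a \<le> 1 / 4" "a powr (- \<beta>) = 2 ^ n"
    and K: "96 * real T * (a powr (\<beta> + 2)) ^ K \<le> 1"
    and params: "2 ^ n * real q ^ ((n + 2) * (12 * p)) \<le> \<kappa>" "real ((n + 2) * (1 + 12 * p)) \<le> \<Lambda>"
      "0 < \<gamma>" "\<gamma> \<le> 1 / real q ^ (n + 2)"
  shows "\<exists>P\<in>arm_dists p \<T> \<beta> \<gamma> \<kappa> \<Lambda>.
    (\<exists>E\<in>sets (bandit_law P S T). 1 / 6 \<le> measure (bandit_law P S T) E \<and>
      (\<forall>\<omega>\<in>E. real T * (a ^ K / 8) \<le> cumulative_regret P S p \<T> T \<omega>)) \<and>
    (\<exists>E\<in>sets (bandit_law P S T). 1 / 6 \<le> measure (bandit_law P S T) E \<and>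
      (\<forall>\<omega>\<in>E. a ^ K / 8 \<le> simple_regret P S p \<T> T \<omega>))"
proof -
  let ?J = "axis.needles n K" and ?\<Delta> = "a ^ K / 2"
  interpret bandit_strategy p \<T> S by (unfold_locales) (rule S)
  have card: "real (card ?J) = 2 ^ (n + 2) * 2 ^ (n * K)" unfolding axis.card_needles by simp
  have "card ?J \<noteq> 0" by (simp add: axis.card_needles)
  then have fin: "finite ?J" by (rule card_ge_0_finite[OF neq0_conv[THEN iffD1]])
  have "(4 :: nat) * 1 \<le> 2 ^ (n + 2) * 2 ^ (n * K)" by (intro mult_mono) simp_all
  then have four: "4 \<le> card ?J" unfolding axis.card_needles by simp
  have disj: "disjoint_family_on slab ?J"
    unfolding disjoint_family_on_def
  proof (intro ballI impI)
    fix \<nu> \<nu>' assume \<nu>: "\<nu> \<in> ?J" "\<nu>' \<in> ?J" "\<nu> \<noteq> \<nu>'"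
    then show "slab \<nu> \<inter> slab \<nu>' = {}"
      using axis.needles_disjoint[OF \<nu>] slab_eq[OF axis.node_at_subset_root[OF axis.needle_node_at]]
      by blast
  qed
  have small: "1536 * ?\<Delta>\<^sup>2 * real T \<le> real (card ?J)"
  proof -
    have "(a powr (- \<beta>)) ^ K * (a powr (\<beta> + 2)) ^ K = (a ^ 2) ^ K"
      unfolding power_mult_distrib[symmetric] powr_add[symmetric]
      using a by (simp add: powr_numeral)
    then have "(a ^ K)\<^sup>2 = 2 ^ (n * K) * (a powr (\<beta> + 2)) ^ K"
      unfolding a(3) by (simp add: power_mult[symmetric] mult.commute)
    \<comment> \<open>Squaring the bump height leaves \<open>1536 / 4 = 4 * 96\<close>; the 4 is
      matched by the fourfold supply of needles, which is the origin of the constant 96.\<close>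
    then have "1536 * ?\<Delta>\<^sup>2 * real T = 4 * 2 ^ (n * K) * (96 * real T * (a powr (\<beta> + 2)) ^ K)"
      by (simp add: power_divide)
    also have "\<dots> \<le> 4 * 2 ^ (n * K) * 1" by (intro mult_left_mono K) simp
    also have "\<dots> \<le> 2 ^ (n + 2) * 2 ^ (n * K)" by simp
    finally show ?thesis unfolding card .
  qed
  obtain \<nu> where \<nu>: "\<nu> \<in> ?J" and events:
    "\<exists>E\<in>sets (bandit_law (\<lambda>x. bernoulli_arm (needle_reward n K a \<nu> x)) S T).
      1 / 6 \<le> measure (bandit_law (\<lambda>x. bernoulli_arm (needle_reward n K a \<nu> x)) S T) E \<and>
      (\<forall>\<omega>\<in>E. visits (slab \<nu>) T (fst \<omega>) \<le> 3 / 4 * real T)"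
    "\<exists>E\<in>sets (bandit_law (\<lambda>x. bernoulli_arm (needle_reward n K a \<nu> x)) S T).
      1 / 6 \<le> measure (bandit_law (\<lambda>x. bernoulli_arm (needle_reward n K a \<nu> x)) S T) E \<and>
      (\<forall>\<omega>\<in>E. returned_arm S T \<omega> \<in> space (arm_algebra p \<T>) - slab \<nu>)"
    using needle_lower_bound[OF T fin four needle_bandit_pair[OF S _ \<beta> a] disj small] by blast
  note props = needle_reward_props[OF \<nu> \<beta> a]
  interpret bandit_pair p \<T> S "base_reward n K a" "needle_reward n K a \<nu>" "slab \<nu>" ?\<Delta>
    by (rule needle_bandit_pair[OF S \<nu> \<beta> a])
  have mean: "mean_reward P\<^sub>h = needle_reward n K a \<nu>"
    unfolding mean_reward_def using mean_bernoulli_arm[OF unit_range(2)] by simp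
  have regret: "?\<Delta> * (1 - indicator (slab \<nu>) x) \<le> 3 / 4 - needle_reward n K a \<nu> x"
    if "x \<in> space (arm_algebra p \<T>)" for x
  proof (cases "x \<in> slab \<nu>")
    case True
    then show ?thesis using props(2)[of x] by simp
  next
    case False
    then have "x 1 \<notin> \<nu>"
      using that slab_eq[OF axis.node_at_subset_root[OF axis.needle_node_at[OF \<nu>]]]
      by (simp add: space_arm_algebra)
    then show ?thesis using props(4)[of x] False by simp
  qed
  have "P\<^sub>h \<in> arm_dists p \<T> \<beta> \<gamma> \<kappa> \<Lambda>"
    unfolding arm_dists_def using P\<^sub>h props(5)[OF params] mean by simp
  moreover obtain E where E: "E \<in> sets (bandit_law P\<^sub>h S T)" "1 / 6 \<le> measure (bandit_law P\<^sub>h S T) E"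
    "\<forall>\<omega>\<in>E. visits (slab \<nu>) T (fst \<omega>) \<le> 3 / 4 * real T"
    using events(1) by blast
  have "real T * (a ^ K / 8) \<le> cumulative_regret P\<^sub>h S p \<T> T \<omega>" if \<omega>: "\<omega> \<in> E" for \<omega>
  proof -
    have "\<omega> \<in> space (history_space S T \<Otimes>\<^sub>M rand_space S)"
      using sets.sets_into_space[OF E(1)] bandit_law_props(3)[OF P\<^sub>h T] \<omega> by blast
    then have hist: "fst \<omega> \<in> space (history_space S T)" by (auto simp: space_pair_measure)
    have played: "played_arm S t \<omega> = arm_at t (fst \<omega>)" for t
      by (simp add: played_arm_def arm_at_def split_beta')
    \<comment> \<open>At least a quarter of the plays miss the needle, and each of these costs
      \<open>a ^ K / 2\<close>.\<close>
    have "real T * (a ^ K / 8) = ?\<Delta> * (real T - 3 / 4 * real T)" by simp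
    also have "\<dots> \<le> ?\<Delta> * (real T - visits (slab \<nu>) T (fst \<omega>))"
      using E(3) \<omega> a by (intro mult_left_mono) auto
    also have "\<dots> = (\<Sum>t\<in>{1..T}. ?\<Delta> * (1 - indicator (slab \<nu>) (arm_at t (fst \<omega>))))"
      unfolding sum_distrib_left[symmetric] sum_subtractf visits_def by simp
    also have "\<dots> \<le> (\<Sum>t\<in>{1..T}. 3 / 4 - needle_reward n K a \<nu> (arm_at t (fst \<omega>)))"
      by (intro sum_mono regret measurable_space[OF arm_at_measurable hist])
    also have "\<dots> = cumulative_regret P\<^sub>h S p \<T> T \<omega>"
      unfolding cumulative_regret_def mean props(3) played ..
    finally show ?thesis .
  qed
  moreover obtain E' where E': "E' \<in> sets (bandit_law P\<^sub>h S T)" "1 / 6 \<le> measure (bandit_law P\<^sub>h S T) E'"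
    "\<forall>\<omega>\<in>E'. returned_arm S T \<omega> \<in> space (arm_algebra p \<T>) - slab \<nu>"
    using events(2) by blast
  have "a ^ K / 8 \<le> simple_regret P\<^sub>h S p \<T> T \<omega>" if "\<omega> \<in> E'" for \<omega>
  proof -
    have "?\<Delta> \<le> 3 / 4 - needle_reward n K a \<nu> (returned_arm S T \<omega>)"
      using regret[of "returned_arm S T \<omega>"] E'(3) that by auto
    moreover have "a ^ K / 8 \<le> ?\<Delta>" using a by simp
    ultimately show ?thesis unfolding simple_regret_def mean props(3) by linarith
  qed
  ultimately show ?thesis using E(1,2) E'(1,2) by blast
qed

end

text \<open>Larger \<open>k\<close> hides the needle better but lowers the regret, so the smallest
  admissible one gives the largest rate.\<close>

definition rate_level :: "real \<Rightarrow> nat \<Rightarrow> nat" where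
  "rate_level b T = (LEAST k. 96 * real T * b ^ k \<le> 1)"

lemma rate_level_le:
  assumes "0 < b" "b < 1"
  shows "96 * real T * b ^ rate_level b T \<le> 1"
  unfolding rate_level_def
proof (rule LeastI_ex)
  have pos: "0 < 1 / (96 * real T + 1)" by simp
  obtain k where "b ^ k < 1 / (96 * real T + 1)" using real_arch_pow_inv[OF pos assms(2)] by blast
  then have "(96 * real T + 1) * b ^ k < 1" by (simp add: field_simps)
  moreover have "0 < b ^ k" using assms by simp
  ultimately have "96 * real T * b ^ k \<le> 1" by (simp add: distrib_right)
  then show "\<exists>k. 96 * real T * b ^ k \<le> 1" by blast
qed

text \<open>By minimality the constraint fails one level earlier. Taking the root of order \<beta> +
  2 of that failure gives the power of T, and the level lost costs only the constant factor
  \<open>1 / a\<close>.\<close>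

lemma rate_lower_bound:
  fixes a \<beta> :: real
  assumes a: "0 < a" "a < 1" and \<beta>: "0 \<le> \<beta>"
  shows "(\<lambda>T. real T powr (- 1 / (\<beta> + 2))) \<in> O(\<lambda>T. a ^ rate_level (a powr (\<beta> + 2)) T / 8)"
proof (rule bigoI)
  let ?b = "a powr (\<beta> + 2)" and ?e = "1 / (\<beta> + 2)"
  let ?c = "8 / a * 96 powr ?e"
  have b: "0 < ?b" using a(1) by simp
  have root: "(?b ^ k) powr ?e = a ^ k" for k
  proof -
    have "(?b ^ k) powr ?e = (a ^ k) powr ((\<beta> + 2) * ?e)"
      using a by (simp add: powr_powr powr_realpow[symmetric] mult_ac)
    also have "(\<beta> + 2) * ?e = 1" using \<beta> by simp
    finally show ?thesis using a by simp
  qed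
  show "\<forall>\<^sub>F T in sequentially. norm (real T powr (- 1 / (\<beta> + 2))) \<le> ?c * norm (a ^ rate_level ?b T / 8)"
    using eventually_ge_at_top[of 1]
  proof eventually_elim
    case (elim T)
    let ?k = "rate_level ?b T"
    \<comment> \<open>For \<open>T \<ge> 1\<close> the constraint fails at 0, since 96 > 1; hence
      there is an earlier level to compare with.\<close>
    have "?k \<noteq> 0"
    proof
      assume "?k = 0"
      moreover have "?b < 1"
        using a \<beta> powr_less_mono2[of "\<beta> + 2" a 1] by simp
      ultimately have "96 * real T * ?b ^ 0 \<le> 1" using rate_level_le[OF b, of T] by metis
      then show False using elim by simp
    qed
    then obtain k where k: "?k = Suc k" using not0_implies_Suc by blast
    then have "\<not> 96 * real T * ?b ^ k \<le> 1"
      using not_less_Least[of k "\<lambda>k. 96 * real T * ?b ^ k \<le> 1"] by (simp add: rate_level_def)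
    then have "1 powr ?e \<le> (96 * real T * ?b ^ k) powr ?e"
      using \<beta> by (intro powr_mono2) auto
    also have "\<dots> = 96 powr ?e * real T powr ?e * a ^ k"
      using b by (simp add: powr_mult root)
    finally have "1 \<le> 96 powr ?e * real T powr ?e * a ^ k" by simp
    then have "real T powr (- ?e) * 1 \<le> real T powr (- ?e) * (96 powr ?e * real T powr ?e * a ^ k)"
      by (intro mult_left_mono) auto
    also have "\<dots> = 96 powr ?e * a ^ k"
      using elim by (simp add: powr_minus field_simps)
    also have "\<dots> = ?c * (a ^ ?k / 8)"
      using a by (simp add: k)
    finally show ?case using a by simp
  qed
qed

theorem theorem2:
  fixes p q :: nat and \<T> :: "nat \<Rightarrow> 'a arm_tree" and \<beta> :: real
  assumes "p \<ge> 1"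
    and "\<And>i. i \<in> {1..p} \<Longrightarrow> valid_tree q (\<T> i)"
    and "\<And>i. i \<in> {1..p} \<Longrightarrow> \<exists>!M. is_descent_dist (\<T> i) M"
    and "\<And>i U. i \<in> {1..p} \<Longrightarrow> \<not> is_leaf (\<T> i) U"
    and "\<beta> \<ge> 0"
  shows "\<exists>\<kappa>\<^sub>0>0. \<exists>\<Lambda>\<^sub>0>0. \<exists>\<gamma>\<^sub>0\<in>{0<..<1}. \<exists>\<epsilon>\<^sub>0\<in>{0<..<1}.
    \<forall>\<kappa>\<ge>\<kappa>\<^sub>0. \<forall>\<Lambda>\<ge>\<Lambda>\<^sub>0. \<forall>\<gamma>\<in>{0<..\<gamma>\<^sub>0}. \<forall>\<epsilon>\<in>{0<..\<epsilon>\<^sub>0}.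
      \<exists>r :: nat \<Rightarrow> real. (\<forall>T. r T > 0) \<and> (\<lambda>T. real T powr (- 1 / (\<beta> + 2))) \<in> O(r) \<and>
        (\<forall>S :: ('a, 'z) strategy. is_strategy p \<T> S \<longrightarrow> (\<forall>T\<ge>1.
          (\<exists>P\<in>arm_dists p \<T> \<beta> \<gamma> \<kappa> \<Lambda>. \<exists>E\<in>sets (bandit_law P S T).
             measure (bandit_law P S T) E \<ge> \<epsilon> \<and>
             (\<forall>\<omega>\<in>E. cumulative_regret P S p \<T> T \<omega> \<ge> real T * r T)) \<and>
          (\<exists>P\<in>arm_dists p \<T> \<beta> \<gamma> \<kappa> \<Lambda>. \<exists>E'\<in>sets (bandit_law P S T).
             measure (bandit_law P S T) E' \<ge> \<epsilon> \<and>
             (\<forall>\<omega>\<in>E'. simple_regret P S p \<T> T \<omega> \<ge> r T))))"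
proof -
  interpret leafless_arms p q \<T>
    by unfold_locales (use assms in auto)
  obtain n :: nat and a :: real where a: "0 < a" "a \<le> 1 / 4" "a powr (- \<beta>) = 2 ^ n"
    by (rule scale_exists[OF assms(5)])
  let ?\<kappa> = "2 ^ n * real q ^ ((n + 2) * (12 * p))" and ?\<Lambda> = "real ((n + 2) * (1 + 12 * p))"
    and ?\<gamma> = "1 / real q ^ (n + 2)" and ?K = "rate_level (a powr (\<beta> + 2))"
  have b: "0 < a powr (\<beta> + 2)" "a powr (\<beta> + 2) < 1"
    using a assms(5) powr_less_mono2[of "\<beta> + 2" a 1] by simp_all
  have "0 < ?\<kappa>" using axis.q_ge_2 by simp
  moreover have "0 < ?\<Lambda>" unfolding of_nat_0_less_iff by simp
  moreover have "?\<gamma> \<in> {0<..<1}"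
  proof -
    have "1 < real q ^ (n + 2)" using axis.q_ge_2 by (intro one_less_power) auto
    moreover then have "1 / real q ^ (n + 2) < 1" unfolding divide_less_eq_1 by linarith
    ultimately show ?thesis by simp
  qed
  moreover have "(1 / 6 :: real) \<in> {0<..<1}" by simp
  moreover have "\<exists>r :: nat \<Rightarrow> real. (\<forall>T. r T > 0) \<and> (\<lambda>T. real T powr (- 1 / (\<beta> + 2))) \<in> O(r) \<and>
        (\<forall>S :: ('a, 'z) strategy. is_strategy p \<T> S \<longrightarrow> (\<forall>T\<ge>1.
          (\<exists>P\<in>arm_dists p \<T> \<beta> \<gamma> \<kappa> \<Lambda>. \<exists>E\<in>sets (bandit_law P S T).
             measure (bandit_law P S T) E \<ge> \<epsilon> \<and>
             (\<forall>\<omega>\<in>E. cumulative_regret P S p \<T> T \<omega> \<ge> real T * r T)) \<and>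
          (\<exists>P\<in>arm_dists p \<T> \<beta> \<gamma> \<kappa> \<Lambda>. \<exists>E'\<in>sets (bandit_law P S T).
             measure (bandit_law P S T) E' \<ge> \<epsilon> \<and>
             (\<forall>\<omega>\<in>E'. simple_regret P S p \<T> T \<omega> \<ge> r T))))"
    if params: "?\<kappa> \<le> \<kappa>" "?\<Lambda> \<le> \<Lambda>" "\<gamma> \<in> {0<..?\<gamma>}" and \<epsilon>: "\<epsilon> \<in> {0<..1 / 6}" for \<kappa> \<Lambda> \<gamma> \<epsilon>
  proof (rule exI[of _ "\<lambda>T. a ^ ?K T / 8"], intro conjI allI impI)
    show "0 < a ^ ?K T / 8" for T using a by simp
    show "(\<lambda>T. real T powr (- 1 / (\<beta> + 2))) \<in> O(\<lambda>T. a ^ ?K T / 8)"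
      using a assms(5) by (intro rate_lower_bound) auto
    fix S :: "('a, 'z) strategy" and T :: nat
    assume S: "is_strategy p \<T> S" and T: "1 \<le> T"
    have \<gamma>: "0 < \<gamma>" "\<gamma> \<le> ?\<gamma>" using params(3) by auto
    obtain P E E' where P: "P \<in> arm_dists p \<T> \<beta> \<gamma> \<kappa> \<Lambda>"
      and E: "E \<in> sets (bandit_law P S T)" "1 / 6 \<le> measure (bandit_law P S T) E"
        "\<forall>\<omega>\<in>E. real T * (a ^ ?K T / 8) \<le> cumulative_regret P S p \<T> T \<omega>"
      and E': "E' \<in> sets (bandit_law P S T)" "1 / 6 \<le> measure (bandit_law P S T) E'"
        "\<forall>\<omega>\<in>E'. a ^ ?K T / 8 \<le> simple_regret P S p \<T> T \<omega>"
      using strategy_lower_bound[OF S T assms(5) a rate_level_le[OF b] params(1,2) \<gamma>] by blast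
    have \<epsilon>6: "\<epsilon> \<le> 1 / 6" using \<epsilon> by simp
    show "\<exists>P\<in>arm_dists p \<T> \<beta> \<gamma> \<kappa> \<Lambda>. \<exists>E\<in>sets (bandit_law P S T).
        \<epsilon> \<le> measure (bandit_law P S T) E \<and>
        (\<forall>\<omega>\<in>E. real T * (a ^ ?K T / 8) \<le> cumulative_regret P S p \<T> T \<omega>)"
      using P E order_trans[OF \<epsilon>6] by blast
    show "\<exists>P\<in>arm_dists p \<T> \<beta> \<gamma> \<kappa> \<Lambda>. \<exists>E'\<in>sets (bandit_law P S T).
        \<epsilon> \<le> measure (bandit_law P S T) E' \<and> (\<forall>\<omega>\<in>E'. a ^ ?K T / 8 \<le> simple_regret P S p \<T> T \<omega>)"
      using P E' order_trans[OF \<epsilon>6] by blast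
  qed
  ultimately show ?thesis by blast
qed

end
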